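(* Let $w \colon [0,\infty) \to [0,\infty)$ be a non-decreasing unbounded function. Suppose that there is $C>1$ such that $$\int_0^{\infty} e^{w(t)-w(Ct)}\,\mathrm{d}t < \infty.$$ Let $h\in (0,\infty]$. Define $\mathcal{K}_{(w)}(T_h)$ as the space consisting of all $f \in C^{\infty}(T_h)$ such that $$\sup_{z\in \overline{T_{h'}}}e^{w(N\lvert \operatorname{Re} z\rvert)} \lvert f^{(\alpha)}(z)\rvert < \infty \qquad \text{for all } N \in \mathbb{N},\ \alpha \in \mathbb{N}^2,\ h' \in (0,h).$$ Then the following statements are equivalent: (i) The Cauchy-Riemann operator $\overline{\partial} \colon \mathcal{K}_{(w)}(T_h) \to \mathcal{K}_{(w)}(T_h)$ is surjective. (ii) The Laplace operator $\Delta \colon \mathcal{K}_{(w)}(T_h) \to \mathcal{K}_{(w)}(T_h)$ is surjective. (iii) There exists a holomorphic function in $\mathcal{K}_{(w)}(T_h)$ that is not identically zero. (iv) For all $\mu > 0$, $\displaystyle \int_0^{\infty} w(t) e^{-\mu t}\,\mathrm{d}t < \infty$.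
   Context: For $h \in (0,\infty]$, $T_h = \mathbb{R} + i(-h,h) = \{z\in\mathbb{C} : |\operatorname{Im} z|<h\}$ (so $T_\infty=\mathbb{C}$). $C^\infty(T_h)$ is the space of complex-valued smooth functions on $T_h$ viewed as an open subset of $\mathbb{R}^2$; for $\alpha=(\alpha_1,\alpha_2)\in\mathbb{N}^2$ (multi-indices, including $0$), $f^{(\alpha)} = \partial_x^{\alpha_1}\partial_y^{\alpha_2} f$, where $z=x+iy$. The operators are $\overline{\partial} = \frac12\left(\frac{\partial}{\partial x} + i\frac{\partial}{\partial y}\right)$ and $\Delta = \frac{\partial^2}{\partial x^2}+\frac{\partial^2}{\partial y^2}$. *)

theory Defs
  imports "HOL-Complex_Analysis.Complex_Analysis"
begin

text \<open>
  A function on an open set \<open>U\<close> is represented by a total function of type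
  \<open>complex \<Rightarrow> complex\<close>; only its values on \<open>U\<close> matter, and equations between such
  functions are stated on \<open>U\<close>.
\<close>

definition strip :: "ereal \<Rightarrow> complex set" where
  "strip h = {z. ereal \<bar>Im z\<bar> < h}"

definition has_partial :: "complex \<Rightarrow> (complex \<Rightarrow> complex) \<Rightarrow> complex \<Rightarrow> bool" where
  "has_partial v f z \<longleftrightarrow> (\<lambda>t::real. f (z + t *\<^sub>R v)) differentiable (at 0)"

definition partial :: "complex \<Rightarrow> (complex \<Rightarrow> complex) \<Rightarrow> complex \<Rightarrow> complex" where
  "partial v f z = vector_derivative (\<lambda>t::real. f (z + t *\<^sub>R v)) (at 0)"

abbreviation partial_x :: "(complex \<Rightarrow> complex) \<Rightarrow> complex \<Rightarrow> complex" where
  "partial_x \<equiv> partial 1"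

abbreviation partial_y :: "(complex \<Rightarrow> complex) \<Rightarrow> complex \<Rightarrow> complex" where
  "partial_y \<equiv> partial \<i>"

text \<open>Real differentiability class \<open>C\<^sup>k\<close> on an open set: all partial derivatives up to order
  \<open>k\<close>, taken in any order, exist and are continuous.\<close>

primrec Ck_on :: "nat \<Rightarrow> complex set \<Rightarrow> (complex \<Rightarrow> complex) \<Rightarrow> bool" where
  "Ck_on 0 U f \<longleftrightarrow> continuous_on U f"
| "Ck_on (Suc k) U f \<longleftrightarrow> continuous_on U f \<and>
     (\<forall>z\<in>U. has_partial 1 f z \<and> has_partial \<i> f z) \<and>
     Ck_on k U (partial_x f) \<and> Ck_on k U (partial_y f)"

definition Cinf_on :: "complex set \<Rightarrow> (complex \<Rightarrow> complex) \<Rightarrow> bool" where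
  "Cinf_on U f \<longleftrightarrow> (\<forall>k. Ck_on k U f)"

definition mderiv :: "nat \<times> nat \<Rightarrow> (complex \<Rightarrow> complex) \<Rightarrow> complex \<Rightarrow> complex" where
  "mderiv \<alpha> f = (partial_x ^^ fst \<alpha>) ((partial_y ^^ snd \<alpha>) f)"

definition dbar :: "(complex \<Rightarrow> complex) \<Rightarrow> complex \<Rightarrow> complex" where
  "dbar f z = (1 / 2) * (partial_x f z + \<i> * partial_y f z)"

definition laplace :: "(complex \<Rightarrow> complex) \<Rightarrow> complex \<Rightarrow> complex" where
  "laplace f z = partial_x (partial_x f) z + partial_y (partial_y f) z"

definition K_space :: "(real \<Rightarrow> real) \<Rightarrow> ereal \<Rightarrow> (complex \<Rightarrow> complex) set" where
  "K_space w h = {f. Cinf_on (strip h) f \<and>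
     (\<forall>(N::nat) \<alpha> (h'::real). 0 < h' \<and> ereal h' < h \<longrightarrow>
        bdd_above ((\<lambda>z. exp (w (real N * \<bar>Re z\<bar>)) * cmod (mderiv \<alpha> f z)) `
          closure (strip (ereal h'))))}"

definition surj_op :: "complex set \<Rightarrow> (complex \<Rightarrow> complex) set \<Rightarrow>
    ((complex \<Rightarrow> complex) \<Rightarrow> complex \<Rightarrow> complex) \<Rightarrow> bool" where
  "surj_op U K P \<longleftrightarrow> (\<forall>g\<in>K. \<exists>f\<in>K. \<forall>z\<in>U. P f z = g z)"

end

theory Submission
  imports Defs "HOL-Real_Asymp.Real_Asymp"
begin

text \<open>
  Integrability of \<open>w t * exp (- \<mu> t)\<close> for all \<open>\<mu> > 0\<close> means that \<open>w\<close> grows more slowly than every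
  exponential. A nonzero holomorphic function in the space forces this growth by the maximum principle,
  applied on long rectangles after multiplication by \<open>exp (\<epsilon> sinh (\<mu> z))\<close>. Conversely, slow growth of
  \<open>w\<close> yields an entire function \<open>P\<close> with \<open>P 0 = 1\<close> that decays faster than \<open>exp (- w (N \<bar>x\<bar>))\<close> on every
  horizontal strip, and then \<open>P z * exp (- i \<tau> z) / (\<pi> z)\<close> is a fundamental solution of \<open>dbar\<close>, with a free
  parameter \<open>\<tau>\<close>. Cutting the right-hand side into pieces supported in narrow horizontal strips that
  accumulate at the boundary, and choosing \<open>\<tau>\<close> large for each piece, makes the sum of the
  corresponding convolutions converge. If \<open>dbar\<close> is surjective, correcting a smooth step function of
  \<open>Re z\<close> by a solution \<open>f\<close> gives a holomorphic function with different limits at both ends of the strip;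
  its derivative lies in the space. The Laplacian is handled by \<open>\<Delta> = 4 \<partial>\<close>-bar \<open>\<partial>\<close> and conjugation.
\<close>

subsection \<open>Directional derivatives\<close>

text \<open>A kernel is controlled on horizontal strips only, so it can be convolved only with
  functions supported in a closed substrip, whereas the right-hand side has no uniform bounds near
  the edges (or for large Im z if h is infinite). Solutions for single pieces would thus need
  corrections before they can be summed. The factor exp(-i \<tau> \<omega>) puts the correction into
  the kernel: it is 1 at 0, so the kernel still inverts \<open>dbar\<close>, and its modulus
  exp(\<tau> Im \<omega>) is as small as desired on differences \<omega> = z - \<zeta> with z on one
  fixed side of \<zeta>. This works in one vertical direction at a time, so pieces near the upper
  and the lower edge are summed separately. Decay survives convolution because w(N|x + y|) \<le>
  w(2N|x|) + w(2N|y|) for a nonnegative non-decreasing w, and the space quantifies over all N. Since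
  membership constrains every derivative, closure properties are proved coinductively, one
  differentiation at a time.\<close>

definition has_pd :: "complex \<Rightarrow> (complex \<Rightarrow> complex) \<Rightarrow> complex \<Rightarrow> complex \<Rightarrow> bool" where
  "has_pd v f z D \<longleftrightarrow> ((\<lambda>t::real. f (z + t *\<^sub>R v)) has_vector_derivative D) (at 0)"

lemma has_pd_partial: "has_partial v f z \<Longrightarrow> has_pd v f z (partial v f z)"
  unfolding has_partial_def has_pd_def partial_def by (simp add: vector_derivative_works)

lemma has_pd_imp_partial: "has_pd v f z D \<Longrightarrow> partial v f z = D"
  unfolding has_pd_def partial_def by (rule vector_derivative_at)

lemma has_pd_imp_has_partial: "has_pd v f z D \<Longrightarrow> has_partial v f z"
  unfolding has_pd_def has_partial_def by (rule differentiableI_vector)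

text \<open>Functions matter on U only, so derivative facts must be insensitive to values outside U;
  they are, because z + t v stays in U for small t.\<close>

lemma has_pd_cong_open:
  assumes "open U" "z \<in> U" "\<And>z. z \<in> U \<Longrightarrow> f z = g z" "has_pd v f z D"
  shows "has_pd v g z D"
proof -
  have "((\<lambda>t::real. z + t *\<^sub>R v) \<longlongrightarrow> z + 0 *\<^sub>R v) (at 0)"
    by (intro tendsto_intros)
  hence "eventually (\<lambda>t::real. z + t *\<^sub>R v \<in> U) (at 0)"
    using assms(1,2) by (simp add: topological_tendstoD)
  hence "eventually (\<lambda>t::real. z + t *\<^sub>R v \<in> U) (nhds 0)"
    using assms(2) by (simp add: eventually_nhds_conv_at)
  hence "eventually (\<lambda>t::real. f (z + t *\<^sub>R v) = g (z + t *\<^sub>R v)) (nhds 0)"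
    by eventually_elim (use assms(3) in auto)
  thus ?thesis using assms(4) unfolding has_pd_def
    using has_vector_derivative_cong_ev by (smt (verit, del_insts) UNIV_I eventually_at_filter eventually_mono eventually_nhds_x_imp_x)
qed

lemma has_partial_cong_open:
  assumes "open U" "z \<in> U" "\<And>z. z \<in> U \<Longrightarrow> f z = g z" "has_partial v f z"
  shows "has_partial v g z" "partial v g z = partial v f z"
  using has_pd_cong_open[OF assms(1,2,3) has_pd_partial[OF assms(4)]]
  by (auto intro: has_pd_imp_has_partial has_pd_imp_partial)

text \<open>\<open>has_pd\<close> differentiates at parameter 0 only. Moving the base point along
  the line makes one-variable calculus on a whole segment available.\<close>

lemma has_pd_shift:
  assumes "has_pd v f (z + s *\<^sub>R v) D"
  shows "((\<lambda>t::real. f (z + t *\<^sub>R v)) has_vector_derivative D) (at s)"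
proof -
  have "((\<lambda>t::real. t - s) has_vector_derivative 1) (at s)"
    by (auto intro!: derivative_eq_intros)
  moreover have "((\<lambda>t::real. f ((z + s *\<^sub>R v) + t *\<^sub>R v)) has_vector_derivative D) (at (s - s))"
    using assms by (simp add: has_pd_def)
  ultimately have "(((\<lambda>t::real. f ((z + s *\<^sub>R v) + t *\<^sub>R v)) \<circ> (\<lambda>t. t - s)) has_vector_derivative 1 *\<^sub>R D) (at s)"
    by (rule vector_diff_chain_at)
  thus ?thesis by (simp add: o_def algebra_simps)
qed

lemma has_pd_add: "has_pd v f z D \<Longrightarrow> has_pd v g z E \<Longrightarrow> has_pd v (\<lambda>z. f z + g z) z (D + E)"
  unfolding has_pd_def by (rule has_vector_derivative_add)

lemma has_pd_mult:
  "has_pd v f z D \<Longrightarrow> has_pd v g z E \<Longrightarrow> has_pd v (\<lambda>z. f z * g z) z (f z * E + D * g z)"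
  unfolding has_pd_def by (drule (1) has_vector_derivative_mult) simp

lemma has_pd_const: "has_pd v (\<lambda>z. c) z 0"
  unfolding has_pd_def by simp

lemma has_pd_cmult: "has_pd v f z D \<Longrightarrow> has_pd v (\<lambda>z. c * f z) z (c * D)"
  using has_pd_mult[OF has_pd_const] by force

lemma has_pd_cnj: "has_pd v f z D \<Longrightarrow> has_pd v (\<lambda>z. cnj (f z)) z (cnj D)"
  unfolding has_pd_def
  by (rule bounded_linear.has_vector_derivative[OF bounded_linear_cnj])

lemma vector_mvt_bound:
  fixes f :: "real \<Rightarrow> complex"
  assumes "a \<le> b" "\<And>t. a \<le> t \<Longrightarrow> t \<le> b \<Longrightarrow> (f has_vector_derivative f' t) (at t)"
    and "\<And>t. a \<le> t \<Longrightarrow> t \<le> b \<Longrightarrow> norm (f' t) \<le> B"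
  shows "norm (f b - f a) \<le> B * (b - a)"
proof -
  have "norm (f b - f a) \<le> B * norm (b - a)"
  proof (rule differentiable_bound[where S="{a..b}" and f'="\<lambda>t s. s *\<^sub>R f' t"])
    fix t assume "t \<in> {a..b}"
    thus "(f has_derivative (\<lambda>s. s *\<^sub>R f' t)) (at t within {a..b})"
      using assms(2)[of t] has_derivative_at_withinI by (auto simp: has_vector_derivative_def)
    have "onorm (\<lambda>s. s *\<^sub>R f' t) \<le> norm (f' t)"
      by (rule onorm_le) (simp add: mult.commute)
    thus "onorm (\<lambda>s. s *\<^sub>R f' t) \<le> B"
      using assms(3)[of t] \<open>t \<in> {a..b}\<close> by simp
  qed (use assms(1) in auto)
  thus ?thesis using assms(1) by simp
qed

text \<open>Two applications of the mean value inequality: along v to the u-increment of f, whose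
  derivative is the u-increment of \<open>f1\<close>, and along u to \<open>f1\<close> itself.
  Subtracting the linear terms turns continuity of \<open>f12\<close> at z into the error factor
  e.\<close>

lemma second_difference_bound:
  assumes U: "open U" "z \<in> U"
    and f1: "\<And>z. z \<in> U \<Longrightarrow> has_pd v f z (f1 z)"
    and f12: "\<And>z. z \<in> U \<Longrightarrow> has_pd u f1 z (f12 z)"
    and cont: "continuous_on U f12" and e: "0 < e"
  shows "\<exists>d>0. \<forall>s t. 0 < s \<and> s < d \<and> 0 < t \<and> t < d \<longrightarrow>
    norm (f (z + s *\<^sub>R v + t *\<^sub>R u) - f (z + s *\<^sub>R v) - f (z + t *\<^sub>R u) + f z
       - (s * t) *\<^sub>R f12 z) \<le> e * (s * t)"
proof -
  obtain r1 where r1: "r1 > 0" "ball z r1 \<subseteq> U" using U open_contains_ball by blast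
  have "continuous (at z) f12" using cont U by (simp add: continuous_on_eq_continuous_at)
  then obtain r2 where r2: "r2 > 0" "\<And>y. dist y z < r2 \<Longrightarrow> norm (f12 y - f12 z) < e"
    using e by (auto simp: continuous_at_eps_delta dist_norm)
  define r where "r = min r1 r2"
  have r: "r > 0" "\<And>y. norm (y - z) < r \<Longrightarrow> y \<in> U \<and> norm (f12 y - f12 z) \<le> e"
    using r1 r2 by (force simp: r_def dist_norm norm_minus_commute)+
  \<comment> \<open>The divisor keeps the parallelogram with sides d v and d u inside the ball of
    radius r; the summand 1 makes it nonzero and the inclusion strict.\<close>
  define d where "d = r / (norm u + norm v + 1)"
  have nn: "norm u + norm v + 1 > 0" by (simp add: add_nonneg_pos)
  have d: "d > 0" using r nn by (simp add: d_def)
  have inball: "norm (z + s *\<^sub>R v + t *\<^sub>R u - z) < r" if "0 \<le> s" "s < d" "0 \<le> t" "t < d" for s t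
  proof -
    have "norm (z + s *\<^sub>R v + t *\<^sub>R u - z) \<le> s * norm v + t * norm u"
      using norm_triangle_ineq[of "s *\<^sub>R v" "t *\<^sub>R u"] that by simp
    also have "\<dots> \<le> d * norm v + d * norm u"
      using that by (intro add_mono mult_right_mono) auto
    also have "\<dots> < d * (norm u + norm v + 1)" using d by (simp add: algebra_simps)
    also have "\<dots> = r" using nn by (simp add: d_def)
    finally show ?thesis .
  qed
  show ?thesis
  proof (intro exI conjI allI impI)
    fix s t assume st: "0 < s \<and> s < d \<and> 0 < t \<and> t < d"
    define p where "p = (\<lambda>\<sigma>. f (z + t *\<^sub>R u + \<sigma> *\<^sub>R v) - f (z + \<sigma> *\<^sub>R v) - \<sigma> *\<^sub>R (t *\<^sub>R f12 z))"
    have "norm (p s - p 0) \<le> (e * t) * (s - 0)"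
    proof (rule vector_mvt_bound)
      fix \<sigma> assume sg: "0 \<le> \<sigma>" "\<sigma> \<le> s"
      have in1: "z + \<sigma> *\<^sub>R v \<in> U" using inball[of \<sigma> 0] sg st d r(2) by force
      have in2: "z + t *\<^sub>R u + \<sigma> *\<^sub>R v \<in> U" using inball[of \<sigma> t] sg st d r(2)
        by (smt (verit, best) add.assoc add.commute)
      show "(p has_vector_derivative f1 (z + t *\<^sub>R u + \<sigma> *\<^sub>R v) - f1 (z + \<sigma> *\<^sub>R v) - t *\<^sub>R f12 z) (at \<sigma>)"
        unfolding p_def
        by (intro has_vector_derivative_diff has_pd_shift f1 in1 in2)
          (auto intro!: derivative_eq_intros simp: has_vector_derivative_def)
      define q where "q = (\<lambda>\<tau>. f1 (z + \<sigma> *\<^sub>R v + \<tau> *\<^sub>R u) - \<tau> *\<^sub>R f12 z)"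
      have "norm (q t - q 0) \<le> e * (t - 0)"
      proof (rule vector_mvt_bound)
        fix \<tau> assume ta: "0 \<le> \<tau>" "\<tau> \<le> t"
        have *: "norm (z + \<sigma> *\<^sub>R v + \<tau> *\<^sub>R u - z) < r" using inball ta sg st by auto
        show "(q has_vector_derivative f12 (z + \<sigma> *\<^sub>R v + \<tau> *\<^sub>R u) - f12 z) (at \<tau>)"
          unfolding q_def
          by (intro has_vector_derivative_diff has_pd_shift f12) 
             (use r(2)[OF *] in \<open>auto intro!: derivative_eq_intros simp: has_vector_derivative_def\<close>)
        show "norm (f12 (z + \<sigma> *\<^sub>R v + \<tau> *\<^sub>R u) - f12 z) \<le> e" using r(2)[OF *] by simp
      qed (use st in auto)
      thus "norm (f1 (z + t *\<^sub>R u + \<sigma> *\<^sub>R v) - f1 (z + \<sigma> *\<^sub>R v) - t *\<^sub>R f12 z) \<le> e * t"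
        by (simp add: q_def algebra_simps)
    qed (use st in auto)
    thus "norm (f (z + s *\<^sub>R v + t *\<^sub>R u) - f (z + s *\<^sub>R v) - f (z + t *\<^sub>R u) + f z
       - (s * t) *\<^sub>R f12 z) \<le> e * (s * t)"
      by (simp add: p_def algebra_simps)
  qed (rule d)
qed

text \<open>Schwarz's theorem: the mixed second difference is symmetric in the two increments, so it
  approximates both mixed derivatives.\<close>

lemma mixed_partials_eq:
  assumes U: "open U" "z \<in> U"
    and f1: "\<And>z. z \<in> U \<Longrightarrow> has_pd v f z (f1 z)"
    and f12: "\<And>z. z \<in> U \<Longrightarrow> has_pd u f1 z (f12 z)" "continuous_on U f12"
    and f2: "\<And>z. z \<in> U \<Longrightarrow> has_pd u f z (f2 z)"
    and f21: "\<And>z. z \<in> U \<Longrightarrow> has_pd v f2 z (f21 z)" "continuous_on U f21"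
  shows "f12 z = f21 z"
proof (rule ccontr)
  assume ne: "f12 z \<noteq> f21 z"
  \<comment> \<open>A third of the gap: the two approximations put the mixed derivatives within 2 e
    of each other, which is less than 3 e.\<close>
  define e where "e = norm (f12 z - f21 z) / 3"
  have e: "e > 0" using ne by (simp add: e_def)
  obtain d1 where d1: "d1 > 0" "\<And>s t. 0 < s \<and> s < d1 \<and> 0 < t \<and> t < d1 \<Longrightarrow>
    norm (f (z + s *\<^sub>R v + t *\<^sub>R u) - f (z + s *\<^sub>R v) - f (z + t *\<^sub>R u) + f z
       - (s * t) *\<^sub>R f12 z) \<le> e * (s * t)"
    using second_difference_bound[OF U f1 f12 e] by blast
  obtain d2 where d2: "d2 > 0" "\<And>s t. 0 < s \<and> s < d2 \<and> 0 < t \<and> t < d2 \<Longrightarrow>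
    norm (f (z + s *\<^sub>R u + t *\<^sub>R v) - f (z + s *\<^sub>R u) - f (z + t *\<^sub>R v) + f z
       - (s * t) *\<^sub>R f21 z) \<le> e * (s * t)"
    using second_difference_bound[OF U f2 f21 e] by blast
  define s where "s = min d1 d2 / 2"
  have s: "0 < s" "s < d1" "s < d2" using d1 d2 by (auto simp: s_def)
  have "(s * s) *\<^sub>R (f12 z - f21 z)
     = (f (z + s *\<^sub>R u + s *\<^sub>R v) - f (z + s *\<^sub>R u) - f (z + s *\<^sub>R v) + f z - (s * s) *\<^sub>R f21 z)
      - (f (z + s *\<^sub>R v + s *\<^sub>R u) - f (z + s *\<^sub>R v) - f (z + s *\<^sub>R u) + f z - (s * s) *\<^sub>R f12 z)"
    by (simp add: algebra_simps)
  also have "norm \<dots> \<le> e * (s * s) + e * (s * s)"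
    by (rule norm_triangle_le_diff) (intro add_mono d1 d2, use s in auto)
  finally have "(s * s) * norm (f12 z - f21 z) \<le> (s * s) * (2 * e)"
    unfolding norm_scaleR by (simp add: mult_ac)
  hence "norm (f12 z - f21 z) \<le> 2 * e" using s by (simp add: mult_le_cancel_left_pos)
  thus False using e by (simp add: e_def)
qed

text \<open>For total differentiability, continuity of one of the two partial derivatives suffices.
  The criterion lives on a product, so f is read as a function of two real variables on a product
  neighbourhood of z.\<close>

lemma C1_has_derivative:
  assumes U: "open U" "z \<in> U"
    and fx: "\<And>z. z \<in> U \<Longrightarrow> has_pd 1 f z (fx z)" and fy: "\<And>z. z \<in> U \<Longrightarrow> has_pd \<i> f z (fy z)"
    and cfy: "continuous_on U fy"
  shows "(f has_derivative (\<lambda>h. Re h *\<^sub>R fx z + Im h *\<^sub>R fy z)) (at z)"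
proof -
  define x y where "x = Re z" and "y = Im z"
  have cC: "continuous_on UNIV (\<lambda>(x, y). Complex x y)"
    unfolding Complex_eq case_prod_beta by (intro continuous_intros)
  have "open ((\<lambda>(x, y). Complex x y) -` U)" using open_vimage[OF U(1) cC] .
  moreover have "(x, y) \<in> (\<lambda>(x, y). Complex x y) -` U" using U(2) by (simp add: x_def y_def)
  ultimately obtain A B where AB: "open A" "open B" "(x, y) \<in> A \<times> B" "A \<times> B \<subseteq> (\<lambda>(x, y). Complex x y) -` U"
    by (rule open_prod_elim)
  then obtain e where e: "e > 0" "ball y e \<subseteq> B" using open_contains_ball by (metis SigmaD2)
  define Y where "Y = ball y e"
  have Y: "open Y" "convex Y" "y \<in> Y" using e by (auto simp: Y_def)
  have x: "x \<in> A" using AB by simp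
  have inU: "Complex a b \<in> U" if "a \<in> A" "b \<in> Y" for a b 
  proof -
    have "(a, b) \<in> A \<times> B" using e(2) that by (auto simp: Y_def)
    thus ?thesis using AB(4) by auto
  qed
  have 1: "((\<lambda>x. f (Complex x y)) has_derivative (\<lambda>t. t *\<^sub>R fx (Complex x y))) (at x)"
    using has_pd_shift[OF fx, of "Complex 0 y" x] inU[OF x Y(3)]
    by (simp add: has_vector_derivative_def complex_eq_iff Complex_eq algebra_simps scaleR_conv_of_real)
  have 2: "((\<lambda>y. f (Complex x y)) has_derivative blinfun_apply (blinfun_scaleR_left (fy (Complex x y)))) (at y)"
    if "x \<in> A" "y \<in> Y" for x y
    using has_pd_shift[OF fy, of "Complex x 0" y] inU[OF that]
    by (simp add: has_vector_derivative_def complex_eq_iff Complex_eq algebra_simps scaleR_conv_of_real)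
  have c: "continuous_on (A \<times> Y) (\<lambda>(x, y). fy (Complex x y))"
    using continuous_on_compose2[OF cfy continuous_on_subset[OF cC subset_UNIV, of "A \<times> Y"]] inU
    by (force simp: case_prod_beta)
  have "continuous_on (A \<times> Y) (\<lambda>(x, y). blinfun_scaleR_left (fy (Complex x y)))"
    using c unfolding case_prod_beta by (intro continuous_intros)
  hence 3: "continuous (at (x, y) within A \<times> Y) (\<lambda>(x, y). blinfun_scaleR_left (fy (Complex x y)))"
    using x Y by (simp add: continuous_on_eq_continuous_within)
  have "((\<lambda>(x, y). f (Complex x y)) has_derivative
     (\<lambda>(tx, ty). tx *\<^sub>R fx (Complex x y) + blinfun_apply (blinfun_scaleR_left (fy (Complex x y))) ty)) (at (x, y) within A \<times> Y)"
    by (rule has_derivative_partialsI[OF _ _ 3 Y(3,2)])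
      (use 1 2 in \<open>auto intro: has_derivative_at_withinI\<close>)
  moreover have "at (x, y) within A \<times> Y = at (x, y)"
    by (rule at_within_open) (use x Y AB in \<open>auto intro: open_Times\<close>)
  ultimately have A: "((\<lambda>(x, y). f (Complex x y)) has_derivative
     (\<lambda>(tx, ty). tx *\<^sub>R fx z + ty *\<^sub>R fy z)) (at (Re z, Im z))"
    by (simp add: x_def y_def)
  have B: "((\<lambda>z. (Re z, Im z)) has_derivative (\<lambda>h. (Re h, Im h))) (at z)"
    by (auto intro!: derivative_eq_intros)
  show ?thesis
    using diff_chain_at[OF B A] by (simp add: o_def)
qed

subsection \<open>Smooth functions and the weighted spaces\<close>

lemma open_strip: "open (strip h)"
proof -
  have "continuous_on UNIV (\<lambda>z. ereal \<bar>Im z\<bar>)" by (intro continuous_intros)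
  moreover have "strip h = (\<lambda>z. ereal \<bar>Im z\<bar>) -` {..<h}" by (auto simp: strip_def)
  ultimately show ?thesis by (simp add: open_vimage)
qed

lemma closure_strip_subset: "closure (strip (ereal c)) \<subseteq> {z. \<bar>Im z\<bar> \<le> c}"
proof (rule closure_minimal)
  show "closed {z. \<bar>Im z\<bar> \<le> c}"
    by (intro closed_Collect_le continuous_intros)
qed (auto simp: strip_def)

section \<open>Iterated partial derivatives and smoothness by coinduction\<close>

definition dirs :: "complex set" where "dirs = {1, \<i>}"

text \<open>Words in the two directions replace multi-indices: a letter can be added at either end,
  so differentiating a derivative requires no commutation. The last letter is the first derivative
  taken.\<close>

definition pd :: "complex list \<Rightarrow> (complex \<Rightarrow> complex) \<Rightarrow> complex \<Rightarrow> complex" where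
  "pd vs f = foldr partial vs f"

lemma pd_simps [simp]: "pd [] f = f" "pd (v # vs) f = partial v (pd vs f)"
  "pd (us @ vs) f = pd us (pd vs f)"
  by (simp_all add: pd_def)

text \<open>The parameter \<Phi> is an estimate imposed on all derivatives at once. Its instances
  are the trivial one for plain smoothness, \<open>wbd\<close> for \<open>K_space\<close>,
  \<open>wbd_on\<close> and \<open>bounded_on_strips\<close> for cutoffs, and \<open>rapid\<close>
  for the densities of convolutions.\<close>

definition smooth :: "complex set \<Rightarrow> ((complex \<Rightarrow> complex) \<Rightarrow> bool) \<Rightarrow> (complex \<Rightarrow> complex) \<Rightarrow> bool" where
  "smooth U \<Phi> f \<longleftrightarrow> (\<forall>vs. set vs \<subseteq> dirs \<longrightarrow> continuous_on U (pd vs f) \<and> \<Phi> (pd vs f) \<and>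
     (\<forall>v\<in>dirs. \<forall>z\<in>U. has_partial v (pd vs f) z))"

definition local_to :: "complex set \<Rightarrow> ((complex \<Rightarrow> complex) \<Rightarrow> bool) \<Rightarrow> bool" where
  "local_to U \<Phi> \<longleftrightarrow> (\<forall>f g. (\<forall>z\<in>U. f z = g z) \<longrightarrow> \<Phi> f \<longrightarrow> \<Phi> g)"

lemma local_toD: "local_to U \<Phi> \<Longrightarrow> \<Phi> f \<Longrightarrow> (\<And>z. z \<in> U \<Longrightarrow> f z = g z) \<Longrightarrow> \<Phi> g"
  unfolding local_to_def by blast

text \<open>By induction on the word, each iterated derivative of f agrees on U with a member of X.
  Closure properties then only need a class X that is stable under one differentiation, and no
  formula for higher derivatives.\<close>

lemma smooth_coinduct:
  assumes U: "open U" "local_to U \<Phi>" and X: "X f"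
    and step: "\<And>f. X f \<Longrightarrow> continuous_on U f \<and> \<Phi> f \<and>
      (\<forall>v\<in>dirs. \<exists>g. X g \<and> (\<forall>z\<in>U. has_pd v f z (g z)))"
  shows "smooth U \<Phi> f"
proof -
  have main: "\<exists>g. X g \<and> (\<forall>z\<in>U. pd vs f z = g z)" if "set vs \<subseteq> dirs" for vs
    using that
  proof (induction vs)
    case Nil thus ?case using X by auto
  next
    case (Cons v vs)
    then obtain g where g: "X g" "\<And>z. z \<in> U \<Longrightarrow> pd vs f z = g z" by auto
    from Cons.prems have "v \<in> dirs" by simp
    then obtain g' where g': "X g'" "\<forall>z\<in>U. has_pd v g z (g' z)" using step[OF g(1)] by blast
    have "partial v (pd vs f) z = g' z" if "z \<in> U" for z
      by (rule has_pd_imp_partial, rule has_pd_cong_open[OF U(1) that])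
        (use g g' that in auto)
    thus ?case using g' by auto
  qed
  show ?thesis unfolding smooth_def
  proof (intro allI impI)
    fix vs assume "set vs \<subseteq> dirs"
    from main[OF this] obtain g where g: "X g" "\<And>z. z \<in> U \<Longrightarrow> pd vs f z = g z" by blast
    note s = step[OF g(1)]
    have "continuous_on U (pd vs f)" using s g(2) by (metis continuous_on_cong)
    moreover have "\<Phi> (pd vs f)" using local_toD[OF U(2)] s g(2) by metis
    moreover have "has_partial v (pd vs f) z" if "v \<in> dirs" "z \<in> U" for v z
    proof -
      obtain g' where "\<forall>z\<in>U. has_pd v g z (g' z)" using s \<open>v \<in> dirs\<close> by blast
      thus ?thesis using has_partial_cong_open(1)[OF U(1) \<open>z \<in> U\<close>, of g "pd vs f"] g(2) that
        by (metis has_pd_imp_has_partial)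
    qed
    ultimately show "continuous_on U (pd vs f) \<and> \<Phi> (pd vs f) \<and> (\<forall>v\<in>dirs. \<forall>z\<in>U. has_partial v (pd vs f) z)"
      by blast
  qed
qed

lemma smooth_continuous: "smooth U \<Phi> f \<Longrightarrow> continuous_on U f"
  and smooth_prop: "smooth U \<Phi> f \<Longrightarrow> \<Phi> f"
  and smooth_has_partial: "smooth U \<Phi> f \<Longrightarrow> v \<in> dirs \<Longrightarrow> z \<in> U \<Longrightarrow> has_partial v f z"
  unfolding smooth_def by (auto dest: spec[of _ "[]"])

lemma smooth_has_pd: "smooth U \<Phi> f \<Longrightarrow> v \<in> dirs \<Longrightarrow> z \<in> U \<Longrightarrow> has_pd v f z (partial v f z)"
  by (intro has_pd_partial smooth_has_partial)

lemma smooth_partial: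
  assumes "smooth U \<Phi> f" "v \<in> dirs" shows "smooth U \<Phi> (partial v f)"
  unfolding smooth_def
proof (intro allI impI)
  fix vs assume "set vs \<subseteq> dirs"
  hence "set (vs @ [v]) \<subseteq> dirs" using assms(2) by simp
  from assms(1)[unfolded smooth_def, rule_format, OF this]
  show "continuous_on U (pd vs (partial v f)) \<and> \<Phi> (pd vs (partial v f)) \<and>
         (\<forall>va\<in>dirs. \<forall>z\<in>U. has_partial va (pd vs (partial v f)) z)" by simp
qed

lemma smooth_pd: "smooth U \<Phi> f \<Longrightarrow> set vs \<subseteq> dirs \<Longrightarrow> smooth U \<Phi> (pd vs f)"
  by (induction vs) (auto intro: smooth_partial)

lemma smooth_mono: "smooth U \<Phi> f \<Longrightarrow> (\<And>f. \<Phi> f \<Longrightarrow> \<Psi> f) \<Longrightarrow> smooth U \<Psi> f"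
  unfolding smooth_def by blast

lemma one_dirs [simp]: "1 \<in> dirs" and ii_dirs [simp]: "\<i> \<in> dirs" by (auto simp: dirs_def)

lemma smooth_linear:
  assumes U: "open U" "local_to U \<Phi>"
    and L\<Phi>: "\<And>f. \<Phi> f \<Longrightarrow> \<Phi> (\<lambda>z. L (f z))" and L: "bounded_linear L"
    and f: "smooth U \<Phi> f"
  shows "smooth U \<Phi> (\<lambda>z. L (f z))"
proof (rule smooth_coinduct[OF U, where X="\<lambda>g. \<exists>f. smooth U \<Phi> f \<and> g = (\<lambda>z. L (f z))"])
  fix g assume "\<exists>f. smooth U \<Phi> f \<and> g = (\<lambda>z. L (f z))"
  then obtain f where f: "smooth U \<Phi> f" and g: "g = (\<lambda>z. L (f z))" by blast
  have "has_pd v g z (L (partial v f z))" if "v \<in> dirs" "z \<in> U" for v z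
    unfolding g has_pd_def using smooth_has_pd[OF f that, unfolded has_pd_def]
    by (rule bounded_linear.has_vector_derivative[OF L])
  moreover have "continuous_on U g" unfolding g
    using smooth_continuous[OF f] by (rule bounded_linear.continuous_on[OF L])
  ultimately show "continuous_on U g \<and> \<Phi> g \<and> (\<forall>v\<in>dirs. \<exists>g'.
      (\<exists>f. smooth U \<Phi> f \<and> g' = (\<lambda>z. L (f z))) \<and> (\<forall>z\<in>U. has_pd v g z (g' z)))"
    using smooth_partial[OF f] L\<Phi>[OF smooth_prop[OF f]] g by blast
qed (use f in auto)

lemma has_pd_sum_list:
  assumes "\<And>p. p \<in> set ps \<Longrightarrow> has_pd v (F p) z (F' p)"
  shows "has_pd v (\<lambda>z. \<Sum>p\<leftarrow>ps. F p z) z (\<Sum>p\<leftarrow>ps. F' p)"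
  using assms
proof (induction ps)
  case Nil thus ?case by (simp add: has_pd_const)
next
  case (Cons p ps)
  thus ?case by (auto intro!: has_pd_add)
qed

text \<open>Leibniz' rule: finite sums of products \<open>a * b\<close>, encoded as lists of pairs, are closed
  under partial derivatives.\<close>

lemma smooth_mult:
  assumes U: "open U" "local_to U \<Phi>"
    and zero: "\<Phi> (\<lambda>_. 0)" and add: "\<And>f g. \<Phi> f \<Longrightarrow> \<Phi> g \<Longrightarrow> \<Phi> (\<lambda>z. f z + g z)"
    and mult: "\<And>a b. \<Phi>\<^sub>1 a \<Longrightarrow> \<Phi>\<^sub>2 b \<Longrightarrow> \<Phi> (\<lambda>z. a z * b z)"
    and a: "smooth U \<Phi>\<^sub>1 a" and b: "smooth U \<Phi>\<^sub>2 b"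
  shows "smooth U \<Phi> (\<lambda>z. a z * b z)"
proof (rule smooth_coinduct[OF U, where X="\<lambda>f. \<exists>ps. (\<forall>p\<in>set ps. smooth U \<Phi>\<^sub>1 (fst p) \<and> smooth U \<Phi>\<^sub>2 (snd p))
     \<and> f = (\<lambda>z. \<Sum>p\<leftarrow>ps. fst p z * snd p z)"])
  show "\<exists>ps. (\<forall>p\<in>set ps. smooth U \<Phi>\<^sub>1 (fst p) \<and> smooth U \<Phi>\<^sub>2 (snd p))
     \<and> (\<lambda>z. a z * b z) = (\<lambda>z. \<Sum>p\<leftarrow>ps. fst p z * snd p z)"
    by (intro exI[of _ "[(a, b)]"]) (use a b in auto)
next
  fix f assume "\<exists>ps. (\<forall>p\<in>set ps. smooth U \<Phi>\<^sub>1 (fst p) \<and> smooth U \<Phi>\<^sub>2 (snd p))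
     \<and> f = (\<lambda>z. \<Sum>p\<leftarrow>ps. fst p z * snd p z)"
  then obtain ps where ps: "\<And>p. p \<in> set ps \<Longrightarrow> smooth U \<Phi>\<^sub>1 (fst p) \<and> smooth U \<Phi>\<^sub>2 (snd p)"
    and f: "f = (\<lambda>z. \<Sum>p\<leftarrow>ps. fst p z * snd p z)" by blast
  have "continuous_on U f \<and> \<Phi> f" unfolding f using ps
  proof (induction ps)
    case Nil thus ?case by (simp add: zero)
  next
    case (Cons p ps)
    have "continuous_on U (\<lambda>z. fst p z * snd p z)"
      using Cons.prems[of p] by (intro continuous_on_mult) (auto intro: smooth_continuous)
    moreover have "\<Phi> (\<lambda>z. fst p z * snd p z)"
      using Cons.prems[of p] by (intro mult) (auto intro: smooth_prop)
    ultimately show ?case using Cons by (auto intro!: add continuous_on_add)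
  qed
  moreover have "\<exists>g. (\<exists>ps. (\<forall>p\<in>set ps. smooth U \<Phi>\<^sub>1 (fst p) \<and> smooth U \<Phi>\<^sub>2 (snd p))
     \<and> g = (\<lambda>z. \<Sum>p\<leftarrow>ps. fst p z * snd p z)) \<and> (\<forall>z\<in>U. has_pd v f z (g z))"
    if v: "v \<in> dirs" for v
  proof -
    define qs where "qs = map (\<lambda>p. (partial v (fst p), snd p)) ps @ map (\<lambda>p. (fst p, partial v (snd p))) ps"
    have "\<forall>p\<in>set qs. smooth U \<Phi>\<^sub>1 (fst p) \<and> smooth U \<Phi>\<^sub>2 (snd p)"
      unfolding qs_def using ps v by (auto intro!: smooth_partial)
    moreover have "has_pd v f z (\<Sum>p\<leftarrow>qs. fst p z * snd p z)" if z: "z \<in> U" for z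
    proof -
      have "has_pd v f z (\<Sum>p\<leftarrow>ps. fst p z * partial v (snd p) z + partial v (fst p) z * snd p z)"
        unfolding f by (intro has_pd_sum_list has_pd_mult) (use ps v z smooth_has_pd in blast)+
      also have "(\<Sum>p\<leftarrow>ps. fst p z * partial v (snd p) z + partial v (fst p) z * snd p z)
          = (\<Sum>p\<leftarrow>qs. fst p z * snd p z)"
        unfolding qs_def by (simp add: sum_list_addf o_def)
      finally show ?thesis .
    qed
    ultimately show ?thesis by blast
  qed
  ultimately show "continuous_on U f \<and> \<Phi> f \<and> (\<forall>v\<in>dirs. \<exists>g. (\<exists>ps. (\<forall>p\<in>set ps. smooth U \<Phi>\<^sub>1 (fst p) \<and> smooth U \<Phi>\<^sub>2 (snd p))
     \<and> g = (\<lambda>z. \<Sum>p\<leftarrow>ps. fst p z * snd p z)) \<and> (\<forall>z\<in>U. has_pd v f z (g z)))"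
    by blast
qed

lemma smooth_add:
  assumes U: "open U" "local_to U \<Phi>"
    and add: "\<And>f g. \<Phi> f \<Longrightarrow> \<Phi> g \<Longrightarrow> \<Phi> (\<lambda>z. f z + g z)"
    and a: "smooth U \<Phi> a" and b: "smooth U \<Phi> b"
  shows "smooth U \<Phi> (\<lambda>z. a z + b z)"
proof (rule smooth_coinduct[OF U, where X="\<lambda>f. \<exists>a b. smooth U \<Phi> a \<and> smooth U \<Phi> b \<and> f = (\<lambda>z. a z + b z)"])
  fix f assume "\<exists>a b. smooth U \<Phi> a \<and> smooth U \<Phi> b \<and> f = (\<lambda>z. a z + b z)"
  then obtain a b where ab: "smooth U \<Phi> a" "smooth U \<Phi> b" and f: "f = (\<lambda>z. a z + b z)" by blast
  have "continuous_on U f \<and> \<Phi> f" unfolding f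
    by (intro conjI continuous_on_add add smooth_continuous[OF ab(1)] smooth_continuous[OF ab(2)]
      smooth_prop[OF ab(1)] smooth_prop[OF ab(2)])
  moreover have "\<exists>g. (\<exists>a b. smooth U \<Phi> a \<and> smooth U \<Phi> b \<and> g = (\<lambda>z. a z + b z)) \<and>
      (\<forall>z\<in>U. has_pd v f z (g z))" if v: "v \<in> dirs" for v
  proof (rule exI[of _ "\<lambda>z. partial v a z + partial v b z"], rule conjI)
    show "\<exists>a' b'. smooth U \<Phi> a' \<and> smooth U \<Phi> b' \<and> (\<lambda>z. partial v a z + partial v b z) = (\<lambda>z. a' z + b' z)"
      by (intro exI[of _ "partial v a"] exI[of _ "partial v b"] conjI
        smooth_partial[OF ab(1) v] smooth_partial[OF ab(2) v] refl)
    show "\<forall>z\<in>U. has_pd v f z (partial v a z + partial v b z)"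
      unfolding f by (intro ballI has_pd_add smooth_has_pd[OF ab(1) v] smooth_has_pd[OF ab(2) v])
  qed
  ultimately show "continuous_on U f \<and> \<Phi> f \<and> (\<forall>v\<in>dirs. \<exists>g.
     (\<exists>a b. smooth U \<Phi> a \<and> smooth U \<Phi> b \<and> g = (\<lambda>z. a z + b z)) \<and> (\<forall>z\<in>U. has_pd v f z (g z)))"
    by simp
qed (use a b in auto)

lemma Cinf_on_imp_partial:
  assumes "Cinf_on U f" "v \<in> dirs"
  shows "Cinf_on U (partial v f)" "\<And>z. z \<in> U \<Longrightarrow> has_partial v f z" "continuous_on U f"
proof -
  have *: "Ck_on (Suc k) U f" for k using assms(1) by (simp add: Cinf_on_def del: Ck_on.simps)
  thus "Cinf_on U (partial v f)" "\<And>z. z \<in> U \<Longrightarrow> has_partial v f z" "continuous_on U f"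
    using assms(2) by (auto simp: Cinf_on_def dirs_def)
qed

lemma smooth_True_iff_Cinf_on: "smooth U (\<lambda>_. True) f \<longleftrightarrow> Cinf_on U f"
proof
  assume "smooth U (\<lambda>_. True) f"
  hence "Ck_on k U f" for k
  proof (induction k arbitrary: f)
    case (Suc k)
    show ?case
      using smooth_continuous[OF Suc.prems] smooth_has_partial[OF Suc.prems]
        Suc.IH[OF smooth_partial[OF Suc.prems one_dirs]] Suc.IH[OF smooth_partial[OF Suc.prems ii_dirs]]
      by simp
  qed (auto intro: smooth_continuous)
  thus "Cinf_on U f" by (simp add: Cinf_on_def)
next
  assume f: "Cinf_on U f"
  have "Cinf_on U (pd vs f)" if "set vs \<subseteq> dirs" for vs
    using that by (induction vs) (auto simp: f intro: Cinf_on_imp_partial)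
  thus "smooth U (\<lambda>_. True) f"
    unfolding smooth_def
    by (intro allI impI conjI ballI Cinf_on_imp_partial(2,3)[OF _ one_dirs] Cinf_on_imp_partial(2)) auto
qed

lemma smooth_partials_commute:
  assumes "open U" "smooth U \<Phi> f" "v \<in> dirs" "u \<in> dirs" "z \<in> U"
  shows "partial u (partial v f) z = partial v (partial u f) z"
proof -
  note f = assms(2)
  note fv = smooth_partial[OF f assms(3)] and fu = smooth_partial[OF f assms(4)]
  show ?thesis
    by (rule mixed_partials_eq[where U=U and v=v and u=u and f=f and ?f1.0="partial v f" and ?f2.0="partial u f"
          and ?f12.0="partial u (partial v f)" and ?f21.0="partial v (partial u f)"])
      (fact assms(1,5) | erule smooth_has_pd[OF f assms(3)] smooth_has_pd[OF f assms(4)]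
        smooth_has_pd[OF fv assms(4)] smooth_has_pd[OF fu assms(3)]
       | rule smooth_continuous[OF smooth_partial[OF fv assms(4)]] smooth_continuous[OF smooth_partial[OF fu assms(3)]])+
qed

text \<open>\<open>mderiv\<close> takes all y-derivatives first. A y-derivative at the front of the
  word is moved inwards past the x-derivatives by Schwarz's theorem, so only the two letter counts
  matter.\<close>

lemma pd_eq_mderiv:
  assumes U: "open U" and f: "smooth U \<Phi> f" and vs: "set vs \<subseteq> dirs" and z: "z \<in> U"
  shows "pd vs f z = mderiv (count_list vs 1, count_list vs \<i>) f z"
proof -
  have S: "smooth U \<Phi> ((partial v ^^ n) g)" if "v \<in> dirs" "smooth U \<Phi> g" for v n g
    using that by (induction n) (auto intro: smooth_partial)
  have comm: "partial \<i> ((partial 1 ^^ n) g) z = (partial 1 ^^ n) (partial \<i> g) z"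
    if g: "smooth U \<Phi> g" and z: "z \<in> U" for n g z
    using z
  proof (induction n arbitrary: z)
    case (Suc n)
    have "partial \<i> ((partial 1 ^^ Suc n) g) z = partial 1 (partial \<i> ((partial 1 ^^ n) g)) z"
      using smooth_partials_commute[OF U S[OF one_dirs g] one_dirs ii_dirs Suc.prems] by simp
    also have "\<dots> = partial 1 ((partial 1 ^^ n) (partial \<i> g)) z"
    proof (rule has_partial_cong_open(2)[OF U Suc.prems])
      show "has_partial 1 ((partial 1 ^^ n) (partial \<i> g)) z"
        by (rule smooth_has_partial[OF S[OF one_dirs smooth_partial[OF g ii_dirs]] one_dirs Suc.prems])
    qed (simp add: Suc.IH)
    finally show ?case by simp
  qed simp
  show ?thesis using vs z
  proof (induction vs arbitrary: z)
    case Nil thus ?case by (simp add: mderiv_def)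
  next
    case (Cons v vs)
    let ?m = "mderiv (count_list vs 1, count_list vs \<i>) f"
    have sm: "smooth U \<Phi> ?m" unfolding mderiv_def by (intro S f) auto
    have v: "v \<in> dirs" using Cons.prems by simp
    have "pd (v # vs) f z = partial v ?m z"
      unfolding pd_simps
      by (rule has_partial_cong_open(2)[OF U Cons.prems(2)])
        (use Cons smooth_has_partial[OF sm v] in auto)
    also have "\<dots> = mderiv (count_list (v # vs) 1, count_list (v # vs) \<i>) f z"
    proof (cases "v = 1")
      case False
      hence "v = \<i>" using v by (simp add: dirs_def)
      thus ?thesis using comm[OF S[OF ii_dirs f] Cons.prems(2)] by (simp add: mderiv_def)
    qed (simp add: mderiv_def)
    finally show ?case .
  qed
qed

section \<open>Weighted bounds and the closure properties of \<open>K_space\<close>\<close>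

abbreviation weight :: "(real \<Rightarrow> real) \<Rightarrow> nat \<Rightarrow> complex \<Rightarrow> real" where
  "weight w N z \<equiv> exp (w (real N * \<bar>Re z\<bar>))"

definition wbd_on :: "(real \<Rightarrow> real) \<Rightarrow> complex set \<Rightarrow> (complex \<Rightarrow> complex) \<Rightarrow> bool" where
  "wbd_on w S f \<longleftrightarrow> (\<forall>N::nat. \<exists>A. \<forall>z\<in>S. weight w N z * cmod (f z) \<le> A)"

lemma wbd_on_add:
  assumes "wbd_on w S f" "wbd_on w S g" shows "wbd_on w S (\<lambda>z. f z + g z)"
  unfolding wbd_on_def
proof
  fix N :: nat
  obtain A B where AB: "\<And>z. z \<in> S \<Longrightarrow> weight w N z * cmod (f z) \<le> A"
    "\<And>z. z \<in> S \<Longrightarrow> weight w N z * cmod (g z) \<le> B" using assms unfolding wbd_on_def by meson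
  have "weight w N z * cmod (f z + g z) \<le> A + B" if "z \<in> S" for z
  proof -
    have "weight w N z * cmod (f z + g z) \<le> weight w N z * (cmod (f z) + cmod (g z))"
      by (intro mult_left_mono norm_triangle_ineq) auto
    thus ?thesis using AB[OF that] by (simp add: ring_distribs)
  qed
  thus "\<exists>A. \<forall>z\<in>S. weight w N z * cmod (f z + g z) \<le> A" by blast
qed

definition wbd :: "(real \<Rightarrow> real) \<Rightarrow> ereal \<Rightarrow> (complex \<Rightarrow> complex) \<Rightarrow> bool" where
  "wbd w h f \<longleftrightarrow> (\<forall>(N::nat) (c::real). 0 < c \<and> ereal c < h \<longrightarrow>
     (\<exists>B. \<forall>z. \<bar>Im z\<bar> \<le> c \<longrightarrow> weight w N z * cmod (f z) \<le> B))"

lemma wbd_local: "local_to (strip h) (wbd w h)"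
  unfolding local_to_def
proof (intro allI impI)
  fix f g assume eq: "\<forall>z\<in>strip h. f z = g z" and f: "wbd w h f"
  have "f z = g z" if "\<bar>Im z\<bar> \<le> c" "ereal c < h" for z c
    using eq that by (auto simp: strip_def) (metis ereal_less_eq(3) order_le_less_trans)
  thus "wbd w h g" using f unfolding wbd_def by metis
qed

text \<open>One direction is \<open>closure_strip_subset\<close>. For the other, a larger half-width
  c' < h puts the closed strip |Im z| \<le> c inside the open strip of half-width c', so the closure
  of a strip never has to be computed.\<close>

lemma wbd_iff:
  "wbd w h f \<longleftrightarrow> (\<forall>(N::nat) (h'::real). 0 < h' \<and> ereal h' < h \<longrightarrow>
        bdd_above ((\<lambda>z. weight w N z * cmod (f z)) ` closure (strip (ereal h'))))"
proof (intro iffI allI impI)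
  fix N :: nat and c :: real
  assume "wbd w h f" "0 < c \<and> ereal c < h"
  then obtain B where "\<And>z. \<bar>Im z\<bar> \<le> c \<Longrightarrow> weight w N z * cmod (f z) \<le> B"
    unfolding wbd_def by blast
  thus "bdd_above ((\<lambda>z. weight w N z * cmod (f z)) ` closure (strip (ereal c)))"
    by (intro bdd_aboveI2[of _ _ B]) (use closure_strip_subset in blast)
next
  assume *: "\<forall>(N::nat) (h'::real). 0 < h' \<and> ereal h' < h \<longrightarrow>
        bdd_above ((\<lambda>z. weight w N z * cmod (f z)) ` closure (strip (ereal h')))"
  show "wbd w h f" unfolding wbd_def
  proof (intro allI impI)
    fix N :: nat and c :: real assume c: "0 < c \<and> ereal c < h"
    then obtain c' where c': "ereal c < ereal c'" "ereal c' < h" using ereal_dense2 by blast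
    hence "bdd_above ((\<lambda>z. weight w N z * cmod (f z)) ` closure (strip (ereal c')))"
      using * c by auto
    then obtain B where B: "\<And>z. z \<in> closure (strip (ereal c')) \<Longrightarrow> weight w N z * cmod (f z) \<le> B"
      by (auto simp: bdd_above_def)
    show "\<exists>B. \<forall>z. \<bar>Im z\<bar> \<le> c \<longrightarrow> weight w N z * cmod (f z) \<le> B"
      by (intro exI[of _ B] allI impI B subsetD[OF closure_subset]) (use c' in \<open>auto simp: strip_def\<close>)
  qed
qed

text \<open>Reduces membership to the coinductive notion: words translate to multi-indices by
  \<open>pd_eq_mderiv\<close>, and conversely \<open>mderiv \<alpha> f\<close> is an iterated
  partial derivative.\<close>

lemma K_space_eq_smooth: "f \<in> K_space w h \<longleftrightarrow> smooth (strip h) (wbd w h) f"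
proof -
  have "f \<in> K_space w h \<longleftrightarrow> Cinf_on (strip h) f \<and> (\<forall>\<alpha>. wbd w h (mderiv \<alpha> f))"
    unfolding K_space_def mem_Collect_eq wbd_iff by (rule conj_cong[OF refl], rule all_comm)
  also have "\<dots> \<longleftrightarrow> smooth (strip h) (wbd w h) f"
  proof (intro iffI conjI allI)
    assume *: "Cinf_on (strip h) f \<and> (\<forall>\<alpha>. wbd w h (mderiv \<alpha> f))"
    hence sm: "smooth (strip h) (\<lambda>_. True) f" by (simp add: smooth_True_iff_Cinf_on)
    have "wbd w h (pd vs f)" if "set vs \<subseteq> dirs" for vs
      by (rule local_toD[OF wbd_local, of _ _ "mderiv (count_list vs 1, count_list vs \<i>) f"])
        (use * pd_eq_mderiv[OF open_strip sm that] in auto)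
    with sm show "smooth (strip h) (wbd w h) f" unfolding smooth_def by simp
  next
    assume sm: "smooth (strip h) (wbd w h) f"
    show "Cinf_on (strip h) f"
      unfolding smooth_True_iff_Cinf_on[symmetric] by (rule smooth_mono[OF sm]) simp
    fix \<alpha>
    have "smooth (strip h) (wbd w h) ((partial v ^^ n) g)" if "v \<in> dirs" "smooth (strip h) (wbd w h) g" for v n g
      using that by (induction n) (auto intro: smooth_partial)
    from this[OF one_dirs this[OF ii_dirs sm]] show "wbd w h (mderiv \<alpha> f)"
      unfolding mderiv_def by (rule smooth_prop)
  qed
  finally show ?thesis .
qed

lemma wbd_iff_wbd_on:
  "wbd w h f \<longleftrightarrow> (\<forall>c. 0 < c \<and> ereal c < h \<longrightarrow> wbd_on w {z. \<bar>Im z\<bar> \<le> c} f)"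
  unfolding wbd_def wbd_on_def by (simp, metis)

lemma wbd_add: "wbd w h f \<Longrightarrow> wbd w h g \<Longrightarrow> wbd w h (\<lambda>z. f z + g z)"
  unfolding wbd_iff_wbd_on by (blast intro: wbd_on_add)

lemma wbd_cmult: assumes "wbd w h f" shows "wbd w h (\<lambda>z. k * f z)"
  unfolding wbd_def
proof (intro allI impI)
  fix N :: nat and c :: real assume c: "0 < c \<and> ereal c < h"
  then obtain A where A: "\<And>z. \<bar>Im z\<bar> \<le> c \<Longrightarrow> weight w N z * cmod (f z) \<le> A"
    using assms unfolding wbd_def by blast
  have "weight w N z * cmod (k * f z) \<le> cmod k * A" if "\<bar>Im z\<bar> \<le> c" for z
    using mult_left_mono[OF A[OF that], of "cmod k"] by (simp add: norm_mult mult_ac)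
  thus "\<exists>B. \<forall>z. \<bar>Im z\<bar> \<le> c \<longrightarrow> weight w N z * cmod (k * f z) \<le> B" by blast
qed

lemma K_space_add: "f \<in> K_space w h \<Longrightarrow> g \<in> K_space w h \<Longrightarrow> (\<lambda>z. f z + g z) \<in> K_space w h"
  unfolding K_space_eq_smooth by (intro smooth_add open_strip wbd_local wbd_add)

lemma K_space_cmult: "f \<in> K_space w h \<Longrightarrow> (\<lambda>z. c * f z) \<in> K_space w h"
  unfolding K_space_eq_smooth
  by (intro smooth_linear[where L="(*) c"] open_strip wbd_local wbd_cmult bounded_linear_mult_right)

lemma K_space_cnj: "f \<in> K_space w h \<Longrightarrow> (\<lambda>z. cnj (f z)) \<in> K_space w h"
  unfolding K_space_eq_smooth
  by (intro smooth_linear[where L=cnj] open_strip wbd_local bounded_linear_cnj) (simp_all add: wbd_def)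

lemma K_space_partial: "f \<in> K_space w h \<Longrightarrow> v \<in> dirs \<Longrightarrow> partial v f \<in> K_space w h"
  unfolding K_space_eq_smooth by (rule smooth_partial)

lemma K_space_has_pd:
  "f \<in> K_space w h \<Longrightarrow> v \<in> dirs \<Longrightarrow> z \<in> strip h \<Longrightarrow> has_pd v f z (partial v f z)"
  unfolding K_space_eq_smooth by (rule smooth_has_pd)

section \<open>The Cauchy-Riemann and Laplace operators\<close>

lemma dbar_eqI: "has_pd 1 f z a \<Longrightarrow> has_pd \<i> f z b \<Longrightarrow> dbar f z = (1 / 2) * (a + \<i> * b)"
  by (simp add: dbar_def has_pd_imp_partial)

lemma dbar_cong:
  assumes "\<And>v z. v \<in> dirs \<Longrightarrow> z \<in> strip h \<Longrightarrow> has_pd v u z (D v z)" "z \<in> strip h"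
    and "\<And>z. z \<in> strip h \<Longrightarrow> f z = u z"
  shows "dbar f z = dbar u z"
proof -
  have "partial v f z = partial v u z" if "v \<in> dirs" for v
    by (rule has_partial_cong_open(2)[OF open_strip assms(2)])
      (use assms(3) has_pd_imp_has_partial[OF assms(1)[OF that assms(2)]] in auto)
  thus ?thesis by (simp add: dbar_def)
qed

text \<open>The identity \<open>\<Delta> = 4 \<partial>\<partial>\<close>-bar, where \<open>\<partial> = (\<partial>\<^sub>x - i \<partial>\<^sub>y) / 2\<close>.\<close>

lemma dbar_del_eq_laplace:
  assumes f: "f \<in> K_space w h" and z: "z \<in> strip h"
  shows "dbar (\<lambda>z. 2 * (partial_x f z + (- \<i>) * partial_y f z)) z = laplace f z"
proof -
  let ?g = "\<lambda>z. 2 * (partial_x f z + (- \<i>) * partial_y f z)"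
  have fx: "partial_x f \<in> K_space w h" and fy: "partial_y f \<in> K_space w h"
    using K_space_partial[OF f] by auto
  have "has_pd v ?g z (2 * (partial v (partial_x f) z + (- \<i>) * partial v (partial_y f) z))" if "v \<in> dirs" for v
    by (intro has_pd_cmult has_pd_add K_space_has_pd[OF fx] K_space_has_pd[OF fy] that z)
  from dbar_eqI[OF this[OF one_dirs] this[OF ii_dirs]]
    smooth_partials_commute[OF open_strip f[unfolded K_space_eq_smooth] one_dirs ii_dirs z]
  show ?thesis by (simp add: laplace_def algebra_simps)
qed

text \<open>Conjugation exchanges the two first-order operators: \<partial> (cnj v) = cnj (dbar v).
  Solving dbar u = g and then dbar v = cnj u / 4 gives f = cnj v with 4 \<partial> f = u, hence
  \<Delta> f = dbar u = g. Conversely, if \<Delta> f = g, then u = 4 \<partial> f satisfies dbar u =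
  g.\<close>

theorem surj_dbar_iff_laplace:
  "surj_op (strip h) (K_space w h) dbar \<longleftrightarrow> surj_op (strip h) (K_space w h) laplace"
proof
  assume D: "surj_op (strip h) (K_space w h) dbar"
  show "surj_op (strip h) (K_space w h) laplace"
    unfolding surj_op_def
  proof
    fix g assume g: "g \<in> K_space w h"
    obtain u where u: "u \<in> K_space w h" "\<And>z. z \<in> strip h \<Longrightarrow> dbar u z = g z"
      using D g unfolding surj_op_def by blast
    obtain v where v: "v \<in> K_space w h" "\<And>z. z \<in> strip h \<Longrightarrow> dbar v z = (1/4) * cnj (u z)"
      using bspec[OF D[unfolded surj_op_def] K_space_cmult[OF K_space_cnj[OF u(1)], of "1/4"]] by metis
    define f where "f = (\<lambda>z. cnj (v z))"
    have f: "f \<in> K_space w h" unfolding f_def by (rule K_space_cnj[OF v(1)])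
    have "laplace f z = g z" if z: "z \<in> strip h" for z
    proof -
      have eq: "2 * (partial_x f z + (- \<i>) * partial_y f z) = u z" if z: "z \<in> strip h" for z
      proof -
        have "partial d f z = cnj (partial d v z)" if "d \<in> dirs" for d
          unfolding f_def by (intro has_pd_imp_partial has_pd_cnj K_space_has_pd[OF v(1)] that z)
        hence "2 * (partial_x f z + (- \<i>) * partial_y f z) = cnj (4 * dbar v z)"
          by (simp add: dbar_def)
        also have "\<dots> = u z" unfolding v(2)[OF z] by simp
        finally show ?thesis .
      qed
      have "dbar (\<lambda>z. 2 * (partial_x f z + (- \<i>) * partial_y f z)) z = dbar u z"
        by (rule dbar_cong[OF K_space_has_pd[OF u(1)] z eq])
      thus ?thesis using dbar_del_eq_laplace[OF f z] u(2)[OF z] by simp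
    qed
    thus "\<exists>f\<in>K_space w h. \<forall>z\<in>strip h. laplace f z = g z" using f by blast
  qed
next
  assume L: "surj_op (strip h) (K_space w h) laplace"
  show "surj_op (strip h) (K_space w h) dbar"
    unfolding surj_op_def
  proof
    fix g assume "g \<in> K_space w h"
    then obtain f where f: "f \<in> K_space w h" "\<And>z. z \<in> strip h \<Longrightarrow> laplace f z = g z"
      using L unfolding surj_op_def by blast
    have "(\<lambda>z. 2 * (partial_x f z + (- \<i>) * partial_y f z)) \<in> K_space w h"
      by (intro K_space_cmult K_space_add K_space_partial f) auto
    thus "\<exists>u\<in>K_space w h. \<forall>z\<in>strip h. dbar u z = g z"
      using dbar_del_eq_laplace[OF f(1)] f(2) by (intro bexI) auto
  qed
qed

subsection \<open>Holomorphic functions of rapid decay on a half strip\<close>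

definition subexp :: "(real \<Rightarrow> real) \<Rightarrow> bool" where
  "subexp w \<longleftrightarrow> (\<forall>\<mu>>0. \<exists>C. \<forall>t\<ge>0. w t \<le> C * exp (\<mu> * t))"

text \<open>The pointwise bound with \<mu>/2 leaves exp(-\<mu> t/2) to integrate. Conversely, w is
  at least w t on [t, t + 1] by monotonicity, so the integral over this interval controls w t
  exp(-\<mu> (t + 1)).\<close>

lemma subexp_iff_nn_integral_finite:
  assumes nonneg: "\<And>t. 0 \<le> t \<Longrightarrow> 0 \<le> w t" and mono: "mono_on {0..} w"
  shows "subexp w \<longleftrightarrow> (\<forall>\<mu>>0. (\<integral>\<^sup>+t\<in>{0..}. ennreal (w t * exp (- \<mu> * t)) \<partial>lborel) < \<infinity>)"
proof (intro iffI allI impI)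
  fix \<mu> :: real assume "subexp w" and mu: "\<mu> > 0"
  then obtain C where C: "\<And>t. t \<ge> 0 \<Longrightarrow> w t \<le> C * exp (\<mu> / 2 * t)"
    unfolding subexp_def by (metis half_gt_zero)
  have C0: "C \<ge> 0" using C[of 0] nonneg[of 0] by simp
  define F where "F = (\<lambda>t. - (2 * C / \<mu>) * exp (- (\<mu> / 2) * t))"
  have F: "(F \<longlongrightarrow> 0) at_top" unfolding F_def using mu by real_asymp
  have F': "(F has_real_derivative C * exp (- (\<mu> / 2) * t)) (at t)" for t
    unfolding F_def using mu by (auto intro!: derivative_eq_intros)
  have "(\<integral>\<^sup>+t\<in>{0..}. ennreal (w t * exp (- \<mu> * t)) \<partial>lborel)
      \<le> (\<integral>\<^sup>+t\<in>{0..}. ennreal (C * exp (- (\<mu> / 2) * t)) \<partial>lborel)"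
  proof (rule nn_integral_mono)
    fix t :: real
    show "ennreal (w t * exp (- \<mu> * t)) * indicator {0..} t
        \<le> ennreal (C * exp (- (\<mu> / 2) * t)) * indicator {0..} t"
    proof (cases "t \<ge> 0")
      case True
      have "w t * exp (- \<mu> * t) \<le> C * exp (\<mu> / 2 * t) * exp (- \<mu> * t)"
        by (intro mult_right_mono C True) auto
      also have "\<dots> = C * exp (- (\<mu> / 2) * t)" by (simp add: exp_add[symmetric])
      finally show ?thesis using True by (simp add: ennreal_leI)
    qed simp
  qed
  also have "\<dots> = ennreal (0 - F 0)"
    by (rule nn_integral_FTC_atLeast[where F=F]) (use F F' C0 in auto)
  also have "\<dots> < \<infinity>" by simp
  finally show "(\<integral>\<^sup>+t\<in>{0..}. ennreal (w t * exp (- \<mu> * t)) \<partial>lborel) < \<infinity>" .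
next
  assume fin: "\<forall>\<mu>>0. (\<integral>\<^sup>+t\<in>{0..}. ennreal (w t * exp (- \<mu> * t)) \<partial>lborel) < \<infinity>"
  show "subexp w" unfolding subexp_def
  proof (intro allI impI)
    fix \<mu> :: real assume mu: "\<mu> > 0"
    define I where "I = (\<integral>\<^sup>+t\<in>{0..}. ennreal (w t * exp (- \<mu> * t)) \<partial>lborel)"
    have I: "I < \<infinity>" using fin mu by (simp add: I_def)
    show "\<exists>C. \<forall>t\<ge>0. w t \<le> C * exp (\<mu> * t)"
    proof (intro exI[of _ "enn2real I * exp \<mu>"] allI impI)
      fix t :: real assume t: "t \<ge> 0"
      have "ennreal (w t * exp (- \<mu> * (t + 1)))
          = (\<integral>\<^sup>+s. ennreal (w t * exp (- \<mu> * (t + 1))) * indicator {t..t+1} s \<partial>lborel)"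
        by (subst nn_integral_cmult) auto
      also have "\<dots> \<le> I" unfolding I_def
      proof (intro nn_integral_mono)
        fix s :: real
        show "ennreal (w t * exp (- \<mu> * (t + 1))) * indicator {t..t+1} s
          \<le> ennreal (w s * exp (- \<mu> * s)) * indicator {0..} s"
        proof (cases "s \<in> {t..t+1}")
          case True
          have "w t * exp (- \<mu> * (t + 1)) \<le> w s * exp (- \<mu> * s)"
            using True t mu by (intro mult_mono mono_onD[OF mono] nonneg) auto
          thus ?thesis using True t by (simp add: ennreal_leI)
        qed simp
      qed
      also have "I = ennreal (enn2real I)" using I by (simp add: less_top)
      finally have "w t * exp (- \<mu> * (t + 1)) \<le> enn2real I" by simp
      hence "w t * exp (- \<mu> * (t + 1)) * exp (\<mu> * (t + 1)) \<le> enn2real I * exp (\<mu> * (t + 1))"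
        by (intro mult_right_mono) auto
      thus "w t \<le> enn2real I * exp \<mu> * exp (\<mu> * t)"
        by (simp add: mult.assoc exp_add[symmetric] algebra_simps)
    qed
  qed
qed

lemma Re_sinh_of_real_mult: "Re (sinh (of_real \<mu> * z)) = sinh (\<mu> * Re z) * cos (\<mu> * Im z)"
  by (simp add: sinh_field_def Re_exp Re_divide_numeral algebra_simps)

text \<open>The factor \<open>exp (\<epsilon> sinh (\<mu> z))\<close> has modulus one on the left and on the horizontal sides of the
  rectangle when \<open>\<mu> c = \<pi> / 2\<close>; on the right side its growth is compensated by the decay of \<open>f\<close>.\<close>

lemma decay_bound_half_strip:
  assumes hol: "f holomorphic_on U" and X: "X > 1" and c: "c > 0"
    and sub: "{z. 0 \<le> Re z \<and> Re z \<le> X \<and> \<bar>Im z\<bar> \<le> c} \<subseteq> U"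
    and bd: "\<And>z. 0 \<le> Re z \<Longrightarrow> Re z \<le> X \<Longrightarrow> \<bar>Im z\<bar> \<le> c \<Longrightarrow> cmod (f z) \<le> B"
    and right: "\<And>z. Re z = X \<Longrightarrow> \<bar>Im z\<bar> \<le> c \<Longrightarrow> cmod (f z) \<le> B * exp (- V)"
    and V: "V \<ge> 0" and f1: "f 1 \<noteq> 0"
  shows "V \<le> ln (B / cmod (f 1)) / sinh (pi / (2 * c)) * exp (pi / (2 * c) * X)"
proof -
  define \<mu> where "\<mu> = pi / (2 * c)"
  have mu: "\<mu> > 0" "\<mu> * c = pi / 2" using c by (auto simp: \<mu>_def)
  \<comment> \<open>On the right side the factor has modulus at most exp(e sinh(\<mu> X)); this e
    makes that bound exp V, which cancels the decay of f there.\<close>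
  define e where "e = V / sinh (\<mu> * X)"
  have sX: "sinh (\<mu> * X) > 0" using mu X by simp
  have e0: "e \<ge> 0" using V sX by (simp add: e_def)
  define H where "H = (\<lambda>z. f z * exp (of_real e * sinh (of_real \<mu> * z)))"
  define S where "S = cbox (Complex 0 (-c)) (Complex X c)"
  have S: "z \<in> S \<longleftrightarrow> 0 \<le> Re z \<and> Re z \<le> X \<and> \<bar>Im z\<bar> \<le> c" for z
    by (auto simp: S_def in_cbox_complex_iff)
  have SU: "S \<subseteq> U" using sub S by auto
  have nH: "cmod (H z) = cmod (f z) * exp (e * (sinh (\<mu> * Re z) * cos (\<mu> * Im z)))" for z
    by (simp add: H_def norm_mult Re_sinh_of_real_mult)
  have holH: "H holomorphic_on U"
    unfolding H_def sinh_field_def by (intro holomorphic_intros hol) simp_all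
  have B0: "B > 0" using bd[of 1] f1 X c by (smt (verit) one_complex.sel zero_less_norm_iff)
  have "cmod (H 1) \<le> B"
  proof (rule maximum_modulus_frontier[where f=H and S=S and \<xi>=1])
    show "H holomorphic_on interior S" using holH SU interior_subset by (blast intro: holomorphic_on_subset)
    show "continuous_on (closure S) H"
      using holomorphic_on_imp_continuous_on[OF holH] SU by (auto simp: S_def intro: continuous_on_subset)
    show "bounded S" by (simp add: S_def)
    show "1 \<in> S" using X c by (simp add: S)
    fix z assume "z \<in> frontier S"
    hence z: "z \<in> S" "z \<notin> box (Complex 0 (-c)) (Complex X c)"
      by (auto simp: S_def frontier_cbox)
    hence zS: "0 \<le> Re z" "Re z \<le> X" "\<bar>Im z\<bar> \<le> c" using S by auto
    from z(2) zS consider "Re z = 0" | "\<bar>Im z\<bar> = c" | "Re z = X"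
      by (fastforce simp: in_box_complex_iff)
    thus "cmod (H z) \<le> B"
    proof cases
      case 1 thus ?thesis using bd[of z] zS by (simp add: nH)
    next
      case 2
      have "cos (\<mu> * \<bar>Im z\<bar>) = 0" unfolding 2 mu(2) by simp
      hence "cos (\<mu> * Im z) = 0" using mu by (metis abs_mult abs_of_pos cos_abs_real)
      thus ?thesis using bd[of z] zS by (simp add: nH)
    next
      case 3
      have "e * (sinh (\<mu> * Re z) * cos (\<mu> * Im z)) \<le> e * (sinh (\<mu> * X) * 1)"
        using sX e0 unfolding 3 by (intro mult_left_mono) auto
      also have "\<dots> = V" using mu(1) X by (simp add: e_def)
      finally have "cmod (H z) \<le> (B * exp (- V)) * exp V"
        unfolding nH using right[OF 3 zS(3)] B0 by (intro mult_mono) auto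
      also have "\<dots> = B" by (simp add: exp_minus)
      finally show ?thesis .
    qed
  qed
  \<comment> \<open>Evaluation at the interior point 1 bounds e, and hence V = e sinh(\<mu> X), with
    a growth rate \<mu> in X that depends only on the width of the strip.\<close>
  hence "cmod (f 1) * exp (e * sinh \<mu>) \<le> B" by (simp add: nH)
  hence "exp (e * sinh \<mu>) \<le> B / cmod (f 1)" using f1 by (simp add: field_simps)
  hence le: "e * sinh \<mu> \<le> ln (B / cmod (f 1))" by (metis exp_gt_zero exp_le_cancel_iff exp_ln less_le_trans)
  have L0: "ln (B / cmod (f 1)) \<ge> 0" using le e0 mu by (smt (verit) mult_nonneg_nonneg sinh_real_pos_iff)
  have "V = e * sinh (\<mu> * X)" using mu(1) X by (simp add: e_def)
  also have "e \<le> ln (B / cmod (f 1)) / sinh \<mu>" using le mu by (simp add: field_simps)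
  hence "e * sinh (\<mu> * X) \<le> ln (B / cmod (f 1)) / sinh \<mu> * sinh (\<mu> * X)"
    using sX by (intro mult_right_mono) auto
  also have "sinh (\<mu> * X) \<le> exp (\<mu> * X)"
    by (simp add: sinh_field_def)  (smt (verit) exp_gt_zero)
  hence "ln (B / cmod (f 1)) / sinh \<mu> * sinh (\<mu> * X) \<le> ln (B / cmod (f 1)) / sinh \<mu> * exp (\<mu> * X)"
    using L0 mu by (intro mult_left_mono) auto
  finally show ?thesis by (simp add: \<mu>_def)
qed

text \<open>The half-strip estimate gives w(N t) \<le> C exp(\<nu> t) with the same \<nu> for every
  N, since \<nu> depends only on the room around z0. Replacing t by t/N lowers the rate to \<nu>/N,
  hence below any given \<mu>.\<close>

theorem holomorphic_K_space_imp_subexp: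
  assumes nonneg: "\<And>t. 0 \<le> t \<Longrightarrow> 0 \<le> w t" and mono: "mono_on {0..} w"
    and f: "f \<in> K_space w h" "f holomorphic_on strip h" and z0: "z0 \<in> strip h" "f z0 \<noteq> 0"
  shows "subexp w"
proof -
  from z0(1) obtain b where b: "ereal \<bar>Im z0\<bar> < ereal b" "ereal b < h"
    unfolding strip_def using ereal_dense2 by blast
  define c where "c = b - \<bar>Im z0\<bar>"
  have c: "c > 0" and b0: "b > 0" using b by (auto simp: c_def)
  define \<nu> where "\<nu> = pi / (2 * c)"
  have nu: "\<nu> > 0" using c by (simp add: \<nu>_def)
  \<comment> \<open>The translation carries z0 to 1, where the half-strip estimate evaluates its
    function; c is the room that keeps the translated strip in |Im z| \<le> b.\<close>
  define F where "F = (\<lambda>z. f (z + (z0 - 1)))"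
  \<comment> \<open>On the side Re z = t + a the translated point has real part Re z + Re z0 - 1
    \<ge> t + 1, so the weight there is at least that at t; the summand 2 also gives t + a >
    1.\<close>
  define a where "a = \<bar>Re z0\<bar> + 2"
  have key: "\<exists>C\<ge>0. \<forall>t\<ge>0. w (real N * t) \<le> C * exp (\<nu> * t)" for N :: nat
  proof -
    have "wbd w h f" using f(1) smooth_prop unfolding K_space_eq_smooth by blast
    then obtain B where B: "\<And>z. \<bar>Im z\<bar> \<le> b \<Longrightarrow> weight w N z * cmod (f z) \<le> B"
      unfolding wbd_def using b b0 by blast
    have B': "cmod (F z) \<le> B * exp (- w (real N * \<bar>Re z + Re z0 - 1\<bar>))" if "\<bar>Im z\<bar> \<le> c" for z
    proof -
      have "\<bar>Im (z + (z0 - 1))\<bar> \<le> b" using that by (simp add: c_def)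
      from B[OF this] show ?thesis by (simp add: F_def exp_minus field_simps add_diff_eq)
    qed
    have "0 \<le> B * exp (- w (real N * \<bar>Re 0 + Re z0 - 1\<bar>))"
      by (rule order_trans[OF norm_ge_zero B']) (use c in simp)
    hence B0: "B \<ge> 0" by (simp add: zero_le_mult_iff)
    have holF: "F holomorphic_on {z. \<bar>Im z\<bar> \<le> c}"
      unfolding F_def
    proof (rule holomorphic_on_compose_gen[OF _ f(2), unfolded o_def])
      show "(\<lambda>z. z + (z0 - 1)) holomorphic_on {z. \<bar>Im z\<bar> \<le> c}" by (intro holomorphic_intros)
      show "(\<lambda>z. z + (z0 - 1)) ` {z. \<bar>Im z\<bar> \<le> c} \<subseteq> strip h"
      proof safe
        fix z assume "\<bar>Im z\<bar> \<le> c"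
        hence "\<bar>Im (z + (z0 - 1))\<bar> \<le> b" by (simp add: c_def)
        thus "z + (z0 - 1) \<in> strip h" using b(2) unfolding strip_def
          by simp (metis ereal_less_eq(3) order_le_less_trans)
      qed
    qed
    define A where "A = ln (B / cmod (F 1)) / sinh \<nu> * exp (\<nu> * a)"
    have bound: "w (real N * t) \<le> A * exp (\<nu> * t)" if t: "t \<ge> 0" for t
    proof -
      have "w (real N * t) \<le> ln (B / cmod (F 1)) / sinh (pi / (2 * c)) * exp (pi / (2 * c) * (t + a))"
      proof (rule decay_bound_half_strip[OF holF])
        show "t + a > 1" using t by (simp add: a_def)
        show "cmod (F z) \<le> B" if "\<bar>Im z\<bar> \<le> c" for z
        proof -
          have "B * exp (- w (real N * \<bar>Re z + Re z0 - 1\<bar>)) \<le> B * 1"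
            using nonneg B0 by (intro mult_left_mono) auto
          thus ?thesis using B'[OF that] by simp
        qed
        show "cmod (F z) \<le> B * exp (- w (real N * t))" if "Re z = t + a" "\<bar>Im z\<bar> \<le> c" for z
        proof -
          have "t \<le> \<bar>Re z + Re z0 - 1\<bar>" using that(1) by (simp add: a_def)
          hence "w (real N * t) \<le> w (real N * \<bar>Re z + Re z0 - 1\<bar>)"
            using t by (intro mono_onD[OF mono]) (auto intro: mult_left_mono)
          hence "B * exp (- w (real N * \<bar>Re z + Re z0 - 1\<bar>)) \<le> B * exp (- w (real N * t))"
            using B0 by (intro mult_left_mono) auto
          thus ?thesis using B'[OF that(2)] by simp
        qed
      qed (use c nonneg t z0(2) in \<open>auto simp: F_def\<close>)
      also have "\<dots> = A * exp (\<nu> * t)" by (simp add: A_def \<nu>_def exp_add ring_distribs add_divide_distrib)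
      finally show ?thesis .
    qed
    have "A \<ge> 0" using bound[of 0] nonneg[of 0] by simp
    thus ?thesis using bound by blast
  qed
  show ?thesis unfolding subexp_def
  proof (intro allI impI)
    fix \<mu> :: real assume mu: "\<mu> > 0"
    obtain N :: nat where N: "\<nu> / \<mu> < real N" using reals_Archimedean2 by blast
    have N0: "real N > 0" using N nu mu by (smt (verit) divide_pos_pos)
    have le: "\<nu> / real N \<le> \<mu>" using N N0 mu by (simp add: field_simps)
    obtain C where C: "C \<ge> 0" "\<And>t. t \<ge> 0 \<Longrightarrow> w (real N * t) \<le> C * exp (\<nu> * t)" using key by blast
    show "\<exists>C. \<forall>t\<ge>0. w t \<le> C * exp (\<mu> * t)"
    proof (intro exI[of _ C] allI impI)
      fix t :: real assume t: "t \<ge> 0"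
      have "w t \<le> C * exp (\<nu> * (t / real N))" using C(2)[of "t / real N"] t N0 by simp
      also have "\<nu> * (t / real N) \<le> \<mu> * t" using mult_right_mono[OF le t] by simp
      hence "C * exp (\<nu> * (t / real N)) \<le> C * exp (\<mu> * t)" using C(1) by (intro mult_left_mono) auto
      finally show "w t \<le> C * exp (\<mu> * t)" .
    qed
  qed
qed

subsection \<open>An entire function of rapid decay\<close>

text \<open>A diagonal argument. Column N enters the maximum at n only once N \<le> n and its whole
  tail lies below 2^m / (N + 1). The first condition keeps the maximum finite, the second makes late
  columns uniformly small relative to 2^n.\<close>

lemma diagonal_majorant:
  fixes \<kappa> :: "nat \<Rightarrow> nat \<Rightarrow> nat"
  assumes lim: "\<And>N. (\<lambda>n. real (\<kappa> N n) / 2 ^ n) \<longlonglongrightarrow> 0"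
  obtains k :: "nat \<Rightarrow> nat" where "(\<lambda>n. real (k n) / 2 ^ n) \<longlonglongrightarrow> 0"
    "\<And>N. eventually (\<lambda>n. \<kappa> N n \<le> k n) sequentially"
proof
  define A where "A = (\<lambda>n. {N. N \<le> n \<and> (\<forall>m\<ge>n. real (\<kappa> N m) \<le> 2 ^ m / (real N + 1))})"
  define k where "k = (\<lambda>n. Max (insert 0 ((\<lambda>N. \<kappa> N n) ` A n)))"
  have fin: "finite (insert 0 ((\<lambda>N. \<kappa> N n) ` A n))" for n
    by (auto simp: A_def)
  show "eventually (\<lambda>n. \<kappa> N n \<le> k n) sequentially" for N
  proof -
    have "eventually (\<lambda>n. real (\<kappa> N n) / 2 ^ n < 1 / (real N + 1)) sequentially"
      using order_tendstoD(2)[OF lim[of N], of "1 / (real N + 1)"] by simp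
    then obtain n0 where n0: "\<And>n. n \<ge> n0 \<Longrightarrow> real (\<kappa> N n) / 2 ^ n < 1 / (real N + 1)"
      by (auto simp: eventually_sequentially)
    have "\<kappa> N n \<le> k n" if "n \<ge> max n0 N" for n
    proof -
      have "N \<in> A n"
        unfolding A_def
      proof (intro CollectI conjI allI impI)
        fix m assume "m \<ge> n"
        hence "real (\<kappa> N m) / 2 ^ m < 1 / (real N + 1)" using n0 that by auto
        thus "real (\<kappa> N m) \<le> 2 ^ m / (real N + 1)" by (simp add: field_simps)
      qed (use that in auto)
      thus ?thesis unfolding k_def by (intro Max_ge fin) auto
    qed
    thus ?thesis unfolding eventually_sequentially by blast
  qed
  show "(\<lambda>n. real (k n) / 2 ^ n) \<longlonglongrightarrow> 0"
  proof (rule LIMSEQ_I)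
    fix e :: real assume e: "e > 0"
    \<comment> \<open>After division by 2^n, columns beyond N0 stay below e by the entry condition,
      and the finitely many others by their own limits.\<close>
    obtain N0 :: nat where N0: "1 / e < real N0" using reals_Archimedean2 by blast
    have "eventually (\<lambda>n. \<forall>N\<in>{..N0}. real (\<kappa> N n) / 2 ^ n < e) sequentially"
      by (intro eventually_ball_finite ballI order_tendstoD(2)[OF lim e]) auto
    then obtain n0 where n0: "\<And>n N. n \<ge> n0 \<Longrightarrow> N \<le> N0 \<Longrightarrow> real (\<kappa> N n) / 2 ^ n < e"
      by (auto simp: eventually_sequentially)
    have "norm (real (k n) / 2 ^ n - 0) < e" if n: "n \<ge> n0" for n
    proof -
      have "k n \<in> insert 0 ((\<lambda>N. \<kappa> N n) ` A n)" unfolding k_def by (intro Max_in fin) auto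
      then consider "k n = 0" | N where "N \<in> A n" "k n = \<kappa> N n" by auto
      thus ?thesis
      proof cases
        case 1 thus ?thesis using e by simp
      next
        case 2
        show ?thesis
        proof (cases "N \<le> N0")
          case True thus ?thesis using n0[OF n] 2 by simp
        next
          case False
          have "real (k n) \<le> 2 ^ n / (real N + 1)" using 2 by (simp add: A_def)
          also have "\<dots> < 2 ^ n * e"
          proof -
            have "1 / e < real N + 1" using False N0 by simp
            hence "1 / (real N + 1) < e" using e by (simp add: field_simps)
            thus ?thesis using mult_strict_left_mono[of "1 / (real N + 1)" e "2 ^ n"] by simp
          qed
          finally show ?thesis by (simp add: field_simps)
        qed
      qed
    qed
    thus "\<exists>no. \<forall>n\<ge>no. norm (real (k n) / 2 ^ n - 0) < e" by blast
  qed
qed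

text \<open>The exponents for the factors 1 + (z / 2^n)^2. The base 3/2 bounds the real part of such
  a factor from below when |Re z| \<ge> 2^n on a fixed strip and n is large. The argument 2^(n+1) is
  the upper end of that dyadic interval, and the factor 2^(n+1) pays for the coefficient 2^-n and
  for the loss of 1/2 in \<open>Re_power_ge\<close>. Subexponential growth makes the logarithm of
  the required size o(2^n).\<close>

lemma exponent_sequence_exists:
  assumes nonneg: "\<And>t. 0 \<le> t \<Longrightarrow> 0 \<le> V t" and V: "subexp V"
  obtains k :: "nat \<Rightarrow> nat" where "(\<lambda>n. real (k n) / 2 ^ n) \<longlonglongrightarrow> 0"
    "\<And>N. eventually (\<lambda>n. 2 ^ (n + 1) * V (real N * 2 ^ (n + 1)) \<le> (3/2) ^ k n) sequentially"
proof -
  define a where "a = (\<lambda>N n. 2 ^ (n + 1) * V (real N * 2 ^ (n + 1)))"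
  define \<kappa> where "\<kappa> = (\<lambda>N n. nat \<lceil>ln (1 + a N n) / ln (3/2)\<rceil>)"
  have a0: "a N n \<ge> 0" for N n unfolding a_def using nonneg by simp
  have a_le: "a N n \<le> (3/2) ^ \<kappa> N n" for N n
  proof -
    have "ln (1 + a N n) / ln (3/2) \<le> real (\<kappa> N n)" unfolding \<kappa>_def by linarith
    hence "ln (1 + a N n) \<le> real (\<kappa> N n) * ln (3/2)" by (simp add: field_simps)
    also have "\<dots> = ln ((3/2) ^ \<kappa> N n)" by (simp add: ln_realpow)
    finally have "1 + a N n \<le> (3/2) ^ \<kappa> N n" using a0[of N n] by (subst (asm) ln_le_cancel_iff) auto
    thus ?thesis by simp
  qed
  have "(\<lambda>n. real (\<kappa> N n) / 2 ^ n) \<longlonglongrightarrow> 0" for N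
  proof (rule LIMSEQ_I)
    fix e :: real assume e: "e > 0"
    \<comment> \<open>With this \<mu> the limit of u is e/2; the smaller rate \<nu> absorbs the
      dilation by 2 N in the argument of V.\<close>
    define \<mu> where "\<mu> = e * ln (3/2) / 2"
    have mu: "\<mu> > 0" using e by (simp add: \<mu>_def)
    define \<nu> where "\<nu> = \<mu> / (2 * real N + 1)"
    have nu: "\<nu> > 0" using mu by (simp add: \<nu>_def)
    obtain C where C: "\<And>t. t \<ge> 0 \<Longrightarrow> V t \<le> C * exp (\<nu> * t)" using V nu unfolding subexp_def by blast
    have C0: "C \<ge> 0" using C[of 0] nonneg[of 0] by simp
    define u where "u = (\<lambda>n::nat. (1 + (ln (1 + 2 * C) + real n * ln 2 + \<mu> * 2 ^ n) / ln (3/2)) / 2 ^ n)"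
    have "u \<longlonglongrightarrow> \<mu> * inverse (ln (3/2))" unfolding u_def by real_asymp
    moreover have "\<mu> * inverse (ln (3/2)) < e" using e by (simp add: \<mu>_def)
    ultimately have "eventually (\<lambda>n. u n < e) sequentially" by (rule order_tendstoD(2))
    moreover have "norm (real (\<kappa> N n) / 2 ^ n - 0) \<le> u n" for n
    proof -
      have "a N n \<le> 2 ^ (n + 1) * (C * exp (\<nu> * (real N * 2 ^ (n + 1))))"
        unfolding a_def by (intro mult_left_mono C) auto
      also have "\<dots> \<le> 2 ^ (n + 1) * (C * exp (\<mu> * 2 ^ n))"
      proof -
        have "\<nu> * (real N * 2 ^ (n + 1)) = (\<nu> * (2 * real N)) * 2 ^ n" by simp
        also have "\<dots> \<le> \<mu> * 2 ^ n"
          using mu by (intro mult_right_mono) (auto simp: \<nu>_def field_simps)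
        finally show ?thesis using C0 by (intro mult_left_mono) auto
      qed
      finally have "a N n \<le> 2 * C * (2 ^ n * exp (\<mu> * 2 ^ n))" by (simp add: mult_ac)
      moreover have "1 * 1 \<le> 2 ^ n * exp (\<mu> * 2 ^ n)" using mu by (intro mult_mono) auto
      ultimately have "1 + a N n \<le> (1 + 2 * C) * (2 ^ n * exp (\<mu> * 2 ^ n))"
        by (simp add: ring_distribs)
      hence "ln (1 + a N n) \<le> ln ((1 + 2 * C) * (2 ^ n * exp (\<mu> * 2 ^ n)))"
        using a0[of N n] C0 by (subst ln_le_cancel_iff) auto
      also have "\<dots> = ln (1 + 2 * C) + real n * ln 2 + \<mu> * 2 ^ n"
        using C0 by (simp add: ln_mult ln_realpow)
      finally have "ln (1 + a N n) / ln (3/2) \<le> (ln (1 + 2 * C) + real n * ln 2 + \<mu> * 2 ^ n) / ln (3/2)"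
        by (intro divide_right_mono) auto
      moreover have "real (\<kappa> N n) \<le> 1 + ln (1 + a N n) / ln (3/2)"
      proof -
        have "ln (1 + a N n) / ln (3/2) \<ge> 0" using a0[of N n] by simp
        thus ?thesis unfolding \<kappa>_def by linarith
      qed
      ultimately have "real (\<kappa> N n) / 2 ^ n \<le> u n"
        unfolding u_def by (intro divide_right_mono) auto
      thus ?thesis by simp
    qed
    ultimately show "\<exists>no. \<forall>n\<ge>no. norm (real (\<kappa> N n) / 2 ^ n - 0) < e"
      unfolding eventually_sequentially by (meson order_le_less_trans)
  qed
  then obtain k :: "nat \<Rightarrow> nat" where k: "(\<lambda>n. real (k n) / 2 ^ n) \<longlonglongrightarrow> 0"
    "\<And>N. eventually (\<lambda>n. \<kappa> N n \<le> k n) sequentially"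
    using diagonal_majorant by blast
  show thesis
  proof (rule that[OF k(1)])
    fix N
    show "eventually (\<lambda>n. 2 ^ (n + 1) * V (real N * 2 ^ (n + 1)) \<le> (3/2) ^ k n) sequentially"
      using k(2)[of N]
    proof eventually_elim
      case (elim n)
      have "a N n \<le> (3/2) ^ \<kappa> N n" by (rule a_le)
      also have "\<dots> \<le> (3/2) ^ k n" using elim by (intro power_increasing) auto
      finally show ?case by (simp add: a_def)
    qed
  qed
qed

text \<open>The polynomial (1 + x)^k - 1 has nonnegative coefficients, so its modulus is at most its
  value at |x|.\<close>

lemma norm_power_one_plus_minus_one:
  fixes x :: complex
  shows "norm ((1 + x) ^ k - 1) \<le> (1 + norm x) ^ k - 1"
proof (induction k)
  case (Suc k)
  have "(1 + x) ^ Suc k - 1 = (1 + x) * ((1 + x) ^ k - 1) + x" by (simp add: algebra_simps)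
  also have "norm \<dots> \<le> norm (1 + x) * norm ((1 + x) ^ k - 1) + norm x"
    by (metis norm_mult norm_triangle_ineq)
  also have "\<dots> \<le> (1 + norm x) * ((1 + norm x) ^ k - 1) + norm x"
    using norm_triangle_ineq[of 1 x] by (intro add_mono mult_mono Suc) auto
  finally show ?case by (simp add: algebra_simps)
qed simp

text \<open>Writing q = Re q (1 + x), the hypothesis reads k |x| \<le> 1/3. Then (1 + x)^k differs
  from 1 by at most exp(1/3) - 1 \<le> 1/2, and the real part keeps half of (Re q)^k.\<close>

lemma Re_power_ge:
  assumes q: "Re q > 0" and k: "real k * \<bar>Im q\<bar> \<le> Re q / 3"
  shows "Re (q ^ k) \<ge> Re q ^ k / 2"
proof -
  define x where "x = \<i> * of_real (Im q / Re q)"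
  have q_eq: "q = of_real (Re q) * (1 + x)"
    using q by (simp add: x_def complex_eq_iff)
  have nx: "real k * norm x \<le> 1 / 3"
    using q k by (simp add: x_def norm_mult norm_divide field_simps)
  have "(1 + norm x) ^ k \<le> exp (norm x) ^ k" by (intro power_mono) auto
  also have "\<dots> = exp (real k * norm x)" by (simp add: exp_of_nat_mult)
  also have "\<dots> \<le> exp (1 / 3)" using nx by simp
  \<comment> \<open>Cubing reduces this to e \<le> 3 \<le> 27/8.\<close>
  also have "exp (1 / 3) \<le> (3 / 2 :: real)"
  proof (rule power_le_imp_le_base)
    have "exp (1 / 3 :: real) ^ Suc 2 = exp 1" by (simp add: exp_of_nat_mult[symmetric])
    also have "\<dots> \<le> (3 / 2) ^ Suc 2"
      using exp_le by (rule order_trans) (simp add: power_divide)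
    finally show "exp (1 / 3 :: real) ^ Suc 2 \<le> (3 / 2) ^ Suc 2" .
  qed simp
  finally have "norm ((1 + x) ^ k - 1) \<le> 1 / 2"
    using norm_power_one_plus_minus_one[of x k] by linarith
  hence "Re ((1 + x) ^ k) \<ge> 1 / 2"
    using abs_Re_le_cmod[of "(1 + x) ^ k - 1"] by simp
  hence "Re q ^ k * (1 / 2) \<le> Re q ^ k * Re ((1 + x) ^ k)"
    using q by (intro mult_left_mono) auto
  also have "\<dots> = Re (q ^ k)"
  proof -
    have "q ^ k = of_real (Re q ^ k) * (1 + x) ^ k"
      by (metis q_eq of_real_power power_mult_distrib)
    thus ?thesis by simp
  qed
  finally show ?thesis by simp
qed

text \<open>The function is \<open>exp (2 - G)\<close> with \<open>G z = \<Sum>n. 2\<^sup>-\<^sup>n (1 + (z / 2\<^sup>n)\<^sup>2) ^ k n\<close>. Since \<open>k n = o(2\<^sup>n)\<close>,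
  the arguments of all summands become small on a strip as the real part grows, whence
  \<open>Re G\<close> dominates each summand there; the summand with \<open>2\<^sup>n \<le> \<bar>Re z\<bar> \<le> 2\<^sup>n\<^sup>+\<^sup>1\<close> dominates \<open>V\<close>.\<close>

theorem rapidly_decaying_entire_function_exists:
  assumes nonneg: "\<And>t. 0 \<le> t \<Longrightarrow> 0 \<le> V t" and mono: "mono_on {0..} V" and V: "subexp V"
  obtains P :: "complex \<Rightarrow> complex" where "P holomorphic_on UNIV" "P 0 = 1"
    "\<And>(N::nat) b. \<exists>B. \<forall>z. \<bar>Im z\<bar> \<le> b \<longrightarrow> exp (V (real N * \<bar>Re z\<bar>)) * cmod (P z) \<le> B"
proof -
  obtain k :: "nat \<Rightarrow> nat" where k: "(\<lambda>n. real (k n) / 2 ^ n) \<longlonglongrightarrow> 0"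
    "\<And>N. eventually (\<lambda>n. 2 ^ (n + 1) * V (real N * 2 ^ (n + 1)) \<le> (3/2) ^ k n) sequentially"
    using exponent_sequence_exists[OF nonneg V] by blast
  define q where "q = (\<lambda>n (z::complex). 1 + (z / 2 ^ n)\<^sup>2)"
  define T where "T = (\<lambda>n z. (1/2) ^ n * q n z ^ k n)"
  define G where "G = (\<lambda>z. \<Sum>n. T n z)"
  obtain K where K: "\<And>n. real (k n) / 2 ^ n \<le> K"
    using convergent_imp_Bseq[OF convergentI[OF k(1)]] unfolding Bseq_def by auto
  have K0: "K \<ge> 0" using K[of 0] by (smt (verit) of_nat_0_le_iff divide_nonneg_nonneg zero_le_power)
  \<comment> \<open>The source of locally uniform convergence: the power is at most exp(k n |z|^2 /
    4^n), and boundedness of k n / 2^n makes this at most exp(K r^2) for all n.\<close>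
  have T_le: "norm (T n z) \<le> (1/2) ^ n * exp (K * r\<^sup>2)" if "norm z \<le> r" for n z r
  proof -
    have "norm (q n z) \<le> 1 + (norm z / 2 ^ n)\<^sup>2"
      unfolding q_def by (rule norm_triangle_le) (simp add: norm_power norm_divide)
    also have "\<dots> \<le> exp ((norm z / 2 ^ n)\<^sup>2)" by (rule exp_ge_add_one_self)
    finally have "norm (q n z) ^ k n \<le> exp ((norm z / 2 ^ n)\<^sup>2) ^ k n" by (intro power_mono) auto
    also have "\<dots> = exp ((real (k n) / 2 ^ n) * ((norm z)\<^sup>2 / 2 ^ n))"
      by (simp add: exp_of_nat_mult[symmetric] power_divide power2_eq_square)
    also have "\<dots> \<le> exp (K * r\<^sup>2)"
    proof -
      have "(norm z)\<^sup>2 / 2 ^ n \<le> (norm z)\<^sup>2 / 1" by (intro divide_left_mono) auto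
      also have "\<dots> \<le> r\<^sup>2" using that by (simp add: power_mono)
      finally have "(real (k n) / 2 ^ n) * ((norm z)\<^sup>2 / 2 ^ n) \<le> K * r\<^sup>2"
        using K K0 by (intro mult_mono) auto
      thus ?thesis unfolding exp_le_cancel_iff .
    qed
    finally show ?thesis by (simp add: T_def norm_mult norm_power)
  qed
  have summ: "summable (\<lambda>n. T n z)" for z
    by (rule summable_comparison_test'[OF _ T_le[OF order_refl]]) (simp add: summable_mult2)
  have "G holomorphic_on UNIV"
  proof (rule holomorphic_uniform_sequence[where f = "\<lambda>m z. \<Sum>n<m. T n z"])
    show "(\<lambda>z. \<Sum>n<m. T n z) holomorphic_on UNIV" for m
      unfolding T_def q_def by (intro holomorphic_intros) auto
    fix z :: complex
    have "uniform_limit (cball z 1) (\<lambda>m z. \<Sum>n<m. T n z) (\<lambda>z. \<Sum>n. T n z) sequentially"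
    proof (rule Weierstrass_m_test)
      fix n y assume "y \<in> cball z 1"
      hence "norm y \<le> norm z + 1" using norm_triangle_ineq2[of y z] by (auto simp: dist_norm norm_minus_commute)
      thus "norm (T n y) \<le> (1/2) ^ n * exp (K * (norm z + 1)\<^sup>2)" by (rule T_le)
    qed (simp add: summable_mult2)
    thus "\<exists>d>0. cball z d \<subseteq> UNIV \<and> uniform_limit (cball z d) (\<lambda>m z. \<Sum>n<m. T n z) G sequentially"
      unfolding G_def by (intro exI[of _ 1]) auto
  qed auto
  \<comment> \<open>The 2 is G 0, the sum of the coefficients 2^-n, and normalises P at the
    origin.\<close>
  define P where "P = (\<lambda>z. exp (2 - G z))"
  have Phol: "P holomorphic_on UNIV" unfolding P_def by (intro holomorphic_intros \<open>G holomorphic_on UNIV\<close>)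
  have "T n 0 = (1/2) ^ n" for n by (simp add: T_def q_def)
  hence "G 0 = 2" unfolding G_def using suminf_geometric[of "1/2 :: complex"] by simp
  hence P0: "P 0 = 1" by (simp add: P_def)
  have nP: "norm (P z) = exp (2 - Re (G z))" for z by (simp add: P_def)
  have ReG: "Re (G z) = (\<Sum>n. Re (T n z))" for z
    unfolding G_def by (rule bounded_linear.suminf[OF bounded_linear_Re summ])
  have ReT: "Re (T n z) = (1/2) ^ n * Re (q n z ^ k n)" for n z
  proof -
    have "T n z = of_real ((1/2) ^ n) * (q n z ^ k n)" by (simp add: T_def)
    thus ?thesis by simp
  qed
  have Req: "Re (q n z) = 1 + ((Re z)\<^sup>2 - (Im z)\<^sup>2) / 4 ^ n"
    and Imq: "Im (q n z) = 2 * (Re z * Im z) / 4 ^ n" for n z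
  proof -
    have "q n z = 1 + z\<^sup>2 / of_real (4 ^ n)"
      by (simp add: q_def power_divide power2_eq_square power_mult_distrib[symmetric])
    thus "Re (q n z) = 1 + ((Re z)\<^sup>2 - (Im z)\<^sup>2) / 4 ^ n" "Im (q n z) = 2 * (Re z * Im z) / 4 ^ n"
      by (simp_all only: plus_complex.sel Re_divide_of_real Im_divide_of_real Re_power2 Im_power2 one_complex.sel)
  qed
  have decay: "\<exists>X. \<forall>z. \<bar>Im z\<bar> \<le> b \<longrightarrow> \<bar>Re z\<bar> \<ge> X \<longrightarrow> V (real N * \<bar>Re z\<bar>) \<le> Re (G z)"
    if b: "b > 0" for N :: nat and b :: real
  proof -
    \<comment> \<open>With t = |Im z| / 2^n, the first two conditions give k n * t \<le> 1/4 and t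
      \<le> 1/2 for the late summands; the third lets a single late summand dominate V.\<close>
    have "eventually (\<lambda>n. real (k n) / 2 ^ n < 1 / (4 * b)) sequentially"
      using order_tendstoD(2)[OF k(1), of "1 / (4 * b)"] b by simp
    moreover have "eventually (\<lambda>n::nat. 2 * b \<le> 2 ^ n) sequentially"
      by real_asymp
    moreover note k(2)[of N]
    ultimately have "eventually (\<lambda>n. real (k n) / 2 ^ n < 1 / (4 * b) \<and> 2 * b \<le> 2 ^ n \<and>
       2 ^ (n + 1) * V (real N * 2 ^ (n + 1)) \<le> (3/2) ^ k n) sequentially"
      by eventually_elim simp
    then obtain n1 where n1: "\<And>n. n \<ge> n1 \<Longrightarrow> real (k n) / 2 ^ n < 1 / (4 * b)"
      "\<And>n. n \<ge> n1 \<Longrightarrow> 2 * b \<le> 2 ^ n"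
      "\<And>n. n \<ge> n1 \<Longrightarrow> 2 ^ (n + 1) * V (real N * 2 ^ (n + 1)) \<le> (3/2) ^ k n"
      unfolding eventually_sequentially by blast
    define M where "M = (\<Sum>n<n1. real (k n))"
    have M: "real (k n) \<le> M" if "n < n1" for n
      unfolding M_def using that by (intro member_le_sum) auto
    \<comment> \<open>The three lower bounds for |Re z| serve in turn: its dyadic index is at least
      n1; the real part dominates the imaginary part; and the summands before n1, whose exponents
      are at most M, have small arguments too.\<close>
    define X where "X = max (2 ^ n1) (max (2 * b) (8 * b * M))"
    have "V (real N * \<bar>Re z\<bar>) \<le> Re (G z)" if zb: "\<bar>Im z\<bar> \<le> b" and zX: "\<bar>Re z\<bar> \<ge> X" for z
    proof -
      define x y where "x = \<bar>Re z\<bar>" and "y = \<bar>Im z\<bar>"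
      have y: "0 \<le> y" "y \<le> b" and x: "x \<ge> 2 ^ n1" "x \<ge> 2 * b" "x \<ge> 8 * b * M"
        using zb zX by (auto simp: x_def y_def X_def)
      have x0: "x > 0" using x b by simp
      have Rq: "Re (q n z) = 1 + (x\<^sup>2 - y\<^sup>2) / 4 ^ n" and Iq: "\<bar>Im (q n z)\<bar> = 2 * (x * y) / 4 ^ n" for n
        by (auto simp: Req Imq x_def y_def abs_mult)
      have y2: "y\<^sup>2 \<le> b\<^sup>2" using y by (intro power_mono) auto
      have x2: "4 * b\<^sup>2 \<le> x\<^sup>2" using power_mono[OF x(2), of 2] b by (simp add: power_mult_distrib)
      have good: "Re (q n z) > 0 \<and> real (k n) * \<bar>Im (q n z)\<bar> \<le> Re (q n z) / 3" for n
      proof (cases "n < n1")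
        case True
        have p: "real (k n) * (8 * y) \<le> x"
        proof -
          have "real (k n) * (8 * y) \<le> M * (8 * b)"
            using M[OF True] y by (intro mult_mono) (auto simp: M_def sum_nonneg)
          thus ?thesis using x(3) by (simp add: mult_ac)
        qed
        have "real (k n) * \<bar>Im (q n z)\<bar> = (real (k n) * (8 * y)) * x / 4 / 4 ^ n"
          unfolding Iq by (simp add: field_simps)
        also have "\<dots> \<le> x * x / 4 / 4 ^ n"
          using p x0 by (intro divide_right_mono mult_right_mono) auto
        also have "\<dots> \<le> (x\<^sup>2 - y\<^sup>2) / 3 / 4 ^ n"
          using x2 y2 by (intro divide_right_mono) (auto simp: power2_eq_square)
        also have "\<dots> \<le> Re (q n z) / 3" unfolding Rq by (simp add: field_simps)
        finally have 1: "real (k n) * \<bar>Im (q n z)\<bar> \<le> Re (q n z) / 3" .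
        have "x\<^sup>2 - y\<^sup>2 \<ge> 0" using x2 y2 by (smt (verit) zero_le_power2)
        hence "Re (q n z) > 0" unfolding Rq by (simp add: add_pos_nonneg)
        thus ?thesis using 1 by simp
      next
        case False
        define s where "s = x / 2 ^ n"
        define t where "t = y / 2 ^ n"
        have tb: "t \<le> b / 2 ^ n" using y by (simp add: t_def divide_right_mono)
        have t: "0 \<le> t" "t \<le> 1 / 2"
          using tb n1(2)[of n] False y by (auto simp: t_def field_simps)
        have Rq': "Re (q n z) = 1 + s\<^sup>2 - t\<^sup>2"
          unfolding Rq s_def t_def by (simp add: power_divide power2_eq_square diff_divide_distrib power_mult_distrib[symmetric])
        have Iq': "\<bar>Im (q n z)\<bar> = 2 * s * t"
          unfolding Iq s_def t_def by (simp add: power_mult_distrib[symmetric])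
        have "t\<^sup>2 \<le> (1/2)\<^sup>2" using t by (intro power_mono) auto
        hence R34: "Re (q n z) \<ge> 3/4 * (1 + s\<^sup>2)" unfolding Rq' by (simp add: power2_eq_square)
        have kt: "real (k n) * t \<le> 1 / 4"
        proof -
          have "real (k n) * t \<le> (real (k n) / 2 ^ n) * b" using mult_left_mono[OF tb, of "real (k n)"] by simp
          also have "\<dots> \<le> 1 / (4 * b) * b" using n1(1)[of n] False b by (intro mult_right_mono) auto
          finally show ?thesis using b by simp
        qed
        have "real (k n) * \<bar>Im (q n z)\<bar> = 2 * s * (real (k n) * t)" unfolding Iq' by simp
        also have "\<dots> \<le> 2 * s * (1 / 4)"
          using kt x0 by (intro mult_left_mono) (auto simp: s_def)
        also have "\<dots> \<le> 1/4 * (1 + s\<^sup>2)" using zero_le_power2[of "1 - s"] by (simp add: power2_eq_square algebra_simps)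
        also have "\<dots> \<le> Re (q n z) / 3" using R34 by simp
        finally have "real (k n) * \<bar>Im (q n z)\<bar> \<le> Re (q n z) / 3" .
        moreover have "Re (q n z) > 0"
          by (rule less_le_trans[OF _ R34]) (simp add: add_pos_nonneg)
        ultimately show ?thesis by simp
      qed
      have ge: "Re (T n z) \<ge> (1/2) ^ n * (Re (q n z) ^ k n / 2)" for n
        unfolding ReT using good[of n] by (intro mult_left_mono Re_power_ge) auto
      \<comment> \<open>Since every summand has nonnegative real part, Re G is at least the real
        part of any one of them.\<close>
      have T0: "Re (T n z) \<ge> 0" for n
        using ge[of n] good[of n] by (smt (verit) mult_nonneg_nonneg zero_le_power divide_nonneg_nonneg)
      obtain n where n: "2 ^ n \<le> x" "x < 2 ^ (n + 1)" "n \<ge> n1"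
      proof -
        obtain m where "x < 2 ^ m" using real_arch_pow[of 2 x] by auto
        define n where "n = (LEAST m. x < 2 ^ (m + 1))"
        have ex: "x < 2 ^ (m + 1)" using \<open>x < 2 ^ m\<close> x0 by simp
        have 1: "x < 2 ^ (n + 1)" unfolding n_def by (rule LeastI[of _ m]) (rule ex)
        have 2: "n \<ge> n1"
        proof (rule ccontr)
          assume "\<not> n1 \<le> n"
          hence "(2::real) ^ (n + 1) \<le> 2 ^ n1" by (intro power_increasing) auto
          thus False using 1 x(1) by simp
        qed
        have 3: "2 ^ n \<le> x"
        proof (cases n)
          case 0 thus ?thesis using x(1) 2 by simp
        next
          case (Suc j)
          have "\<not> x < 2 ^ (j + 1)" using Suc not_less_Least[of j "\<lambda>m. x < 2 ^ (m + 1)"] by (simp add: n_def)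
          thus ?thesis using Suc by simp
        qed
        show thesis using that 1 2 3 by blast
      qed
      have "Re (q n z) \<ge> 3/2"
      proof -
        have "y\<^sup>2 / 4 ^ n \<le> 1/4"
        proof -
          have "y / 2 ^ n \<le> 1/2" using y n1(2)[OF n(3)] by (simp add: field_simps)
          hence "(y / 2 ^ n)\<^sup>2 \<le> (1/2)\<^sup>2" using y by (intro power_mono) auto
          thus ?thesis by (simp add: power_divide power2_eq_square power_mult_distrib[symmetric])
        qed
        moreover have "x\<^sup>2 / 4 ^ n \<ge> 1"
        proof -
          have "1 \<le> x / 2 ^ n" using n(1) by simp
          hence "1\<^sup>2 \<le> (x / 2 ^ n)\<^sup>2" by (intro power_mono) auto
          thus ?thesis by (simp add: power_divide power2_eq_square power_mult_distrib[symmetric])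
        qed
        ultimately show ?thesis unfolding Rq diff_divide_distrib by linarith
      qed
      hence pw: "(3/2) ^ k n \<le> Re (q n z) ^ k n" by (intro power_mono) auto
      have "V (real N * x) \<le> V (real N * 2 ^ (n + 1))"
        using n(2) x0 by (intro mono_onD[OF mono]) (auto intro!: mult_left_mono)
      also have "\<dots> \<le> (1/2) ^ n * ((3/2) ^ k n / 2)"
        using n1(3)[OF n(3)] by (simp add: field_simps power_divide)
      also have "\<dots> \<le> (1/2) ^ n * (Re (q n z) ^ k n / 2)"
        using pw by (intro mult_left_mono divide_right_mono) auto
      also have "\<dots> \<le> Re (T n z)" by (rule ge)
      also have "\<dots> \<le> (\<Sum>n. Re (T n z))"
      proof -
        have "summable (\<lambda>n. Re (T n z))" by (rule bounded_linear.summable[OF bounded_linear_Re summ])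
        from sum_le_suminf[OF this, of "{n}"] T0 show ?thesis by simp
      qed
      also have "\<dots> = Re (G z)" by (rule ReG[symmetric])
      finally show ?thesis by (simp add: x_def)
    qed
    thus ?thesis by blast
  qed
  show thesis
  proof (rule that[OF Phol P0])
    fix N :: nat and b :: real
    define c where "c = max b 1"
    have c: "c > 0" "b \<le> c" by (auto simp: c_def)
    obtain X where X: "\<And>z. \<bar>Im z\<bar> \<le> c \<Longrightarrow> \<bar>Re z\<bar> \<ge> X \<Longrightarrow> V (real N * \<bar>Re z\<bar>) \<le> Re (G z)"
      using decay[OF c(1)] by blast
    define S where "S = cbox (Complex (- \<bar>X\<bar>) (-c)) (Complex \<bar>X\<bar> c)"
    have "continuous_on S P" using holomorphic_on_imp_continuous_on[OF Phol] continuous_on_subset by blast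
    hence "bounded (P ` S)" by (intro compact_imp_bounded compact_continuous_image) (auto simp: S_def)
    then obtain B where B: "\<And>z. z \<in> S \<Longrightarrow> norm (P z) \<le> B" by (auto simp: bounded_iff)
    have B0: "B \<ge> 0" using order_trans[OF norm_ge_zero B[of 0]] c by (simp add: S_def in_cbox_complex_iff)
    show "\<exists>B. \<forall>z. \<bar>Im z\<bar> \<le> b \<longrightarrow> exp (V (real N * \<bar>Re z\<bar>)) * cmod (P z) \<le> B"
    \<comment> \<open>exp 2 serves where V \<le> Re G; the other term bounds the product on the
      remaining part of the strip, which lies in the compact rectangle S.\<close>
    proof (intro exI[of _ "max (exp 2) (exp (V (real N * \<bar>X\<bar>)) * B)"] allI impI)
      fix z assume "\<bar>Im z\<bar> \<le> b"
      hence z: "\<bar>Im z\<bar> \<le> c" using c by simp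
      show "exp (V (real N * \<bar>Re z\<bar>)) * cmod (P z) \<le> max (exp 2) (exp (V (real N * \<bar>X\<bar>)) * B)"
      proof (cases "\<bar>Re z\<bar> \<ge> X")
        case True
        have "exp (V (real N * \<bar>Re z\<bar>)) * cmod (P z) = exp (V (real N * \<bar>Re z\<bar>) + (2 - Re (G z)))"
          by (simp add: nP exp_add)
        also have "\<dots> \<le> exp 2" using X[OF z True] by simp
        finally show ?thesis by simp
      next
        case False
        have "V (real N * \<bar>Re z\<bar>) \<le> V (real N * \<bar>X\<bar>)"
          using False by (intro mono_onD[OF mono]) (auto intro!: mult_left_mono)
        moreover have "norm (P z) \<le> B" using False z by (intro B) (auto simp: S_def in_cbox_complex_iff)
        ultimately have "exp (V (real N * \<bar>Re z\<bar>)) * cmod (P z) \<le> exp (V (real N * \<bar>X\<bar>)) * B"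
          using B0 by (intro mult_mono) auto
        thus ?thesis by simp
      qed
    qed
  qed
qed

subsection \<open>Smooth cutoff functions\<close>

text \<open>k-fold differentiability, without continuity of the last derivative; once it holds for
  all k, each derivative is differentiable and so continuous.\<close>

primrec smk :: "nat \<Rightarrow> (real \<Rightarrow> real) \<Rightarrow> bool" where
  "smk 0 f \<longleftrightarrow> True"
| "smk (Suc k) f \<longleftrightarrow> (\<exists>f'. (\<forall>x. (f has_real_derivative f' x) (at x)) \<and> smk k f')"

definition smooth_real :: "(real \<Rightarrow> real) \<Rightarrow> bool" where
  "smooth_real f \<longleftrightarrow> (\<forall>k. smk k f)"

lemma smk_pred: "smk (Suc k) f \<Longrightarrow> smk k f"
  by (induction k arbitrary: f) (simp, metis smk.simps(2))

lemma smk_const [simp]: "smk k (\<lambda>_. c)"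
proof (induction k arbitrary: c)
  case (Suc k)
  show ?case using Suc[of 0] by (auto intro!: exI[of _ "\<lambda>_. 0"])
qed simp

lemma smk_add: "smk k f \<Longrightarrow> smk k g \<Longrightarrow> smk k (\<lambda>x. f x + g x)"
proof (induction k arbitrary: f g)
  case (Suc k)
  then obtain f' g' where "\<And>x. (f has_real_derivative f' x) (at x)" "smk k f'"
    "\<And>x. (g has_real_derivative g' x) (at x)" "smk k g'" by auto
  thus ?case using Suc.IH[of f' g'] by (auto intro!: exI[of _ "\<lambda>x. f' x + g' x"] DERIV_add)
qed simp

lemma smk_mult: "smk k f \<Longrightarrow> smk k g \<Longrightarrow> smk k (\<lambda>x. f x * g x)"
proof (induction k arbitrary: f g)
  case (Suc k)
  then obtain f' g' where d: "\<And>x. (f has_real_derivative f' x) (at x)" "smk k f'"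
    "\<And>x. (g has_real_derivative g' x) (at x)" "smk k g'" by auto
  have "smk k (\<lambda>x. f' x * g x + g' x * f x)"
    by (intro smk_add Suc.IH d smk_pred[OF Suc.prems(1)] smk_pred[OF Suc.prems(2)])
  with DERIV_mult[OF d(1) d(3)] show ?case
    unfolding smk.simps by (intro exI[of _ "\<lambda>x. f' x * g x + g' x * f x"]) auto
qed simp

lemma smk_inverse: "smk k f \<Longrightarrow> (\<And>x. f x \<noteq> 0) \<Longrightarrow> smk k (\<lambda>x. inverse (f x))"
proof (induction k arbitrary: f)
  case (Suc k)
  then obtain f' where d: "\<And>x. (f has_real_derivative f' x) (at x)" "smk k f'" by auto
  have i: "smk k (\<lambda>x. inverse (f x))" by (rule Suc.IH[OF smk_pred[OF Suc.prems(1)] Suc.prems(2)])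
  have "smk k (\<lambda>x. (-1) * ((inverse (f x) * f' x) * inverse (f x)))"
    by (intro smk_mult i d smk_const)
  moreover have "((\<lambda>x. inverse (f x)) has_real_derivative (-1) * ((inverse (f x) * f' x) * inverse (f x))) (at x)" for x
    using DERIV_inverse'[OF d(1) Suc.prems(2)] by simp
  ultimately show ?case by (auto intro!: exI[of _ "\<lambda>x. (-1) * ((inverse (f x) * f' x) * inverse (f x))"])
qed simp

lemma smk_affine: "smk k f \<Longrightarrow> smk k (\<lambda>x. f (a * x + b))"
proof (induction k arbitrary: f)
  case (Suc k)
  then obtain f' where d: "\<And>x. (f has_real_derivative f' x) (at x)" "smk k f'" by auto
  have "((\<lambda>x. f (a * x + b)) has_real_derivative a * f' (a * x + b)) (at x)" for x
    by (rule DERIV_chain2[OF d(1), THEN DERIV_cong]) (auto intro!: derivative_eq_intros)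
  moreover have "smk k (\<lambda>x. a * f' (a * x + b))" by (intro smk_mult smk_const Suc.IH d)
  ultimately show ?case by (auto intro!: exI[of _ "\<lambda>x. a * f' (a * x + b)"])
qed simp

lemma smooth_real_deriv:
  assumes "smooth_real f"
  shows "(f has_real_derivative deriv f x) (at x)" "smooth_real (deriv f)"
proof -
  have *: "smk (Suc k) f" for k using assms by (simp add: smooth_real_def del: smk.simps)
  have d: "(f has_real_derivative deriv f x) (at x)" for x
    using *[of 0] by (auto simp: DERIV_deriv_iff_has_field_derivative)
  thus "(f has_real_derivative deriv f x) (at x)" .
  have "smk k (deriv f)" for k
  proof -
    obtain f' where f': "\<And>x. (f has_real_derivative f' x) (at x)" "smk k f'" using *[of k] by auto
    have "f' = deriv f" using DERIV_imp_deriv[OF f'(1)] by auto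
    thus ?thesis using f'(2) by simp
  qed
  thus "smooth_real (deriv f)" by (simp add: smooth_real_def)
qed

lemma smooth_real_continuous: "smooth_real f \<Longrightarrow> continuous_on S f"
  by (meson DERIV_continuous_on has_field_derivative_at_within smooth_real_deriv(1))

lemma smooth_real_deriv_zero:
  assumes "smooth_real f" "open S" "\<And>x. x \<in> S \<Longrightarrow> f x = c" "x \<in> S"
  shows "deriv f x = 0"
proof -
  have "(f has_real_derivative 0) (at x)"
    using has_field_derivative_transform_within_open[OF DERIV_const assms(2,4), of c f] assms(3) by simp
  thus ?thesis by (rule DERIV_imp_deriv)
qed

text \<open>The products q(1/t) exp(-1/t), continued by 0: a family that is closed under
  differentiation and contains the classical flat function as \<open>flat 1\<close>.\<close>

definition flat :: "real poly \<Rightarrow> real \<Rightarrow> real" where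
  "flat q t = (if t > 0 then poly q (1 / t) * exp (- (1 / t)) else 0)"

lemma flat_tendsto_0: "(flat q \<longlongrightarrow> 0) (at 0)"
proof -
  have "((\<lambda>s. \<Sum>i\<le>degree q. coeff q i * (s ^ i / exp s)) \<longlongrightarrow> (\<Sum>i\<le>degree q. coeff q i * 0)) at_top"
    by (intro tendsto_intros tendsto_power_div_exp_0)
  hence "((\<lambda>s. poly q s * exp (- s)) \<longlongrightarrow> 0) at_top"
    by (simp add: poly_altdef sum_distrib_right exp_minus divide_inverse mult.assoc)
  hence "((\<lambda>t. poly q (inverse t) * exp (- inverse t)) \<longlongrightarrow> 0) (at_right 0)"
    by (rule filterlim_compose[OF _ filterlim_inverse_at_top_right])
  hence "(flat q \<longlongrightarrow> 0) (at_right 0)"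
    by (rule Lim_transform_eventually)
      (auto simp: flat_def eventually_at_right_field inverse_eq_divide intro!: exI[of _ 1])
  moreover have "(flat q \<longlongrightarrow> 0) (at_left 0)"
    by (rule Lim_transform_eventually[OF tendsto_const])
      (auto simp: flat_def eventually_at_left_field intro!: exI[of _ "-1"])
  ultimately show ?thesis by (simp add: filterlim_split_at)
qed

text \<open>In the variable s = 1/t, differentiation sends q(s) exp(-s) to s^2 (q - q')(s) exp(-s),
  again a member of the family; all higher derivatives follow by induction.\<close>

lemma flat_has_derivative:
  "(flat q has_real_derivative flat ([:0, 0, 1:] * (q - pderiv q)) t) (at t)"
proof -
  consider "t > 0" | "t < 0" | "t = 0" by linarith
  thus ?thesis
  proof cases
    case 1
    have "((\<lambda>t. poly q (1 / t) * exp (- (1 / t))) has_real_derivative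
        flat ([:0, 0, 1:] * (q - pderiv q)) t) (at t)"
      using 1 by (auto intro!: derivative_eq_intros DERIV_chain2[OF poly_DERIV]
          simp: flat_def field_simps power2_eq_square)
    thus ?thesis
      by (rule has_field_derivative_transform_within_open[where S="{0<..}"]) (use 1 in \<open>auto simp: flat_def\<close>)
  next
    case 2
    have "((\<lambda>t. 0) has_real_derivative flat ([:0, 0, 1:] * (q - pderiv q)) t) (at t)"
      using 2 by (simp add: flat_def)
    thus ?thesis
      by (rule has_field_derivative_transform_within_open[where S="{..<0}"]) (use 2 in \<open>auto simp: flat_def\<close>)
  next
    case 3
    \<comment> \<open>The difference quotient at 0 is itself a flat function: division by h
      multiplies the polynomial by its variable.\<close>
    have "((\<lambda>h. flat q h / h) \<longlongrightarrow> 0) (at 0)"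
      by (rule Lim_transform_eventually[OF flat_tendsto_0[of "[:0, 1:] * q"]])
        (auto simp: flat_def eventually_at_filter)
    thus ?thesis unfolding 3 DERIV_def by (simp add: flat_def)
  qed
qed

lemma smooth_real_flat: "smooth_real (flat q)"
proof -
  have "smk k (flat q)" for k
    by (induction k arbitrary: q) (auto intro!: exI flat_has_derivative)
  thus ?thesis by (simp add: smooth_real_def)
qed

text \<open>The smooth transition from 0 on t \<le> 0 to 1 on t \<ge> 1; the denominator is positive
  because t or 1 - t is.\<close>

definition step :: "real \<Rightarrow> real" where
  "step t = flat 1 t * inverse (flat 1 t + flat 1 (1 - t))"

lemma flat_1: "flat 1 t \<ge> 0" "t > 0 \<Longrightarrow> flat 1 t > 0" "t \<le> 0 \<Longrightarrow> flat 1 t = 0"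
  by (auto simp: flat_def)

lemma smooth_real_step: "smooth_real step"
proof -
  have pos: "flat 1 t + flat 1 (1 - t) \<noteq> 0" for t
  proof (cases "t > 0")
    case True thus ?thesis using flat_1(2)[of t] flat_1(1)[of "1 - t"] by linarith
  next
    case False thus ?thesis using flat_1(2)[of "1 - t"] flat_1(1)[of t] by linarith
  qed
  have f: "smk k (flat 1)" for k using smooth_real_flat by (simp add: smooth_real_def)
  have "smk k (\<lambda>t. flat 1 (1 - t))" for k using smk_affine[OF f, of k "-1" 1] by simp
  hence "smk k (\<lambda>t. flat 1 t * inverse (flat 1 t + flat 1 (1 - t)))" for k
    by (intro smk_mult smk_inverse smk_add f pos)
  thus ?thesis by (simp add: smooth_real_def step_def[abs_def])
qed

lemma step_0: "t \<le> 0 \<Longrightarrow> step t = 0"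
  by (simp add: step_def flat_1)

lemma step_1: "t \<ge> 1 \<Longrightarrow> step t = 1"
  using flat_1(2)[of t] flat_1(3)[of "1 - t"] by (simp add: step_def)

lemma has_pd_Re:
  assumes "(\<psi> has_real_derivative D) (at (Re z))"
  shows "has_pd v (\<lambda>z. of_real (\<psi> (Re z))) z (of_real (Re v * D))"
proof -
  have "((\<lambda>t. Re (z + t *\<^sub>R v)) has_real_derivative Re v) (at 0)"
    by (auto intro!: derivative_eq_intros)
  hence "((\<lambda>t. \<psi> (Re (z + t *\<^sub>R v))) has_real_derivative D * Re v) (at 0)"
    by (rule DERIV_chain2[rotated]) (use assms in simp)
  hence "((\<lambda>t. \<psi> (Re (z + t *\<^sub>R v))) has_vector_derivative Re v * D) (at 0)"
    by (simp add: has_real_derivative_iff_has_vector_derivative mult.commute)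
  thus ?thesis unfolding has_pd_def
    by (rule bounded_linear.has_vector_derivative[OF bounded_linear_of_real])
qed

lemma has_pd_Im:
  assumes "(\<psi> has_real_derivative D) (at (Im z))"
  shows "has_pd v (\<lambda>z. of_real (\<psi> (Im z))) z (of_real (Im v * D))"
proof -
  have "((\<lambda>t. Im (z + t *\<^sub>R v)) has_real_derivative Im v) (at 0)"
    by (auto intro!: derivative_eq_intros)
  hence "((\<lambda>t. \<psi> (Im (z + t *\<^sub>R v))) has_real_derivative D * Im v) (at 0)"
    by (rule DERIV_chain2[rotated]) (use assms in simp)
  hence "((\<lambda>t. \<psi> (Im (z + t *\<^sub>R v))) has_vector_derivative Im v * D) (at 0)"
    by (simp add: has_real_derivative_iff_has_vector_derivative mult.commute)
  thus ?thesis unfolding has_pd_def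
    by (rule bounded_linear.has_vector_derivative[OF bounded_linear_of_real])
qed

section \<open>From surjectivity to a nonzero holomorphic function\<close>

lemma wbd_of_compact_Re:
  assumes mono: "mono_on {0..} w" and c: "continuous_on UNIV \<psi>" and z: "\<And>x. x \<notin> {0..1} \<Longrightarrow> \<psi> x = 0"
  shows "wbd w h (\<lambda>z. of_real (\<psi> (Re z)))"
  unfolding wbd_def
proof (intro allI impI)
  fix N :: nat and b :: real
  have "bounded (\<psi> ` {0..1})" using c
    by (intro compact_imp_bounded compact_continuous_image) (auto intro: continuous_on_subset)
  then obtain B where B: "\<And>x. x \<in> {0..1} \<Longrightarrow> \<bar>\<psi> x\<bar> \<le> B"
    unfolding bounded_iff by (metis imageI real_norm_def)
  have B0: "B \<ge> 0" using B[of 0] by simp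
  have "weight w N z * cmod (of_real (\<psi> (Re z))) \<le> exp (w (real N)) * B" for z
  proof (cases "Re z \<in> {0..1}")
    case True
    have "real N * \<bar>Re z\<bar> \<le> real N * 1" using True by (intro mult_left_mono) auto
    hence "w (real N * \<bar>Re z\<bar>) \<le> w (real N)" by (intro mono_onD[OF mono]) auto
    thus ?thesis using B[OF True] B0 by (intro mult_mono) auto
  qed (use B0 z in auto)
  thus "\<exists>B. \<forall>z. \<bar>Im z\<bar> \<le> b \<longrightarrow> weight w N z * cmod (of_real (\<psi> (Re z))) \<le> B" by blast
qed

lemma K_space_compact_Re:
  assumes mono: "mono_on {0..} w" and "smooth_real \<psi>" "\<And>x. x \<notin> {0..1} \<Longrightarrow> \<psi> x = 0"
  shows "(\<lambda>z. of_real (\<psi> (Re z))) \<in> K_space w h"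
  unfolding K_space_eq_smooth
proof (rule smooth_coinduct[OF open_strip wbd_local,
    where X="\<lambda>f. \<exists>\<psi>. smooth_real \<psi> \<and> (\<forall>x. x \<notin> {0..1} \<longrightarrow> \<psi> x = 0) \<and> f = (\<lambda>z. of_real (\<psi> (Re z)))"])
  fix f :: "complex \<Rightarrow> complex"
  assume "\<exists>\<psi>. smooth_real \<psi> \<and> (\<forall>x. x \<notin> {0..1} \<longrightarrow> \<psi> x = 0) \<and> f = (\<lambda>z. of_real (\<psi> (Re z)))"
  then obtain \<psi> where \<psi>: "smooth_real \<psi>" "\<And>x. x \<notin> {0..1} \<Longrightarrow> \<psi> x = 0" and f: "f = (\<lambda>z. of_real (\<psi> (Re z)))"
    by blast
  have "continuous_on (strip h) f" unfolding f
    by (intro continuous_intros continuous_on_compose2[OF smooth_real_continuous[OF \<psi>(1), of UNIV]]) auto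
  moreover have "wbd w h f" unfolding f
    by (rule wbd_of_compact_Re[OF mono smooth_real_continuous[OF \<psi>(1)] \<psi>(2)])
  moreover have "\<exists>g. (\<exists>\<psi>. smooth_real \<psi> \<and> (\<forall>x. x \<notin> {0..1} \<longrightarrow> \<psi> x = 0) \<and> g = (\<lambda>z. of_real (\<psi> (Re z)))) \<and>
      (\<forall>z\<in>strip h. has_pd v f z (g z))" if "v \<in> dirs" for v
  proof (intro exI[of _ "\<lambda>z. of_real (Re v * deriv \<psi> (Re z))"] exI[of _ "\<lambda>x. Re v * deriv \<psi> x"] conjI allI impI ballI)
    show "smooth_real (\<lambda>x. Re v * deriv \<psi> x)"
      using smooth_real_deriv(2)[OF \<psi>(1)] by (simp add: smooth_real_def smk_mult)
    show "Re v * deriv \<psi> x = 0" if "x \<notin> {0..1}" for x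
      using smooth_real_deriv_zero[OF \<psi>(1), of "- {0..1}" 0 x] \<psi>(2) that by (simp add: open_Compl)
    show "has_pd v f z (of_real (Re v * deriv \<psi> (Re z)))" for z
      unfolding f by (rule has_pd_Re[OF smooth_real_deriv(1)[OF \<psi>(1)]])
  qed simp
  ultimately show "continuous_on (strip h) f \<and> wbd w h f \<and> (\<forall>v\<in>dirs. \<exists>g.
      (\<exists>\<psi>. smooth_real \<psi> \<and> (\<forall>x. x \<notin> {0..1} \<longrightarrow> \<psi> x = 0) \<and> g = (\<lambda>z. of_real (\<psi> (Re z)))) \<and>
      (\<forall>z\<in>strip h. has_pd v f z (g z)))" by blast
qed (use assms in blast)

text \<open>Unboundedness of w enters here: a nonzero constant value along a half-line, together
  with the weighted bound for N = 1, would bound w. The sign s covers both ends of the real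
  axis.\<close>

lemma K_space_constant_imp_zero:
  fixes s :: real
  assumes unb: "\<not> bdd_above (w ` {0..})" and mono: "mono_on {0..} w"
    and h: "0 < h" and f: "f \<in> K_space w h" and s: "\<bar>s\<bar> = 1"
    and c: "\<And>x. x \<ge> 1 \<Longrightarrow> f (of_real (s * x)) = a"
  shows "a = 0"
proof (rule ccontr)
  assume a: "a \<noteq> 0"
  obtain b where b: "0 < ereal b" "ereal b < h" using ereal_dense2[OF h] by auto
  have "wbd w h f" using f smooth_prop unfolding K_space_eq_smooth by blast
  then obtain B where B: "\<And>z. \<bar>Im z\<bar> \<le> b \<Longrightarrow> exp (w (real 1 * \<bar>Re z\<bar>)) * cmod (f z) \<le> B"
    unfolding wbd_def using b by (metis ereal_less(2))
  have B1: "exp (w x) \<le> B / cmod a" if "x \<ge> 1" for x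
    using B[of "of_real (s * x)"] c[OF that] a b s that by (simp add: field_simps abs_mult)
  have B0: "B / cmod a > 0" using B1[of 1] exp_gt_zero[of "w 1"] by linarith
  have "w x \<le> ln (B / cmod a)" if "x \<ge> 0" for x
  proof -
    have "w x \<le> w (max x 1)" using that by (intro mono_onD[OF mono]) auto
    also have "\<dots> \<le> ln (B / cmod a)" using B1[of "max x 1"] B0 by (simp add: ln_ge_iff)
    finally show ?thesis .
  qed
  hence "bdd_above (w ` {0..})" by (intro bdd_aboveI2) auto
  thus False using unb by blast
qed

text \<open>The Cauchy-Riemann equation turns the real differential, which sends h to Re h fx + Im h
  fy, into multiplication by the complex number fx.\<close>

lemma C1_dbar_zero_holomorphic:
  assumes U: "open U"
    and fx: "\<And>z. z \<in> U \<Longrightarrow> has_pd 1 f z (fx z)" and fy: "\<And>z. z \<in> U \<Longrightarrow> has_pd \<i> f z (fy z)"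
    and cfy: "continuous_on U fy" and CR: "\<And>z. z \<in> U \<Longrightarrow> fx z + \<i> * fy z = 0"
  shows "f holomorphic_on U"
proof -
  have "(f has_field_derivative fx z) (at z)" if z: "z \<in> U" for z
  proof -
    have "fx z = - (\<i> * fy z)" using CR[OF z] by (simp add: add_eq_0_iff2)
    hence fy_eq: "fy z = \<i> * fx z" by simp
    have "(\<lambda>h. Re h *\<^sub>R fx z + Im h *\<^sub>R fy z) = (*) (fx z)"
      unfolding fy_eq by (auto simp: fun_eq_iff complex_eq_iff algebra_simps)
    thus ?thesis using C1_has_derivative[OF U z fx fy cfy] by (simp add: has_field_derivative_def)
  qed
  thus ?thesis using U by (auto simp: holomorphic_on_open)
qed

text \<open>If \<open>dbar f\<close> and \<open>dbar\<close> of \<open>step (Re z)\<close> agree, then \<open>step (Re z) - f z\<close> is holomorphic with different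
  limits at both ends of the strip; its derivative is the desired function.\<close>

theorem surj_dbar_imp_holomorphic:
  assumes unb: "\<not> bdd_above (w ` {0..})" and mono: "mono_on {0..} w" and h: "0 < h"
    and surj: "surj_op (strip h) (K_space w h) dbar"
  shows "\<exists>f\<in>K_space w h. f holomorphic_on strip h \<and> (\<exists>z\<in>strip h. f z \<noteq> 0)"
proof -
  define \<phi> where "\<phi> = deriv step"
  have \<phi>: "smooth_real \<phi>" unfolding \<phi>_def by (rule smooth_real_deriv(2)[OF smooth_real_step])
  have \<phi>0: "\<phi> x = 0" if "x \<notin> {0..1}" for x
  proof (cases "x < 0")
    case True
    show ?thesis unfolding \<phi>_def
      by (rule smooth_real_deriv_zero[OF smooth_real_step, of "{..<0}" 0]) (use True in \<open>auto simp: step_0\<close>)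
  next
    case False
    show ?thesis unfolding \<phi>_def
      by (rule smooth_real_deriv_zero[OF smooth_real_step, of "{1<..}" 1])
        (use False that in \<open>auto simp: step_1\<close>)
  qed
  define g where "g = (\<lambda>z. complex_of_real (\<phi> (Re z)))"
  have g: "g \<in> K_space w h" unfolding g_def by (rule K_space_compact_Re[OF mono \<phi> \<phi>0])
  \<comment> \<open>The factor 1/2 is that of \<open>dbar\<close>: a function of Re z alone has half
    its derivative as its \<open>dbar\<close>.\<close>
  obtain f where f: "f \<in> K_space w h" "\<And>z. z \<in> strip h \<Longrightarrow> dbar f z = (1/2) * g z"
    using bspec[OF surj[unfolded surj_op_def] K_space_cmult[OF g, of "1/2"]] by metis
  \<comment> \<open>The x-derivative of step(Re z) - f. The difference itself does not decay, but
    both terms of its derivative lie in the space.\<close>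
  define H where "H = (\<lambda>z. g z + (-1) * partial_x f z)"
  have fx: "partial_x f \<in> K_space w h" and fy: "partial_y f \<in> K_space w h"
    using K_space_partial[OF f(1)] by auto
  have H: "H \<in> K_space w h" unfolding H_def by (intro K_space_add K_space_cmult g fx)
  have Hd: "has_pd v H z (partial v g z + (-1) * partial v (partial_x f) z)" if "v \<in> dirs" "z \<in> strip h" for v z
    unfolding H_def by (intro has_pd_add has_pd_cmult K_space_has_pd[OF g] K_space_has_pd[OF fx] that)
  have "H holomorphic_on strip h"
  proof (rule C1_dbar_zero_holomorphic[OF open_strip])
    show "has_pd 1 H z (partial_x H z)" "has_pd \<i> H z (partial_y H z)" if "z \<in> strip h" for z
      using K_space_has_pd[OF H _ that] by auto
    show "continuous_on (strip h) (partial_y H)"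
      using K_space_partial[OF H ii_dirs] unfolding K_space_eq_smooth by (rule smooth_continuous)
    fix z assume z: "z \<in> strip h"
    have gy: "partial_y g z = 0"
      unfolding g_def using has_pd_Re[OF smooth_real_deriv(1)[OF \<phi>], of \<i> z] has_pd_imp_partial by fastforce
    have "partial_x (\<lambda>z. (1/2) * g z) z = (1/2) * (partial_x (partial_x f) z + \<i> * partial_x (partial_y f) z)"
    proof -
      have "has_pd 1 (\<lambda>z. (1/2) * (partial_x f z + \<i> * partial_y f z)) z
         ((1/2) * (partial_x (partial_x f) z + \<i> * partial_x (partial_y f) z))"
        by (intro has_pd_cmult has_pd_add K_space_has_pd[OF fx] K_space_has_pd[OF fy] one_dirs z)
      hence "has_pd 1 (\<lambda>z. (1/2) * g z) z
         ((1/2) * (partial_x (partial_x f) z + \<i> * partial_x (partial_y f) z))"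
        by (rule has_pd_cong_open[OF open_strip z, rotated]) (use f(2) in \<open>simp add: dbar_def\<close>)
      thus ?thesis by (rule has_pd_imp_partial)
    qed
    moreover have "partial_x (\<lambda>z. (1/2) * g z) z = (1/2) * partial_x g z"
      by (intro has_pd_imp_partial has_pd_cmult K_space_has_pd[OF g] one_dirs z)
    moreover have "partial_x (partial_y f) z = partial_y (partial_x f) z"
      using smooth_partials_commute[OF open_strip f(1)[unfolded K_space_eq_smooth] ii_dirs one_dirs z] .
    ultimately have gx: "partial_x g z = partial_x (partial_x f) z + \<i> * partial_y (partial_x f) z"
      by simp
    have "partial_x H z = partial_x g z + (-1) * partial_x (partial_x f) z"
      and "partial_y H z = partial_y g z + (-1) * partial_y (partial_x f) z"
      using Hd[OF _ z] by (auto intro: has_pd_imp_partial)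
    thus "partial_x H z + \<i> * partial_y H z = 0"
      unfolding gx gy by simp
  qed
  moreover have "\<exists>z\<in>strip h. H z \<noteq> 0"
  proof (rule ccontr)
    assume "\<not> (\<exists>z\<in>strip h. H z \<noteq> 0)"
    hence H0: "\<And>z. z \<in> strip h \<Longrightarrow> partial_x f z = g z" by (auto simp: H_def)
    \<comment> \<open>If H vanished, f - step would be constant on the real axis, and the decay of f
      at the two ends would force that constant to be both 0 and -1.\<close>
    define u where "u = (\<lambda>x::real. f (of_real x) - of_real (step x))"
    have real_strip: "complex_of_real x \<in> strip h" for x using h by (simp add: strip_def zero_ereal_def)
    have du: "(u has_vector_derivative 0) (at x within UNIV)" for x
    proof -
      have "has_pd 1 f (0 + x *\<^sub>R 1) (g (of_real x))"
        using K_space_has_pd[OF f(1) one_dirs real_strip[of x]] H0[OF real_strip[of x]]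
        by (simp add: scaleR_conv_of_real)
      from has_pd_shift[OF this]
      have "((\<lambda>x. f (of_real x)) has_vector_derivative of_real (\<phi> x)) (at x)"
        by (simp add: g_def scaleR_conv_of_real)
      moreover have "((\<lambda>x. complex_of_real (step x)) has_vector_derivative of_real (\<phi> x)) (at x)"
        using smooth_real_deriv(1)[OF smooth_real_step, of x] unfolding \<phi>_def has_real_derivative_iff_has_vector_derivative
        by (rule bounded_linear.has_vector_derivative[OF bounded_linear_of_real])
      ultimately show ?thesis unfolding u_def using has_vector_derivative_diff by fastforce
    qed
    have "\<exists>c. \<forall>x\<in>UNIV. u x = c"
      by (rule has_vector_derivative_zero_constant[OF convex_UNIV du])  blast
    then obtain c where c: "\<And>x. u x = c" by auto
    have "f (of_real ((1::real) * x)) = c + 1" if "x \<ge> 1" for x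
      using c[of x] step_1[OF that] by (simp add: u_def algebra_simps)
    hence "c + 1 = 0"
      using K_space_constant_imp_zero[OF unb mono h f(1), of 1 "c + 1"] by (metis abs_1)
    moreover have "f (of_real ((- 1::real) * x)) = c" if "x \<ge> 1" for x
      using c[of "- x"] step_0[of "- x"] that by (simp add: u_def)
    hence "c = 0"
      using K_space_constant_imp_zero[OF unb mono h f(1), of "- 1" c] by (metis abs_1 abs_minus_cancel)
    ultimately show False by simp
  qed
  ultimately show ?thesis using H by blast
qed

subsection \<open>Convolution with a fundamental solution in polar coordinates\<close>

text \<open>Termwise differentiation along a line: the derivatives must be uniformly summable, the
  series itself only pointwise.\<close>

lemma has_pd_suminf:
  assumes U: "open U" "z \<in> U"
    and F: "\<And>n y. y \<in> U \<Longrightarrow> has_pd v (F n) y (F' n y)"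
    and B: "summable B" "\<And>n y. y \<in> U \<Longrightarrow> cmod (F' n y) \<le> B n"
    and sF: "\<And>y. y \<in> U \<Longrightarrow> summable (\<lambda>n. F n y)"
  shows "has_pd v (\<lambda>z. \<Sum>n. F n z) z (\<Sum>n. F' n z)"
proof -
  have "((\<lambda>t::real. z + t *\<^sub>R v) \<longlongrightarrow> z + 0 *\<^sub>R v) (at 0)" by (intro tendsto_intros)
  hence "eventually (\<lambda>t::real. z + t *\<^sub>R v \<in> U) (at 0)"
    using U by (simp add: topological_tendstoD)
  then obtain d where d: "d > 0" "\<And>t::real. \<bar>t\<bar> < d \<Longrightarrow> z + t *\<^sub>R v \<in> U"
    using U(2) unfolding eventually_at by (auto simp: dist_real_def) (metis add.right_neutral scaleR_zero_left)
  define S where "S = {-d<..<d}"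
  have inU: "z + t *\<^sub>R v \<in> U" if "t \<in> S" for t using d that by (auto simp: S_def)
  have ul: "uniform_limit U (\<lambda>n y. \<Sum>i<n. F' i y) (\<lambda>y. \<Sum>i. F' i y) sequentially"
    by (rule Weierstrass_m_test[OF B(2) B(1)])
  have "\<exists>g. \<forall>t\<in>S. (\<lambda>n. F n (z + t *\<^sub>R v)) sums g t \<and>
     (g has_derivative (\<lambda>s. s *\<^sub>R (\<Sum>n. F' n (z + t *\<^sub>R v)))) (at t within S)"
  proof (rule has_derivative_series[where f'="\<lambda>n t s. s *\<^sub>R F' n (z + t *\<^sub>R v)" and x=0])
    show "convex S" "0 \<in> S" using d by (auto simp: S_def)
    show "((\<lambda>t. F n (z + t *\<^sub>R v)) has_derivative (\<lambda>s. s *\<^sub>R F' n (z + t *\<^sub>R v))) (at t within S)"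
      if "t \<in> S" for n t
      using has_pd_shift[OF F[OF inU[OF that]]] unfolding has_vector_derivative_def
      by (rule has_derivative_at_withinI)
    show "(\<lambda>n. F n (z + 0 *\<^sub>R v)) sums (\<Sum>n. F n z)" using sF[OF U(2)] by (simp add: summable_sums)
    fix e :: real assume e: "e > 0"
    from uniform_limitD[OF ul e]
    show "\<forall>\<^sub>F n in sequentially. \<forall>t\<in>S. \<forall>s. norm ((\<Sum>i<n. s *\<^sub>R F' i (z + t *\<^sub>R v)) -
        s *\<^sub>R (\<Sum>n. F' n (z + t *\<^sub>R v))) \<le> e * norm s"
    proof eventually_elim
      case (elim n)
      show ?case
      proof (intro ballI allI)
        fix t s assume t: "t \<in> S"
        have "(\<Sum>i<n. s *\<^sub>R F' i (z + t *\<^sub>R v)) - s *\<^sub>R (\<Sum>n. F' n (z + t *\<^sub>R v))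
          = s *\<^sub>R ((\<Sum>i<n. F' i (z + t *\<^sub>R v)) - (\<Sum>n. F' n (z + t *\<^sub>R v)))"
          by (simp add: scaleR_sum_right scaleR_diff_right)
        moreover have "norm ((\<Sum>i<n. F' i (z + t *\<^sub>R v)) - (\<Sum>n. F' n (z + t *\<^sub>R v))) \<le> e"
          using elim inU[OF t] by (auto simp: dist_norm less_imp_le)
        ultimately show "norm ((\<Sum>i<n. s *\<^sub>R F' i (z + t *\<^sub>R v)) - s *\<^sub>R (\<Sum>n. F' n (z + t *\<^sub>R v))) \<le> e * norm s"
          by (auto simp: mult.commute[of e] intro!: mult_left_mono)
      qed
    qed
  qed
  then obtain g where g: "\<And>t. t \<in> S \<Longrightarrow> (\<lambda>n. F n (z + t *\<^sub>R v)) sums g t"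
    "\<And>t. t \<in> S \<Longrightarrow> (g has_derivative (\<lambda>s. s *\<^sub>R (\<Sum>n. F' n (z + t *\<^sub>R v)))) (at t within S)" by blast
  have 0: "0 \<in> S" and oS: "open S" using d by (auto simp: S_def)
  have "(g has_derivative (\<lambda>s. s *\<^sub>R (\<Sum>n. F' n z))) (at 0)"
    using g(2)[OF 0] at_within_open[OF 0 oS] by simp
  moreover have "g t = (\<Sum>n. F n (z + t *\<^sub>R v))" if "t \<in> S" for t using g(1)[OF that] by (rule sums_unique)
  ultimately have "((\<lambda>t. \<Sum>n. F n (z + t *\<^sub>R v)) has_derivative (\<lambda>s. s *\<^sub>R (\<Sum>n. F' n z))) (at 0)"
    by (rule has_derivative_transform_within_open[OF _ oS 0])
  thus ?thesis by (simp add: has_pd_def has_vector_derivative_def)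
qed

definition rapid :: "(real \<Rightarrow> real) \<Rightarrow> complex set \<Rightarrow> (complex \<Rightarrow> complex) \<Rightarrow> bool" where
  "rapid w S G \<longleftrightarrow> (\<forall>N::nat. \<exists>A. \<forall>z. weight w N z * cmod (G z) \<le> A) \<and> (\<forall>z. z \<notin> S \<longrightarrow> G z = 0)"

lemma rapid_local: "local_to UNIV (rapid w S)"
proof -
  have "f = g" if "\<forall>z\<in>UNIV. f z = g z" for f g :: "complex \<Rightarrow> complex" using that by auto
  thus ?thesis unfolding local_to_def by blast
qed

text \<open>The extra factor exp |Re \<omega>| leaves integrable decay after the weights are spent,
  and E 0 = 1 gives the singularity of a fundamental solution. The width c is arbitrary because
  differences of points from two strips fill a wider one.\<close>

definition kernel :: "(real \<Rightarrow> real) \<Rightarrow> (complex \<Rightarrow> complex) \<Rightarrow> bool" where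
  "kernel w E \<longleftrightarrow> E holomorphic_on UNIV \<and> E 0 = 1 \<and>
     (\<forall>(N::nat) c. \<exists>K. \<forall>\<omega>. \<bar>Im \<omega>\<bar> \<le> c \<longrightarrow> exp (w (real N * \<bar>Re \<omega>\<bar>) + \<bar>Re \<omega>\<bar>) * cmod (E \<omega>) \<le> K)"

definition polar :: "real \<times> real \<Rightarrow> complex" where
  "polar p = of_real (fst p) * cis (snd p)"

lemma norm_polar [simp]: "cmod (polar p) = \<bar>fst p\<bar>"
  by (simp add: polar_def norm_mult)

lemma continuous_on_polar [continuous_intros]: "continuous_on S polar"
  unfolding polar_def[abs_def] cis_conv_exp by (intro continuous_intros)

text \<open>\<open>conv E G\<close> is the convolution of \<open>G\<close> with \<open>E \<omega> / (\<pi> \<omega>)\<close>, a fundamental solution of \<open>dbar\<close>,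
  written in polar coordinates \<open>\<omega> = r cis \<theta>\<close>: the Jacobian \<open>r\<close> cancels the singularity.
  The integral over \<open>r\<close> is split into unit intervals.\<close>

definition ring_integral :: "(complex \<Rightarrow> complex) \<Rightarrow> (complex \<Rightarrow> complex) \<Rightarrow> nat \<Rightarrow> complex \<Rightarrow> complex" where
  "ring_integral E G m z = integral (cbox (real m, 0) (real m + 1, 2 * pi))
     (\<lambda>p. G (z - polar p) * (E (polar p) * cis (- snd p)))"

definition conv :: "(complex \<Rightarrow> complex) \<Rightarrow> (complex \<Rightarrow> complex) \<Rightarrow> complex \<Rightarrow> complex" where
  "conv E G z = of_real (1 / pi) * (\<Sum>m. ring_integral E G m z)"

text \<open>|Re z| is at most twice the larger of |Re (z - \<omega>)| and |Re \<omega>|, so the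
  weight at N is at most the product of the weights at 2 N of the two factors. The spare exp |Re
  \<omega>| becomes exp(-|\<omega>|) up to exp c, since |Im \<omega>| \<le> c.\<close>

lemma kernel_bound:
  assumes nonneg: "\<And>t. 0 \<le> t \<Longrightarrow> 0 \<le> w t" and mono: "mono_on {0..} w"
    and A: "\<And>\<zeta>. weight w (2 * N) \<zeta> * cmod (G \<zeta>) \<le> A"
    and S: "\<And>\<zeta>. \<zeta> \<notin> S \<Longrightarrow> G \<zeta> = 0"
    and K: "\<And>\<omega>. z - \<omega> \<in> S \<Longrightarrow> \<bar>Im \<omega>\<bar> \<le> c \<and> exp (w (real (2 * N) * \<bar>Re \<omega>\<bar>) + \<bar>Re \<omega>\<bar>) * cmod (E \<omega>) \<le> K"
    and K0: "K \<ge> 0"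
  shows "weight w N z * cmod (G (z - \<omega>) * E \<omega>) \<le> A * K * exp c * exp (- cmod \<omega>)"
proof (cases "z - \<omega> \<in> S")
  case False
  have "A \<ge> 0" using A[of 0] by (smt (verit) exp_ge_zero norm_ge_zero mult_nonneg_nonneg)
  thus ?thesis using S[OF False] K0 by simp
next
  case True
  define a b where "a = \<bar>Re (z - \<omega>)\<bar>" and "b = \<bar>Re \<omega>\<bar>"
  have ab: "a \<ge> 0" "b \<ge> 0" "\<bar>Re z\<bar> \<le> a + b" by (auto simp: a_def b_def)
  have A0: "A \<ge> 0" using A[of 0] by (smt (verit) exp_ge_zero norm_ge_zero mult_nonneg_nonneg)
  have w_le: "w (real N * \<bar>Re z\<bar>) \<le> w (real (2 * N) * a) + w (real (2 * N) * b)"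
  proof (cases "a \<le> b")
    case True
    have "real N * \<bar>Re z\<bar> \<le> real (2 * N) * b"
      using mult_left_mono[of "\<bar>Re z\<bar>" "2 * b" "real N"] ab True by simp
    hence "w (real N * \<bar>Re z\<bar>) \<le> w (real (2 * N) * b)" using ab by (intro mono_onD[OF mono]) auto
    thus ?thesis using nonneg[of "real (2 * N) * a"] ab by simp
  next
    case False
    have "real N * \<bar>Re z\<bar> \<le> real (2 * N) * a"
      using mult_left_mono[of "\<bar>Re z\<bar>" "2 * a" "real N"] ab False by simp
    hence "w (real N * \<bar>Re z\<bar>) \<le> w (real (2 * N) * a)" using ab by (intro mono_onD[OF mono]) auto
    thus ?thesis using nonneg[of "real (2 * N) * b"] ab by simp
  qed
  have "cmod \<omega> \<le> b + c" using cmod_le[of \<omega>] K[OF True] by (simp add: b_def)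
  hence "1 \<le> exp c * exp (- cmod \<omega>) * exp b" by (simp add: exp_add[symmetric])
  hence "weight w N z * cmod (G (z - \<omega>) * E \<omega>) * 1
     \<le> (exp (w (real (2 * N) * a)) * exp (w (real (2 * N) * b))) * (cmod (G (z - \<omega>)) * cmod (E \<omega>)) * (exp c * exp (- cmod \<omega>) * exp b)"
    using w_le by (intro mult_mono) (auto simp: norm_mult exp_add[symmetric])
  also have "\<dots> = (exp (w (real (2 * N) * a)) * cmod (G (z - \<omega>))) * (exp (w (real (2 * N) * b) + b) * cmod (E \<omega>)) * (exp c * exp (- cmod \<omega>))"
    by (simp add: exp_add mult_ac)
  also have "\<dots> \<le> A * K * (exp c * exp (- cmod \<omega>))"
    using A[of "z - \<omega>"] K[OF True] A0 K0
    by (intro mult_right_mono mult_mono) (auto simp: a_def b_def)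
  finally show ?thesis by (simp add: mult_ac)
qed

lemma continuous_on_ring_integrand:
  assumes "continuous_on UNIV G" "E holomorphic_on UNIV"
  shows "continuous_on X (\<lambda>p. G (z - polar p) * (E (polar p) * cis (- snd p)))"
proof -
  have E: "continuous_on UNIV E" using assms(2) by (rule holomorphic_on_imp_continuous_on)
  show ?thesis unfolding cis_conv_exp
    by (intro continuous_intros continuous_on_compose2[OF assms(1)] continuous_on_compose2[OF E]) auto
qed

text \<open>The box of polar coordinates has measure 2 \<pi>, and |\<omega>| \<ge> m on it, whence a
  geometric bound in m.\<close>

lemma ring_integral_bound:
  assumes nonneg: "\<And>t. 0 \<le> t \<Longrightarrow> 0 \<le> w t" and mono: "mono_on {0..} w"
    and A: "\<And>\<zeta>. weight w (2 * N) \<zeta> * cmod (G \<zeta>) \<le> A"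
    and S: "\<And>\<zeta>. \<zeta> \<notin> S \<Longrightarrow> G \<zeta> = 0"
    and K: "\<And>\<omega>. z - \<omega> \<in> S \<Longrightarrow> \<bar>Im \<omega>\<bar> \<le> c \<and> exp (w (real (2 * N) * \<bar>Re \<omega>\<bar>) + \<bar>Re \<omega>\<bar>) * cmod (E \<omega>) \<le> K"
    and K0: "K \<ge> 0" and cG: "continuous_on UNIV G" and E: "E holomorphic_on UNIV"
  shows "weight w N z * cmod (ring_integral E G m z) \<le> 2 * pi * (A * K * exp c) * exp (- 1) ^ m"
proof -
  have A0: "A \<ge> 0" using A[of 0] by (smt (verit) exp_ge_zero norm_ge_zero mult_nonneg_nonneg)
  define B where "B = A * K * exp c * exp (- real m) / weight w N z"
  have "cmod (ring_integral E G m z) \<le> B * measure lborel (cbox (real m, 0) (real m + 1, 2 * pi))"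
    unfolding ring_integral_def
  proof (rule integrable_bound)
    show "B \<ge> 0" using A0 K0 by (simp add: B_def)
    show "(\<lambda>p. G (z - polar p) * (E (polar p) * cis (- snd p))) integrable_on cbox (real m, 0) (real m + 1, 2 * pi)"
      by (intro integrable_continuous continuous_on_ring_integrand cG E)
    fix p assume p: "p \<in> cbox (real m, 0) (real m + 1, 2 * pi)"
    hence "fst p \<ge> real m" by (cases p) (auto simp: cbox_Pair_eq)
    hence "exp (- cmod (polar p)) \<le> exp (- real m)" by simp
    hence "A * K * exp c * exp (- cmod (polar p)) \<le> A * K * exp c * exp (- real m)"
      using A0 K0 by (intro mult_left_mono) auto
    moreover have "weight w N z * cmod (G (z - polar p) * E (polar p))
        \<le> A * K * exp c * exp (- cmod (polar p))"
      by (rule kernel_bound[where S=S and w=w]) (fact nonneg mono A S K K0)+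
    ultimately have "weight w N z * cmod (G (z - polar p) * E (polar p)) \<le> A * K * exp c * exp (- real m)"
      by linarith
    thus "cmod (G (z - polar p) * (E (polar p) * cis (- snd p))) \<le> B"
      by (simp add: B_def norm_mult field_simps)
  qed
  also have "measure lborel (cbox (real m, 0) (real m + 1, 2 * pi)) = 2 * pi" by (simp add: content_Pair)
  finally show ?thesis
    by (simp add: B_def field_simps exp_of_nat_mult[symmetric])
qed

lemma exp_m1_geometric: "summable (\<lambda>m. exp (- 1 :: real) ^ m)" "(\<Sum>m. exp (- 1 :: real) ^ m) \<le> 2"
proof -
  have e: "exp (- 1 :: real) \<le> 1 / 2"
    using exp_ge_add_one_self[of "1::real"] by (simp add: exp_minus field_simps)
  thus "summable (\<lambda>m. exp (- 1 :: real) ^ m)" by (intro summable_geometric) simp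
  have "(\<Sum>m. exp (- 1 :: real) ^ m) = 1 / (1 - exp (- 1))" by (rule suminf_geometric) (use e in simp)
  also have "\<dots> \<le> 1 / (1 / 2)" by (rule divide_left_mono) (use e in \<open>auto simp: field_simps\<close>)
  finally show "(\<Sum>m. exp (- 1 :: real) ^ m) \<le> 2" by simp
qed

text \<open>The constant 4 is (1 / \<pi>) (2 \<pi>) 2, where the last 2 bounds the geometric series
  with ratio exp(-1).\<close>

lemma conv_bound:
  assumes nonneg: "\<And>t. 0 \<le> t \<Longrightarrow> 0 \<le> w t" and mono: "mono_on {0..} w"
    and A: "\<And>\<zeta>. weight w (2 * N) \<zeta> * cmod (G \<zeta>) \<le> A"
    and S: "\<And>\<zeta>. \<zeta> \<notin> S \<Longrightarrow> G \<zeta> = 0"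
    and K: "\<And>\<omega>. z - \<omega> \<in> S \<Longrightarrow> \<bar>Im \<omega>\<bar> \<le> c \<and> exp (w (real (2 * N) * \<bar>Re \<omega>\<bar>) + \<bar>Re \<omega>\<bar>) * cmod (E \<omega>) \<le> K"
    and K0: "K \<ge> 0" and cG: "continuous_on UNIV G" and E: "E holomorphic_on UNIV"
  shows "weight w N z * cmod (conv E G z) \<le> 4 * A * K * exp c"
proof -
  have A0: "A \<ge> 0" using A[of 0] by (smt (verit) exp_ge_zero norm_ge_zero mult_nonneg_nonneg)
  define D where "D = 2 * pi * (A * K * exp c) / weight w N z"
  have D0: "D \<ge> 0" using A0 K0 by (simp add: D_def)
  have le: "cmod (ring_integral E G m z) \<le> D * exp (- 1) ^ m" for m
  proof -
    have "weight w N z * cmod (ring_integral E G m z) \<le> 2 * pi * (A * K * exp c) * exp (- 1) ^ m"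
      by (rule ring_integral_bound[where S=S and w=w]) (fact nonneg mono A S K K0 cG E)+
    thus ?thesis by (simp add: D_def field_simps)
  qed
  have "cmod (\<Sum>m. ring_integral E G m z) \<le> (\<Sum>m. D * exp (- 1) ^ m)"
    by (rule norm_suminf_le[OF le summable_mult[OF exp_m1_geometric(1)]])
  also have "\<dots> = D * (\<Sum>m. exp (- 1) ^ m)" by (rule suminf_mult[OF exp_m1_geometric(1)])
  also have "\<dots> \<le> D * 2" using D0 exp_m1_geometric(2) by (intro mult_left_mono)
  finally have "cmod (conv E G z) \<le> (1 / pi) * (D * 2)"
    unfolding conv_def norm_mult norm_of_real by (intro mult_mono) auto
  thus ?thesis by (simp add: D_def field_simps)
qed

text \<open>Only the translate of G depends on z, so the derivative falls on G, under the integral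
  of a continuous function over a compact box.\<close>

lemma has_pd_ring_integral:
  assumes G: "\<And>z. has_pd v G z (G' z)" and cG: "continuous_on UNIV G" "continuous_on UNIV G'"
    and E: "E holomorphic_on UNIV"
  shows "has_pd v (ring_integral E G m) z (ring_integral E G' m z)"
proof -
  let ?box = "cbox (real m, 0) (real m + 1, 2 * pi) :: (real \<times> real) set"
  have cE: "continuous_on UNIV E" using E by (rule holomorphic_on_imp_continuous_on)
  have "((\<lambda>t. integral ?box (\<lambda>p. G (z + t *\<^sub>R v - polar p) * (E (polar p) * cis (- snd p))))
    has_vector_derivative integral ?box (\<lambda>p. G' (z + 0 *\<^sub>R v - polar p) * (E (polar p) * cis (- snd p)))) (at 0 within UNIV)"
  proof (rule leibniz_rule_vector_derivative)
    fix t :: real and p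
    have "((\<lambda>t. G ((z - polar p) + t *\<^sub>R v)) has_vector_derivative G' ((z - polar p) + t *\<^sub>R v)) (at t)"
      by (rule has_pd_shift[OF G])
    hence "((\<lambda>t. G ((z - polar p) + t *\<^sub>R v) * (E (polar p) * cis (- snd p))) has_vector_derivative
       G' ((z - polar p) + t *\<^sub>R v) * (E (polar p) * cis (- snd p))) (at t)"
      by (rule has_vector_derivative_mult_left)
    thus "((\<lambda>t. G (z + t *\<^sub>R v - polar p) * (E (polar p) * cis (- snd p))) has_vector_derivative
       G' (z + t *\<^sub>R v - polar p) * (E (polar p) * cis (- snd p))) (at t within UNIV)"
      by (simp add: algebra_simps)
  next
    fix t :: real
    show "(\<lambda>p. G (z + t *\<^sub>R v - polar p) * (E (polar p) * cis (- snd p))) integrable_on ?box"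
      by (intro integrable_continuous continuous_on_ring_integrand cG E)
  next
    show "continuous_on (UNIV \<times> ?box) (\<lambda>(t, p). G' (z + t *\<^sub>R v - polar p) * (E (polar p) * cis (- snd p)))"
      unfolding case_prod_beta cis_conv_exp
      by (intro continuous_intros continuous_on_compose2[OF cG(2)] continuous_on_compose2[OF cE]
          continuous_on_compose2[OF continuous_on_polar[of UNIV]]) auto
  qed auto
  thus ?thesis unfolding has_pd_def ring_integral_def[abs_def] by simp
qed

lemma kernel_bound_strip:
  assumes "kernel w E" "\<And>\<zeta>. \<zeta> \<in> S \<Longrightarrow> \<bar>Im \<zeta>\<bar> \<le> b"
  obtains K where "K \<ge> 0" "\<And>z \<omega>. \<bar>Im z\<bar> \<le> Y \<Longrightarrow> z - \<omega> \<in> S \<Longrightarrow>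
    \<bar>Im \<omega>\<bar> \<le> Y + b \<and> exp (w (real N * \<bar>Re \<omega>\<bar>) + \<bar>Re \<omega>\<bar>) * cmod (E \<omega>) \<le> K"
proof -
  obtain K where K: "\<And>\<omega>. \<bar>Im \<omega>\<bar> \<le> Y + b \<Longrightarrow> exp (w (real N * \<bar>Re \<omega>\<bar>) + \<bar>Re \<omega>\<bar>) * cmod (E \<omega>) \<le> K"
    using assms(1) unfolding kernel_def by blast
  show thesis
  proof (rule that[of "max K 0"])
    fix z \<omega> assume "\<bar>Im z\<bar> \<le> Y" "z - \<omega> \<in> S"
    hence "\<bar>Im \<omega>\<bar> \<le> Y + b" using assms(2)[of "z - \<omega>"] by simp
    thus "\<bar>Im \<omega>\<bar> \<le> Y + b \<and> exp (w (real N * \<bar>Re \<omega>\<bar>) + \<bar>Re \<omega>\<bar>) * cmod (E \<omega>) \<le> max K 0"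
      using K[of \<omega>] by simp
  qed simp
qed

context
  fixes w :: "real \<Rightarrow> real" and S :: "complex set" and b :: real and E :: "complex \<Rightarrow> complex"
  assumes nonneg: "\<And>t. 0 \<le> t \<Longrightarrow> 0 \<le> w t" and mono: "mono_on {0..} w"
    and S: "\<And>\<zeta>. \<zeta> \<in> S \<Longrightarrow> \<bar>Im \<zeta>\<bar> \<le> b" and E: "kernel w E"
begin

lemma E_hol: "E holomorphic_on UNIV"
  using E by (simp add: kernel_def)

lemma conv_wbd:
  assumes G: "rapid w S G" "continuous_on UNIV G"
  shows "\<exists>B. \<forall>z. \<bar>Im z\<bar> \<le> Y \<longrightarrow> weight w N z * cmod (conv E G z) \<le> B"
proof -
  obtain A where A: "\<And>\<zeta>. weight w (2 * N) \<zeta> * cmod (G \<zeta>) \<le> A"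
    using G(1) unfolding rapid_def by blast
  have S0: "\<And>\<zeta>. \<zeta> \<notin> S \<Longrightarrow> G \<zeta> = 0" using G(1) unfolding rapid_def by blast
  obtain K where K: "K \<ge> 0" "\<And>z \<omega>. \<bar>Im z\<bar> \<le> Y \<Longrightarrow> z - \<omega> \<in> S \<Longrightarrow>
    \<bar>Im \<omega>\<bar> \<le> Y + b \<and> exp (w (real (2 * N) * \<bar>Re \<omega>\<bar>) + \<bar>Re \<omega>\<bar>) * cmod (E \<omega>) \<le> K"
    using kernel_bound_strip[OF E S, where Y=Y and N="2 * N"] by blast
  show ?thesis
    by (intro exI[of _ "4 * A * K * exp (Y + b)"] allI impI)
      (rule conv_bound[OF nonneg mono A S0 K(2) K(1) G(2) E_hol])
qed

lemma ring_integral_summable_bound: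
  assumes G: "rapid w S G" "continuous_on UNIV G"
  shows "\<exists>C. \<forall>m z. \<bar>Im z\<bar> \<le> Y \<longrightarrow> cmod (ring_integral E G m z) \<le> C * exp (- 1) ^ m"
proof -
  obtain A where A: "\<And>\<zeta>. weight w (2 * 0) \<zeta> * cmod (G \<zeta>) \<le> A"
    using G(1) unfolding rapid_def by blast
  have S0: "\<And>\<zeta>. \<zeta> \<notin> S \<Longrightarrow> G \<zeta> = 0" using G(1) unfolding rapid_def by blast
  obtain K where K: "K \<ge> 0" "\<And>z \<omega>. \<bar>Im z\<bar> \<le> Y \<Longrightarrow> z - \<omega> \<in> S \<Longrightarrow>
    \<bar>Im \<omega>\<bar> \<le> Y + b \<and> exp (w (real (2 * 0) * \<bar>Re \<omega>\<bar>) + \<bar>Re \<omega>\<bar>) * cmod (E \<omega>) \<le> K"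
    using kernel_bound_strip[OF E S, where Y=Y and N="2 * 0"] by blast
  have "cmod (ring_integral E G m z) \<le> 2 * pi * (A * K * exp (Y + b)) * exp (- 1) ^ m" if "\<bar>Im z\<bar> \<le> Y" for m z
  proof -
    \<comment> \<open>\<open>weight w 0 z\<close> is the constant exp(w 0) \<ge> 1, so the case N =
      0 contains the unweighted bound.\<close>
    have "1 * cmod (ring_integral E G m z) \<le> weight w 0 z * cmod (ring_integral E G m z)"
      using nonneg by (intro mult_right_mono) auto
    also have "\<dots> \<le> 2 * pi * (A * K * exp (Y + b)) * exp (- 1) ^ m"
      by (rule ring_integral_bound[OF nonneg mono A S0 K(2)[OF that] K(1) G(2) E_hol])
    finally show ?thesis by simp
  qed
  thus ?thesis by blast
qed

lemma summable_ring_integral: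
  assumes G: "rapid w S G" "continuous_on UNIV G"
  shows "summable (\<lambda>m. ring_integral E G m z)"
proof -
  obtain C where "\<And>m. cmod (ring_integral E G m z) \<le> C * exp (- 1) ^ m"
    using ring_integral_summable_bound[OF G, of "\<bar>Im z\<bar>"] by blast
  thus ?thesis by (rule summable_comparison_test'[OF summable_mult[OF exp_m1_geometric(1)]])
qed

lemma has_pd_conv:
  assumes G: "smooth UNIV (rapid w S) G" and v: "v \<in> dirs"
  shows "has_pd v (conv E G) z (conv E (partial v G) z)"
proof -
  note G' = smooth_partial[OF G v]
  obtain C where C: "\<And>m y. \<bar>Im y\<bar> \<le> \<bar>Im z\<bar> + 1 \<Longrightarrow> cmod (ring_integral E (partial v G) m y) \<le> C * exp (- 1) ^ m"
    using ring_integral_summable_bound[OF smooth_prop[OF G'] smooth_continuous[OF G']] by blast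
  define U where "U = {y. \<bar>Im y\<bar> < \<bar>Im z\<bar> + 1}"
  have "open U" unfolding U_def by (intro open_Collect_less continuous_intros)
  hence "has_pd v (\<lambda>z. \<Sum>m. ring_integral E G m z) z (\<Sum>m. ring_integral E (partial v G) m z)"
  proof (rule has_pd_suminf)
    show "has_pd v (ring_integral E G m) y (ring_integral E (partial v G) m y)" for m y
      by (rule has_pd_ring_integral[OF smooth_has_pd[OF G v] smooth_continuous[OF G] smooth_continuous[OF G'] E_hol]) simp
    show "summable (\<lambda>m. C * exp (- 1) ^ m)" by (rule summable_mult[OF exp_m1_geometric(1)])
    show "summable (\<lambda>m. ring_integral E G m y)" for y
      by (rule summable_ring_integral[OF smooth_prop[OF G] smooth_continuous[OF G]])
  qed (use C in \<open>auto simp: U_def\<close>)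
  thus ?thesis unfolding conv_def[abs_def] by (rule has_pd_cmult)
qed

lemma continuous_on_conv:
  assumes G: "smooth UNIV (rapid w S) G"
  shows "continuous_on UNIV (conv E G)"
proof -
  have "isCont (conv E G) z" for z
  proof -
    define U where "U = {y. \<bar>Im y\<bar> < \<bar>Im z\<bar> + 1}"
    have U: "open U" unfolding U_def by (intro open_Collect_less continuous_intros)
    obtain C where C: "\<And>m y. \<bar>Im y\<bar> \<le> \<bar>Im z\<bar> + 1 \<Longrightarrow> cmod (ring_integral E G m y) \<le> C * exp (- 1) ^ m"
      using ring_integral_summable_bound[OF smooth_prop[OF G] smooth_continuous[OF G]] by blast
    have "uniform_limit U (\<lambda>n y. \<Sum>m<n. ring_integral E G m y) (\<lambda>y. \<Sum>m. ring_integral E G m y) sequentially"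
      by (rule Weierstrass_m_test[OF _ summable_mult[OF exp_m1_geometric(1), of C]]) (use C in \<open>auto simp: U_def\<close>)
    moreover have "continuous_on U (\<lambda>y. \<Sum>m<n. ring_integral E G m y)" for n
    proof -
      have "continuous_on UNIV (ring_integral E G m)" for m
      proof -
        show ?thesis
          unfolding ring_integral_def[abs_def]
        proof (rule integral_continuous_on_param)
          have cE: "continuous_on UNIV E" using E_hol by (rule holomorphic_on_imp_continuous_on)
          show "continuous_on (UNIV \<times> cbox (real m, 0) (real m + 1, 2 * pi))
            (\<lambda>(z, p). G (z - polar p) * (E (polar p) * cis (- snd p)))"
            unfolding case_prod_beta cis_conv_exp
            by (intro continuous_intros continuous_on_compose2[OF smooth_continuous[OF G]] continuous_on_compose2[OF cE]
               continuous_on_compose2[OF continuous_on_polar[of UNIV]]) auto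
        qed
      qed
      thus ?thesis by (intro continuous_on_sum) (auto intro: continuous_on_subset)
    qed
    ultimately have "continuous_on U (\<lambda>y. \<Sum>m. ring_integral E G m y)"
      by (intro uniform_limit_theorem[of _ "\<lambda>n y. \<Sum>m<n. ring_integral E G m y"]) auto
    hence "continuous_on U (conv E G)" unfolding conv_def[abs_def] by (intro continuous_intros)
    thus ?thesis using U by (auto simp: continuous_on_eq_continuous_at U_def)
  qed
  thus ?thesis by (simp add: continuous_at_imp_continuous_on)
qed

text \<open>Convolutions of E with rapid densities form a class stable under differentiation,
  because the derivative passes to the density; so coinduction applies.\<close>

lemma smooth_conv:
  assumes G: "smooth UNIV (rapid w S) G"
  shows "smooth (strip h) (wbd w h) (conv E G)"
proof (rule smooth_coinduct[OF open_strip wbd_local, where X="\<lambda>f. \<exists>G. smooth UNIV (rapid w S) G \<and> f = conv E G"])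
  fix f assume "\<exists>G. smooth UNIV (rapid w S) G \<and> f = conv E G"
  then obtain G where G: "smooth UNIV (rapid w S) G" and f: "f = conv E G" by blast
  have "continuous_on (strip h) f" unfolding f using continuous_on_conv[OF G] by (rule continuous_on_subset) simp
  moreover have "wbd w h f"
    unfolding f wbd_def using conv_wbd[OF smooth_prop[OF G] smooth_continuous[OF G]] by blast
  moreover have "\<exists>g. (\<exists>G. smooth UNIV (rapid w S) G \<and> g = conv E G) \<and> (\<forall>z\<in>strip h. has_pd v f z (g z))" if v: "v \<in> dirs" for v
    by (rule exI[of _ "conv E (partial v G)"]) (use smooth_partial[OF G v] has_pd_conv[OF G v] f in auto)
  ultimately show "continuous_on (strip h) f \<and> wbd w h f \<and> (\<forall>v\<in>dirs. \<exists>g.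
     (\<exists>G. smooth UNIV (rapid w S) G \<and> g = conv E G) \<and> (\<forall>z\<in>strip h. has_pd v f z (g z)))" by blast
qed (use G in blast)

lemma pd_conv:
  assumes G: "smooth UNIV (rapid w S) G" and "set vs \<subseteq> dirs"
  shows "pd vs (conv E G) = conv E (pd vs G)"
  using assms(2)
proof (induction vs)
  case (Cons v vs)
  hence "pd (v # vs) (conv E G) z = conv E (pd (v # vs) G) z" for z
    using has_pd_imp_partial[OF has_pd_conv[OF smooth_pd[OF G, of vs], of v z]] by simp
  thus ?case by blast
qed simp

end

section \<open>The convolution solves the inhomogeneous Cauchy-Riemann equation\<close>

definition circle_integral :: "(complex \<Rightarrow> complex) \<Rightarrow> (complex \<Rightarrow> complex) \<Rightarrow> real \<Rightarrow> complex \<Rightarrow> complex" where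
  "circle_integral E G r z = integral {0..2 * pi} (\<lambda>\<theta>. G (z - polar (r, \<theta>)) * E (polar (r, \<theta>)))"

text \<open>One chain rule for both polar coordinate lines: \<gamma> is later r cis \<theta> as a
  function of r and as a function of \<theta>. G has only a real differential, E a complex
  derivative.\<close>

lemma has_vector_derivative_along_path:
  assumes dG: "(G has_derivative (\<lambda>h. Re h *\<^sub>R gx + Im h *\<^sub>R gy)) (at (z - \<gamma> t))"
    and E: "E holomorphic_on UNIV" and \<gamma>: "(\<gamma> has_vector_derivative \<gamma>') (at t)"
  shows "((\<lambda>t. G (z - \<gamma> t) * E (\<gamma> t)) has_vector_derivative
     G (z - \<gamma> t) * (\<gamma>' * deriv E (\<gamma> t)) - (Re \<gamma>' *\<^sub>R gx + Im \<gamma>' *\<^sub>R gy) * E (\<gamma> t)) (at t)"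
proof -
  have "((\<lambda>t. z - \<gamma> t) has_vector_derivative - \<gamma>') (at t)"
    using has_vector_derivative_diff[OF has_vector_derivative_const \<gamma>] by simp
  hence "((\<lambda>t. G (z - \<gamma> t)) has_vector_derivative (Re (- \<gamma>') *\<^sub>R gx + Im (- \<gamma>') *\<^sub>R gy)) (at t)"
    unfolding has_vector_derivative_def
    using diff_chain_at[where f="\<lambda>t. z - \<gamma> t" and f'="\<lambda>s. s *\<^sub>R - \<gamma>'" and g=G, OF _ dG]
    by (simp add: o_def algebra_simps)
  moreover have "((\<lambda>t. E (\<gamma> t)) has_vector_derivative \<gamma>' * deriv E (\<gamma> t)) (at t)"
    using field_vector_diff_chain_at[OF \<gamma>, of E] holomorphic_derivI[OF E open_UNIV, of "\<gamma> t"]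
    by (simp add: o_def)
  ultimately show ?thesis by (drule_tac has_vector_derivative_mult) (auto simp: algebra_simps)
qed

text \<open>In polar coordinates \<open>2 cis (-\<theta>) dbar = \<partial>\<^sub>r + (i / r) \<partial>\<^sub>\<theta>\<close>; the angular part integrates to zero over
  full circles, and the radial part is integrated by the fundamental theorem of calculus.\<close>

lemma ring_integral_dbar:
  assumes Gx: "\<And>z. has_pd 1 G z (gx z)" and Gy: "\<And>z. has_pd \<i> G z (gy z)"
    and c: "continuous_on UNIV G" "continuous_on UNIV gx" "continuous_on UNIV gy"
    and E: "E holomorphic_on UNIV"
  shows "ring_integral E gx m z + \<i> * ring_integral E gy m z
    = circle_integral E G (real m) z - circle_integral E G (real m + 1) z"
proof -
  let ?box = "cbox (real m, 0) (real m + 1, 2 * pi) :: (real \<times> real) set"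
  let ?\<zeta> = "\<lambda>p. z - polar p"
  define u where "u = (\<lambda>p. G (?\<zeta> p) * E (polar p))"
  \<comment> \<open>a is the r-derivative of u, and r b is its \<theta>-derivative. Keeping the
    factor r out of b makes b continuous down to r = 0.\<close>
  define a where "a = (\<lambda>p. G (?\<zeta> p) * (cis (snd p) * deriv E (polar p))
      - (cos (snd p) *\<^sub>R gx (?\<zeta> p) + sin (snd p) *\<^sub>R gy (?\<zeta> p)) * E (polar p))"
  define b where "b = (\<lambda>p. G (?\<zeta> p) * (\<i> * cis (snd p) * deriv E (polar p))
      - ((- sin (snd p)) *\<^sub>R gx (?\<zeta> p) + cos (snd p) *\<^sub>R gy (?\<zeta> p)) * E (polar p))"
  have dG: "(G has_derivative (\<lambda>h. Re h *\<^sub>R gx \<zeta> + Im h *\<^sub>R gy \<zeta>)) (at \<zeta>)" for \<zeta>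
    by (rule C1_has_derivative[OF open_UNIV UNIV_I Gx Gy c(3)])
  have cE: "continuous_on UNIV E" using E by (rule holomorphic_on_imp_continuous_on)
  have cE': "continuous_on UNIV (deriv E)"
    by (rule holomorphic_on_imp_continuous_on[OF holomorphic_deriv[OF E open_UNIV]])
  have ca: "continuous_on X a" and cb: "continuous_on X b" for X
    unfolding a_def b_def cis_conv_exp
    by (intro continuous_intros continuous_on_compose2[OF c(1)] continuous_on_compose2[OF c(2)]
      continuous_on_compose2[OF c(3)] continuous_on_compose2[OF cE] continuous_on_compose2[OF cE']; simp)+
  have ur: "((\<lambda>r. u (r, \<theta>)) has_vector_derivative a (r, \<theta>)) (at r)" for r \<theta>
  proof -
    have "((\<lambda>r. polar (r, \<theta>)) has_vector_derivative cis \<theta>) (at r)"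
      unfolding polar_def by (auto intro!: derivative_eq_intros simp: has_vector_derivative_def scaleR_conv_of_real)
    from has_vector_derivative_along_path[OF dG E this] show ?thesis by (simp add: u_def a_def)
  qed
  have ut: "((\<lambda>\<theta>. u (r, \<theta>)) has_vector_derivative r *\<^sub>R b (r, \<theta>)) (at \<theta>)" for r \<theta>
  proof -
    have "((\<lambda>\<theta>. cis \<theta>) has_vector_derivative \<i> * cis \<theta>) (at \<theta>)"
      by (auto intro!: derivative_eq_intros simp: has_vector_derivative_def scaleR_conv_of_real)
    hence "((\<lambda>\<theta>. polar (r, \<theta>)) has_vector_derivative of_real r * (\<i> * cis \<theta>)) (at \<theta>)"
      unfolding polar_def fst_conv snd_conv by (rule has_vector_derivative_mult_right)
    from has_vector_derivative_along_path[OF dG E this] show ?thesis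
      by (simp add: u_def b_def scaleR_conv_of_real algebra_simps)
  qed
  have "ring_integral E gx m z + \<i> * ring_integral E gy m z
     = integral ?box (\<lambda>p. gx (?\<zeta> p) * (E (polar p) * cis (- snd p)) + \<i> * (gy (?\<zeta> p) * (E (polar p) * cis (- snd p))))"
    unfolding ring_integral_def
    by (subst integral_add)
      (auto intro!: integrable_continuous continuous_on_ring_integrand c E continuous_on_mult_left)
  \<comment> \<open>In a + i b the terms with \<open>deriv E\<close> cancel because cis \<theta> + i
    (i cis \<theta>) = 0; what remains is - cis(-\<theta>) (gx + i gy) E.\<close>
  also have "\<dots> = integral ?box (\<lambda>p. - (a p + \<i> * b p))"
  proof (rule integral_cong)
    fix p :: "real \<times> real"
    have cis_eq: "cis (- snd p) = of_real (cos (snd p)) - \<i> * of_real (sin (snd p))"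
      "cis (snd p) = of_real (cos (snd p)) + \<i> * of_real (sin (snd p))"
      by (simp_all add: complex_eq_iff)
    show "gx (?\<zeta> p) * (E (polar p) * cis (- snd p)) + \<i> * (gy (?\<zeta> p) * (E (polar p) * cis (- snd p)))
        = - (a p + \<i> * b p)"
      unfolding a_def b_def cis_eq scaleR_conv_of_real by (simp add: algebra_simps)
  qed
  also have "\<dots> = - (integral ?box a + \<i> * integral ?box b)"
    by (subst integral_neg, subst integral_add)
      (auto intro!: integrable_continuous ca cb continuous_on_mult_left)
  also have "integral ?box b = 0"
  proof -
    have "integral ?box b = integral (cbox (real m) (real m + 1)) (\<lambda>r. integral (cbox 0 (2 * pi)) (\<lambda>\<theta>. b (r, \<theta>)))"
      by (rule integral_prod_continuous[OF cb])
    also have "\<dots> = integral (cbox (real m) (real m + 1)) (\<lambda>r. 0)"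
    \<comment> \<open>At r = 0 the angular derivative r b says nothing about b, but a single radius
      is negligible.\<close>
    proof (rule integral_spike[of "{0}"])
      fix r assume "r \<in> cbox (real m) (real m + 1) - {0}"
      hence r: "r \<noteq> 0" by simp
      have "((\<lambda>\<theta>. r *\<^sub>R b (r, \<theta>)) has_integral u (r, 2 * pi) - u (r, 0)) {0..2 * pi}"
        by (rule fundamental_theorem_of_calculus) (auto intro: has_vector_derivative_at_within ut)
      moreover have "u (r, 2 * pi) = u (r, 0)" by (simp add: u_def polar_def)
      ultimately have "((\<lambda>\<theta>. r *\<^sub>R b (r, \<theta>)) has_integral 0) {0..2 * pi}" by simp
      hence "((\<lambda>\<theta>. (1 / r) *\<^sub>R (r *\<^sub>R b (r, \<theta>))) has_integral (1 / r) *\<^sub>R 0) {0..2 * pi}"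
        by (rule has_integral_cmul)
      hence "((\<lambda>\<theta>. b (r, \<theta>)) has_integral 0) {0..2 * pi}" using r by simp
      thus "0 = integral (cbox 0 (2 * pi)) (\<lambda>\<theta>. b (r, \<theta>))" by (simp add: integral_unique)
    qed simp
    finally show ?thesis by simp
  qed
  also have "integral ?box a = circle_integral E G (real m + 1) z - circle_integral E G (real m) z"
  proof -
    have "integral ?box a = integral (cbox (real m) (real m + 1)) (\<lambda>r. integral (cbox 0 (2 * pi)) (\<lambda>\<theta>. a (r, \<theta>)))"
      by (rule integral_prod_continuous[OF ca])
    \<comment> \<open>The order is exchanged so that the fundamental theorem of calculus applies to
      the inner, radial integral.\<close>
    also have "\<dots> = integral (cbox 0 (2 * pi)) (\<lambda>\<theta>. integral (cbox (real m) (real m + 1)) (\<lambda>r. a (r, \<theta>)))"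
      by (rule integral_swap_continuous) (use ca in \<open>simp add: case_prod_beta\<close>)
    also have "\<dots> = integral (cbox 0 (2 * pi)) (\<lambda>\<theta>. u (real m + 1, \<theta>) - u (real m, \<theta>))"
    proof (rule integral_cong)
      fix \<theta>
      have "((\<lambda>r. a (r, \<theta>)) has_integral u (real m + 1, \<theta>) - u (real m, \<theta>)) {real m..real m + 1}"
        by (rule fundamental_theorem_of_calculus) (auto intro: has_vector_derivative_at_within ur)
      thus "integral (cbox (real m) (real m + 1)) (\<lambda>r. a (r, \<theta>)) = u (real m + 1, \<theta>) - u (real m, \<theta>)"
        by (simp add: integral_unique)
    qed
    also have "\<dots> = circle_integral E G (real m + 1) z - circle_integral E G (real m) z"
    proof -
      have "(\<lambda>\<theta>. u (r, \<theta>)) integrable_on {0..2 * pi}" for r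
      proof -
        have "continuous_on {0..2 * pi} (\<lambda>\<theta>. u (r, \<theta>))"
          using has_vector_derivative_continuous[OF ut] by (simp add: continuous_at_imp_continuous_on)
        thus ?thesis by (rule integrable_continuous_real)
      qed
      thus ?thesis unfolding circle_integral_def u_def by (simp add: integral_diff)
    qed
    finally show ?thesis .
  qed
  finally show ?thesis by simp
qed

text \<open>The ring integrals of the two partial derivatives combine to differences of circle
  integrals, which telescope. Radius 0 contributes 2 \<pi> G z because E 0 = 1, and the circles of
  growing radius tend to 0 by the decay of the kernel.\<close>

lemma dbar_conv:
  assumes nonneg: "\<And>t. 0 \<le> t \<Longrightarrow> 0 \<le> w t" and mono: "mono_on {0..} w"
    and S: "\<And>\<zeta>. \<zeta> \<in> S \<Longrightarrow> \<bar>Im \<zeta>\<bar> \<le> b" and E: "kernel w E"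
    and G: "smooth UNIV (rapid w S) G"
  shows "dbar (conv E G) z = G z"
proof -
  have Eh: "E holomorphic_on UNIV" and E0: "E 0 = 1" using E by (auto simp: kernel_def)
  note Gx = smooth_partial[OF G one_dirs] and Gy = smooth_partial[OF G ii_dirs]
  have cE: "continuous_on UNIV E" using Eh by (rule holomorphic_on_imp_continuous_on)
  obtain A where A: "\<And>\<zeta>. weight w (2 * 0) \<zeta> * cmod (G \<zeta>) \<le> A"
    using smooth_prop[OF G] unfolding rapid_def by blast
  have S0: "\<And>\<zeta>. \<zeta> \<notin> S \<Longrightarrow> G \<zeta> = 0" using smooth_prop[OF G] unfolding rapid_def by blast
  obtain K where K: "K \<ge> 0" "\<And>y \<omega>. \<bar>Im y\<bar> \<le> \<bar>Im z\<bar> \<Longrightarrow> y - \<omega> \<in> S \<Longrightarrow>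
    \<bar>Im \<omega>\<bar> \<le> \<bar>Im z\<bar> + b \<and> exp (w (real (2 * 0) * \<bar>Re \<omega>\<bar>) + \<bar>Re \<omega>\<bar>) * cmod (E \<omega>) \<le> K"
    using kernel_bound_strip[OF E S, where Y="\<bar>Im z\<bar>" and N="2 * 0"] by blast
  define C where "C = A * K * exp (\<bar>Im z\<bar> + b)"
  have "(\<lambda>n. circle_integral E G (real n) z) \<longlonglongrightarrow> 0"
  proof (rule Lim_null_comparison)
    show "\<forall>\<^sub>F n in sequentially. norm (circle_integral E G (real n) z) \<le> 2 * pi * C * exp (- real n)"
    proof (intro always_eventually allI)
      fix n :: nat
      have "norm (circle_integral E G (real n) z) \<le> (C * exp (- real n)) * (2 * pi - 0)"
        unfolding circle_integral_def
      proof (rule integral_bound)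
        show "continuous_on {0..2 * pi} (\<lambda>\<theta>. G (z - polar (real n, \<theta>)) * E (polar (real n, \<theta>)))"
          by (intro continuous_intros continuous_on_compose2[OF smooth_continuous[OF G]] continuous_on_compose2[OF cE]
              continuous_on_compose2[OF continuous_on_polar[of UNIV]]) auto
        fix \<theta>
        have "1 * cmod (G (z - polar (real n, \<theta>)) * E (polar (real n, \<theta>)))
            \<le> weight w 0 z * cmod (G (z - polar (real n, \<theta>)) * E (polar (real n, \<theta>)))"
          using nonneg by (intro mult_right_mono) auto
        also have "\<dots> \<le> C * exp (- cmod (polar (real n, \<theta>)))"
          unfolding C_def by (rule kernel_bound[where S=S and w=w]) (fact nonneg mono A S0 K(1) | rule K(2)[OF order_refl], assumption)+
        finally show "cmod (G (z - polar (real n, \<theta>)) * E (polar (real n, \<theta>))) \<le> C * exp (- real n)" by simp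
      qed simp
      thus "norm (circle_integral E G (real n) z) \<le> 2 * pi * C * exp (- real n)" by (simp add: mult_ac)
    qed
    show "(\<lambda>n. 2 * pi * C * exp (- real n)) \<longlonglongrightarrow> 0" by real_asymp
  qed
  hence "(\<lambda>n. circle_integral E G (real n) z - circle_integral E G (real (Suc n)) z) sums (circle_integral E G (real 0) z - 0)"
    by (rule telescope_sums')
  moreover have "circle_integral E G (real 0) z = 2 * pi * G z"
    by (simp add: circle_integral_def polar_def E0 scaleR_conv_of_real)
  ultimately have "(\<lambda>m. ring_integral E (partial_x G) m z + \<i> * ring_integral E (partial_y G) m z) sums (2 * pi * G z)"
    using ring_integral_dbar[OF smooth_has_pd[OF G one_dirs] smooth_has_pd[OF G ii_dirs] smooth_continuous[OF G]
        smooth_continuous[OF Gx] smooth_continuous[OF Gy] Eh, of _ z] by (simp add: add.commute)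
  moreover have "(\<lambda>m. ring_integral E (partial_x G) m z + \<i> * ring_integral E (partial_y G) m z) sums
     ((\<Sum>m. ring_integral E (partial_x G) m z) + \<i> * (\<Sum>m. ring_integral E (partial_y G) m z))"
    by (intro sums_add sums_mult summable_sums
      summable_ring_integral[OF nonneg mono S E smooth_prop[OF Gx] smooth_continuous[OF Gx]]
      summable_ring_integral[OF nonneg mono S E smooth_prop[OF Gy] smooth_continuous[OF Gy]])
  ultimately have eq: "(\<Sum>m. ring_integral E (partial_x G) m z) + \<i> * (\<Sum>m. ring_integral E (partial_y G) m z) = 2 * pi * G z"
    by (metis sums_unique2)
  have "dbar (conv E G) z = (1 / 2) * (conv E (partial_x G) z + \<i> * conv E (partial_y G) z)"
    by (intro dbar_eqI has_pd_conv[OF nonneg mono S E G]) auto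
  also have "\<dots> = (1 / 2) * (of_real (1 / pi) * ((\<Sum>m. ring_integral E (partial_x G) m z) + \<i> * (\<Sum>m. ring_integral E (partial_y G) m z)))"
    unfolding conv_def by (simp add: algebra_simps)
  also have "\<dots> = G z" unfolding eq by simp
  finally show ?thesis .
qed

subsection \<open>Exhaustion of the strip\<close>

lemma smooth_real_mult: "smooth_real f \<Longrightarrow> smooth_real g \<Longrightarrow> smooth_real (\<lambda>x. f x * g x)"
  and smooth_real_add: "smooth_real f \<Longrightarrow> smooth_real g \<Longrightarrow> smooth_real (\<lambda>x. f x + g x)"
  and smooth_real_const: "smooth_real (\<lambda>_. c)"
  and smooth_real_affine: "smooth_real f \<Longrightarrow> smooth_real (\<lambda>x. f (a * x + b))"
  by (simp_all add: smooth_real_def smk_mult smk_add smk_affine)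

lemma smooth_real_diff: "smooth_real f \<Longrightarrow> smooth_real g \<Longrightarrow> smooth_real (\<lambda>x. f x - g x)"
  using smooth_real_add[of f "\<lambda>x. - 1 * g x"] smooth_real_mult[OF smooth_real_const, of g "-1"] by simp

text \<open>Convolution runs over the whole plane, while a function in the space may take any values
  outside the strip. As S is closed and contained in the strip, the strip and the complement of S
  form an open cover of the plane, and smoothness is local.\<close>

lemma smooth_UNIV_extend_zero:
  assumes S: "closed S" "S \<subseteq> strip h"
    and f: "smooth (strip h) (wbd_on w S) f"
    and 0: "\<And>z. z \<notin> S \<Longrightarrow> f z = 0"
  shows "smooth UNIV (rapid w S) f"
proof (rule smooth_coinduct[OF open_UNIV rapid_local, where X="\<lambda>f.
   smooth (strip h) (wbd_on w S) f \<and> (\<forall>z. z \<notin> S \<longrightarrow> f z = 0)"])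
  fix f
  assume "smooth (strip h) (wbd_on w S) f \<and> (\<forall>z. z \<notin> S \<longrightarrow> f z = 0)"
  hence f: "smooth (strip h) (wbd_on w S) f"
    and f0: "\<And>z. z \<notin> S \<Longrightarrow> f z = 0" by auto
  have zero: "has_pd v f z 0" if "z \<notin> S" for v z
    using has_pd_cong_open[of "- S" z "\<lambda>_. 0" f] S(1) that f0 has_pd_const by (auto simp: open_Compl)
  have "continuous_on (strip h \<union> - S) f"
  proof (rule continuous_on_open_Un[OF open_strip])
    show "open (- S)" using S(1) by (rule open_Compl)
    show "continuous_on (strip h) f" by (rule smooth_continuous[OF f])
    show "continuous_on (- S) f" using f0 continuous_on_cong[of "- S" "- S" f "\<lambda>_. 0"] by simp
  qed
  moreover have "strip h \<union> - S = UNIV" using S(2) by auto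
  ultimately have "continuous_on UNIV f" by simp
  moreover have "rapid w S f" unfolding rapid_def
  proof (intro conjI allI impI f0)
    fix N :: nat
    obtain A where "\<And>z. z \<in> S \<Longrightarrow> weight w N z * cmod (f z) \<le> A"
      using smooth_prop[OF f] unfolding wbd_on_def by blast
    hence "weight w N z * cmod (f z) \<le> max A 0" for z
      using f0[of z] by (cases "z \<in> S") (auto simp: le_max_iff_disj)
    thus "\<exists>A. \<forall>z. weight w N z * cmod (f z) \<le> A" by blast
  qed
  moreover have "\<exists>g. (smooth (strip h) (wbd_on w S) g \<and>
      (\<forall>z. z \<notin> S \<longrightarrow> g z = 0)) \<and> (\<forall>z\<in>UNIV. has_pd v f z (g z))" if v: "v \<in> dirs" for v
  proof (rule exI[of _ "partial v f"], intro conjI allI impI ballI)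
    show "smooth (strip h) (wbd_on w S) (partial v f)"
      by (rule smooth_partial[OF f v])
    show "partial v f z = 0" if "z \<notin> S" for z by (rule has_pd_imp_partial[OF zero[OF that]])
    show "has_pd v f z (partial v f z)" for z
      using smooth_has_pd[OF f v, of z] zero[of z v] has_pd_imp_partial[OF zero[of z v]] S(2) by (cases "z \<in> S") auto
  qed
  ultimately show "continuous_on UNIV f \<and> rapid w S f \<and> (\<forall>v\<in>dirs. \<exists>g.
      (smooth (strip h) (wbd_on w S) g \<and>
      (\<forall>z. z \<notin> S \<longrightarrow> g z = 0)) \<and> (\<forall>z\<in>UNIV. has_pd v f z (g z)))" by blast
qed (use f 0 in blast)

text \<open>The estimate for the cutoff factor in products: multiplication by such a function
  preserves weighted bounds on closed substrips.\<close>

definition bounded_on_strips :: "ereal \<Rightarrow> (complex \<Rightarrow> complex) \<Rightarrow> bool" where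
  "bounded_on_strips h a \<longleftrightarrow> (\<forall>b. ereal b < h \<longrightarrow> (\<exists>C. \<forall>z. \<bar>Im z\<bar> \<le> b \<longrightarrow> cmod (a z) \<le> C))"

lemma smooth_real_Im:
  assumes \<psi>: "smooth_real \<psi>"
  shows "smooth (strip h) (bounded_on_strips h) (\<lambda>z. of_real (\<psi> (Im z)))"
proof (rule smooth_coinduct[OF open_strip, where X="\<lambda>f. \<exists>\<psi>. smooth_real \<psi> \<and> f = (\<lambda>z. of_real (\<psi> (Im z)))"])
  have eq: "f z = g z" if "\<forall>z\<in>strip h. f z = g z" "\<bar>Im z\<bar> \<le> b" "ereal b < h" for f g :: "complex \<Rightarrow> complex" and z b
    using that by (auto simp: strip_def) (metis ereal_less_eq(3) order_le_less_trans)
  show "local_to (strip h) (bounded_on_strips h)"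
    unfolding local_to_def bounded_on_strips_def
  proof (intro allI impI)
    fix f g :: "complex \<Rightarrow> complex" and b
    assume fg: "\<forall>z\<in>strip h. f z = g z" and f: "\<forall>b. ereal b < h \<longrightarrow> (\<exists>C. \<forall>z. \<bar>Im z\<bar> \<le> b \<longrightarrow> cmod (f z) \<le> C)" and b: "ereal b < h"
    obtain C where "\<And>z. \<bar>Im z\<bar> \<le> b \<Longrightarrow> cmod (f z) \<le> C" using f b by blast
    thus "\<exists>C. \<forall>z. \<bar>Im z\<bar> \<le> b \<longrightarrow> cmod (g z) \<le> C" using eq[OF fg _ b] by metis
  qed
  show "\<exists>\<psi>'. smooth_real \<psi>' \<and> (\<lambda>z. complex_of_real (\<psi> (Im z))) = (\<lambda>z. of_real (\<psi>' (Im z)))"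
    using \<psi> by blast
  fix f assume "\<exists>\<psi>. smooth_real \<psi> \<and> f = (\<lambda>z. complex_of_real (\<psi> (Im z)))"
  then obtain \<psi> where \<psi>: "smooth_real \<psi>" and f: "f = (\<lambda>z. complex_of_real (\<psi> (Im z)))" by blast
  have "continuous_on (strip h) f" unfolding f
    by (intro continuous_intros continuous_on_compose2[OF smooth_real_continuous[OF \<psi>, of UNIV]]) auto
  moreover have "\<exists>C. \<forall>z. \<bar>Im z\<bar> \<le> b \<longrightarrow> cmod (f z) \<le> C" for b
  proof -
    have "bounded (\<psi> ` {-b..b})"
      by (intro compact_imp_bounded compact_continuous_image smooth_real_continuous \<psi>) simp
    then obtain C where "\<And>y. y \<in> {-b..b} \<Longrightarrow> \<bar>\<psi> y\<bar> \<le> C"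
      unfolding bounded_iff by (metis imageI real_norm_def)
    thus ?thesis unfolding f by (intro exI[of _ C] allI impI) (simp add: abs_le_iff)
  qed
  moreover have "\<exists>g. (\<exists>\<psi>. smooth_real \<psi> \<and> g = (\<lambda>z. complex_of_real (\<psi> (Im z)))) \<and> (\<forall>z\<in>strip h. has_pd v f z (g z))" for v
  proof (intro exI[of _ "\<lambda>z. of_real (Im v * deriv \<psi> (Im z))"] exI[of _ "\<lambda>x. Im v * deriv \<psi> x"] conjI ballI refl)
    show "smooth_real (\<lambda>x. Im v * deriv \<psi> x)"
      by (intro smooth_real_mult smooth_real_const smooth_real_deriv(2) \<psi>)
    show "has_pd v f z (of_real (Im v * deriv \<psi> (Im z)))" for z
      unfolding f by (rule has_pd_Im[OF smooth_real_deriv(1)[OF \<psi>]])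
  qed
  ultimately show "continuous_on (strip h) f \<and> bounded_on_strips h f \<and>
    (\<forall>v\<in>dirs. \<exists>g. (\<exists>\<psi>. smooth_real \<psi> \<and> g = (\<lambda>z. complex_of_real (\<psi> (Im z)))) \<and> (\<forall>z\<in>strip h. has_pd v f z (g z)))"
    unfolding bounded_on_strips_def by blast
qed

text \<open>The source of all densities convolved later: a member of the space times a cutoff in Im
  z supported in a closed substrip.\<close>

lemma smooth_cutoff:
  assumes g: "g \<in> K_space w h" and \<rho>: "smooth_real \<rho>"
    and T: "closed T" "\<And>y. y \<in> T \<Longrightarrow> \<bar>y\<bar> \<le> b" "0 < b" "ereal b < h" and 0: "\<And>y. y \<notin> T \<Longrightarrow> \<rho> y = 0"
  shows "smooth UNIV (rapid w {z. Im z \<in> T}) (\<lambda>z. of_real (\<rho> (Im z)) * g z)"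
proof (rule smooth_UNIV_extend_zero)
  let ?S = "{z. Im z \<in> T}"
  have S: "\<bar>Im z\<bar> \<le> b" if "z \<in> ?S" for z using T(2) that by simp
  have "closed (Im -` T)" by (intro closed_vimage T continuous_intros)
  thus "closed ?S" by (simp add: vimage_def)
  show sub: "?S \<subseteq> strip h"
  proof
    fix z assume "z \<in> ?S"
    hence "ereal \<bar>Im z\<bar> \<le> ereal b" using S by simp
    thus "z \<in> strip h" unfolding strip_def using T(4) order_le_less_trans by blast
  qed
  show "smooth (strip h) (wbd_on w ?S) (\<lambda>z. of_real (\<rho> (Im z)) * g z)"
  proof (rule smooth_mult[OF open_strip _ _ _ _ smooth_real_Im[OF \<rho>] g[unfolded K_space_eq_smooth]])
    show "local_to (strip h) (wbd_on w ?S)"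
      using sub unfolding local_to_def wbd_on_def by (metis subsetD)
    show "wbd_on w ?S (\<lambda>_. 0)" unfolding wbd_on_def by auto
    show "\<And>f g. wbd_on w ?S f \<Longrightarrow> wbd_on w ?S g \<Longrightarrow> wbd_on w ?S (\<lambda>z. f z + g z)" by (rule wbd_on_add)
  next
    fix a f :: "complex \<Rightarrow> complex"
    assume a: "bounded_on_strips h a" and f: "wbd w h f"
    show "wbd_on w ?S (\<lambda>z. a z * f z)" unfolding wbd_on_def
    proof
      fix N :: nat
      obtain C where C: "\<And>z. \<bar>Im z\<bar> \<le> b \<Longrightarrow> cmod (a z) \<le> C" using a T(4) unfolding bounded_on_strips_def by blast
      obtain A where A: "\<And>z. \<bar>Im z\<bar> \<le> b \<Longrightarrow> weight w N z * cmod (f z) \<le> A"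
        using f T(3,4) unfolding wbd_def by blast
      have C0: "C \<ge> 0" by (rule order_trans[OF norm_ge_zero C[of 0]]) (use T(3) in simp)
      have "weight w N z * cmod (a z * f z) \<le> C * A" if "z \<in> ?S" for z
      proof -
        have "cmod (a z) * (weight w N z * cmod (f z)) \<le> C * A"
          by (intro mult_mono C A S[OF that] C0) auto
        thus ?thesis by (simp add: norm_mult mult_ac)
      qed
      thus "\<exists>A. \<forall>z\<in>?S. weight w N z * cmod (a z * f z) \<le> A" by blast
    qed
  qed
qed (use 0 in auto)

text \<open>The class for coinduction consists of sums of sequences with summable weighted bounds
  for every word; termwise differentiation only appends a letter to the words.\<close>

lemma K_space_suminf:
  assumes F: "\<And>n. F n \<in> K_space w h" and nonneg: "\<And>t. 0 \<le> t \<Longrightarrow> 0 \<le> w t"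
    and B: "\<And>vs (N::nat) c. set vs \<subseteq> dirs \<Longrightarrow> 0 < c \<Longrightarrow> ereal c < h \<Longrightarrow> \<exists>B. summable B \<and>
      (\<forall>n z. \<bar>Im z\<bar> \<le> c \<longrightarrow> weight w N z * cmod (pd vs (F n) z) \<le> B n)"
  shows "(\<lambda>z. \<Sum>n. F n z) \<in> K_space w h"
    "z \<in> strip h \<Longrightarrow> (\<lambda>n. dbar (F n) z) sums dbar (\<lambda>z. \<Sum>n. F n z) z"
proof -
  define X where "X = (\<lambda>F. (\<forall>n::nat. smooth (strip h) (wbd w h) (F n)) \<and>
    (\<forall>vs (N::nat) c. set vs \<subseteq> dirs \<longrightarrow> 0 < c \<longrightarrow> ereal c < h \<longrightarrow> (\<exists>B. summable B \<and>
      (\<forall>n z. \<bar>Im z\<bar> \<le> c \<longrightarrow> weight w N z * cmod (pd vs (F n) z) \<le> B n))))"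
  have XF: "X F" unfolding X_def using F B by (auto simp: K_space_eq_smooth)
  have X_partial: "X (\<lambda>n. partial v (F n))" if X: "X F" and v: "v \<in> dirs" for F v
    unfolding X_def
  proof (intro conjI allI impI)
    show "smooth (strip h) (wbd w h) (partial v (F n))" for n
      using X v unfolding X_def by (blast intro: smooth_partial)
    fix vs and N :: nat and c :: real assume *: "set vs \<subseteq> dirs" "0 < c" "ereal c < h"
    hence "set (vs @ [v]) \<subseteq> dirs" using v by simp
    from X[unfolded X_def, THEN conjunct2, rule_format, OF this *(2,3), of N]
    show "\<exists>B. summable B \<and> (\<forall>n z. \<bar>Im z\<bar> \<le> c \<longrightarrow> weight w N z * cmod (pd vs (partial v (F n)) z) \<le> B n)"
      by simp
  qed
  have bound: "\<exists>B. summable B \<and> (\<forall>n z. \<bar>Im z\<bar> \<le> c \<longrightarrow> weight w N z * cmod (F n z) \<le> B n)"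
    if X: "X F" and c: "0 < c" "ereal c < h" for F c and N :: nat
    using X[unfolded X_def, THEN conjunct2, rule_format, of "[]" c N] c by simp
  have bound': "\<exists>B. summable B \<and> (\<forall>n z. \<bar>Im z\<bar> \<le> c \<longrightarrow> cmod (F n z) \<le> B n)"
    if X: "X F" and c: "0 < c" "ereal c < h" for F c
  proof -
    obtain B where B: "summable B" "\<And>n z. \<bar>Im z\<bar> \<le> c \<Longrightarrow> weight w 0 z * cmod (F n z) \<le> B n"
      using bound[OF X c, of 0] by blast
    have "cmod (F n z) \<le> B n" if "\<bar>Im z\<bar> \<le> c" for n z
    proof -
      have "1 * cmod (F n z) \<le> weight w 0 z * cmod (F n z)"
        using nonneg by (intro mult_right_mono) auto
      thus ?thesis using B(2)[OF that, of n] by linarith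
    qed
    thus ?thesis using B(1) by blast
  qed
  have nbhd: "\<exists>c>0. ereal c < h \<and> \<bar>Im z\<bar> < c" if "z \<in> strip h" for z
  proof -
    have "ereal \<bar>Im z\<bar> < h" using that by (simp add: strip_def)
    then obtain c where "ereal \<bar>Im z\<bar> < ereal c" "ereal c < h" using ereal_dense2 by blast
    thus ?thesis by (intro exI[of _ c]) auto
  qed
  have summ: "summable (\<lambda>n. F n z)" if X: "X F" and z: "z \<in> strip h" for F z
  proof -
    obtain c where c: "c > 0" "ereal c < h" "\<bar>Im z\<bar> < c" using nbhd[OF z] by blast
    obtain B where "summable B" "\<And>n. cmod (F n z) \<le> B n" using bound'[OF X c(1,2)] c(3) by (metis less_imp_le)
    thus ?thesis by (rule summable_comparison_test')
  qed
  have pd_sum: "has_pd v (\<lambda>z. \<Sum>n. F n z) z (\<Sum>n. partial v (F n) z)" if X: "X F" and v: "v \<in> dirs" and z: "z \<in> strip h" for F v z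
  proof -
    obtain c where c: "c > 0" "ereal c < h" "\<bar>Im z\<bar> < c" using nbhd[OF z] by blast
    obtain B where B: "summable B" "\<And>n y. \<bar>Im y\<bar> \<le> c \<Longrightarrow> cmod (partial v (F n) y) \<le> B n"
      using bound'[OF X_partial[OF X v] c(1,2)] by blast
    define U where "U = {y. \<bar>Im y\<bar> < c}"
    have Us: "y \<in> strip h" if "y \<in> U" for y
      using that c(2) unfolding U_def strip_def by (auto intro: less_trans[of _ "ereal c"])
    have "open U" unfolding U_def by (intro open_Collect_less continuous_intros)
    thus ?thesis
    proof (rule has_pd_suminf[OF _ _ _ B(1)])
      show "z \<in> U" using c by (simp add: U_def)
      show "has_pd v (F n) y (partial v (F n) y)" if "y \<in> U" for n y
        using X Us[OF that] v unfolding X_def by (blast intro: smooth_has_pd)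
      show "cmod (partial v (F n) y) \<le> B n" if "y \<in> U" for n y using B(2) that by (simp add: U_def)
      show "summable (\<lambda>n. F n y)" if "y \<in> U" for y by (rule summ[OF X Us[OF that]])
    qed
  qed
  show "(\<lambda>z. \<Sum>n. F n z) \<in> K_space w h"
    unfolding K_space_eq_smooth
  proof (rule smooth_coinduct[OF open_strip wbd_local, where X="\<lambda>f. \<exists>F. X F \<and> f = (\<lambda>z. \<Sum>n. F n z)"])
    fix f assume "\<exists>F. X F \<and> f = (\<lambda>z. \<Sum>n. F n z)"
    then obtain F where X: "X F" and f: "f = (\<lambda>z. \<Sum>n. F n z)" by blast
    have "isCont f z" if z: "z \<in> strip h" for z
    proof -
      obtain c where c: "c > 0" "ereal c < h" "\<bar>Im z\<bar> < c" using nbhd[OF z] by blast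
      define U where "U = {y. \<bar>Im y\<bar> < c}"
      have Us: "U \<subseteq> strip h"
        using c(2) unfolding U_def strip_def by (auto intro: less_trans[of _ "ereal c"])
      have U: "open U" unfolding U_def by (intro open_Collect_less continuous_intros)
      obtain B where B: "summable B" "\<And>n y. \<bar>Im y\<bar> \<le> c \<Longrightarrow> cmod (F n y) \<le> B n"
        using bound'[OF X c(1,2)] by blast
      have "uniform_limit U (\<lambda>m y. \<Sum>n<m. F n y) f sequentially"
        unfolding f by (rule Weierstrass_m_test[OF _ B(1)]) (use B(2) in \<open>auto simp: U_def\<close>)
      moreover have "continuous_on U (\<lambda>y. \<Sum>n<m. F n y)" for m
        using X Us unfolding X_def by (intro continuous_on_sum continuous_on_subset[OF smooth_continuous]) auto
      ultimately have "continuous_on U f"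
        by (intro uniform_limit_theorem[of _ "\<lambda>m y. \<Sum>n<m. F n y"]) auto
      thus ?thesis using U c(3) by (auto simp: continuous_on_eq_continuous_at U_def)
    qed
    hence "continuous_on (strip h) f" by (simp add: continuous_at_imp_continuous_on)
    moreover have "wbd w h f" unfolding wbd_def
    proof (intro allI impI)
      fix N :: nat and c :: real assume c: "0 < c \<and> ereal c < h"
      obtain B where B: "summable B" "\<And>n z. \<bar>Im z\<bar> \<le> c \<Longrightarrow> weight w N z * cmod (F n z) \<le> B n"
        using bound[OF X, of c N] c by blast
      have "weight w N z * cmod (f z) \<le> (\<Sum>n. B n)" if "\<bar>Im z\<bar> \<le> c" for z
      proof -
        let ?e = "weight w N z"
        have "cmod (F n z) \<le> B n / ?e" for n using B(2)[OF that, of n] by (simp add: field_simps)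
        hence "cmod (f z) \<le> (\<Sum>n. B n / ?e)" unfolding f by (rule norm_suminf_le) (rule summable_divide[OF B(1)])
        also have "\<dots> = (\<Sum>n. B n) / ?e" by (rule suminf_divide[OF B(1)])
        finally show ?thesis by (simp add: field_simps)
      qed
      thus "\<exists>B. \<forall>z. \<bar>Im z\<bar> \<le> c \<longrightarrow> weight w N z * cmod (f z) \<le> B" by blast
    qed
    moreover have "\<exists>g. (\<exists>F. X F \<and> g = (\<lambda>z. \<Sum>n. F n z)) \<and> (\<forall>z\<in>strip h. has_pd v f z (g z))" if v: "v \<in> dirs" for v
    proof (rule exI[of _ "\<lambda>z. \<Sum>n. partial v (F n) z"], rule conjI)
      show "\<exists>F'. X F' \<and> (\<lambda>z. \<Sum>n. partial v (F n) z) = (\<lambda>z. \<Sum>n. F' n z)" using X_partial[OF X v] by blast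
      show "\<forall>z\<in>strip h. has_pd v f z (\<Sum>n. partial v (F n) z)" unfolding f using pd_sum[OF X v] by blast
    qed
    ultimately show "continuous_on (strip h) f \<and> wbd w h f \<and> (\<forall>v\<in>dirs. \<exists>g.
      (\<exists>F. X F \<and> g = (\<lambda>z. \<Sum>n. F n z)) \<and> (\<forall>z\<in>strip h. has_pd v f z (g z)))" by blast
  qed (use XF in blast)
  show "(\<lambda>n. dbar (F n) z) sums dbar (\<lambda>z. \<Sum>n. F n z) z" if z: "z \<in> strip h"
    unfolding dbar_def has_pd_imp_partial[OF pd_sum[OF XF one_dirs z]] has_pd_imp_partial[OF pd_sum[OF XF ii_dirs z]]
    by (intro sums_mult sums_add summable_sums summ[OF X_partial[OF XF] z]) auto
qed

lemma exhausting_sequence: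
  assumes "0 < h"
  obtains a :: "nat \<Rightarrow> real" where "0 < a 0" "\<And>n. a n < a (Suc n)" "\<And>n. ereal (a n) < h"
    "\<And>c. ereal c < h \<Longrightarrow> \<exists>n. c \<le> a n"
proof (cases h)
  case (real r)
  hence r: "r > 0" using assms by simp
  define a where "a = (\<lambda>n::nat. r * (1 - 1 / (real n + 2)))"
  have lim: "a \<longlonglongrightarrow> r" unfolding a_def using r by real_asymp
  show ?thesis
  proof (rule that[of a])
    show "0 < a 0" using r by (simp add: a_def)
    show "a n < a (Suc n)" for n unfolding a_def using r by (intro mult_strict_left_mono) (auto simp: field_simps)
    show "ereal (a n) < h" for n
      using r mult_strict_left_mono[of "1 - 1 / (real n + 2)" 1 r] by (simp add: a_def real)
    fix c assume "ereal c < h"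
    hence "eventually (\<lambda>n. c < a n) sequentially" using order_tendstoD(1)[OF lim, of c] real by simp
    thus "\<exists>n. c \<le> a n" by (metis eventually_sequentially less_imp_le order_refl)
  qed
next
  case PInf
  show ?thesis
    by (rule that[of "\<lambda>n. real n + 1"]) (auto simp: PInf, meson le_add_same_cancel1 linear order_trans real_arch_simple zero_le_one)
qed (use assms in auto)

lemma kernel_exists:
  assumes nonneg: "\<And>t. 0 \<le> t \<Longrightarrow> 0 \<le> w t" and mono: "mono_on {0..} w" and w: "subexp w"
  obtains P where "kernel w P"
proof -
  \<comment> \<open>The summand t supplies the factor exp |Re \<omega>| demanded of a
    kernel.\<close>
  define V where "V = (\<lambda>t. w t + t)"
  have "subexp V" unfolding subexp_def
  proof (intro allI impI)
    fix \<mu> :: real assume mu: "\<mu> > 0"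
    then obtain C where C: "\<And>t. t \<ge> 0 \<Longrightarrow> w t \<le> C * exp (\<mu> * t)" using w unfolding subexp_def by blast
    have "V t \<le> (C + 1 / \<mu>) * exp (\<mu> * t)" if "t \<ge> 0" for t
    proof -
      have "\<mu> * t \<le> exp (\<mu> * t)" using exp_ge_add_one_self[of "\<mu> * t"] by linarith
      hence "t \<le> 1 / \<mu> * exp (\<mu> * t)" using mu by (simp add: field_simps)
      thus ?thesis using C[OF that] by (simp add: V_def ring_distribs)
    qed
    thus "\<exists>C. \<forall>t\<ge>0. V t \<le> C * exp (\<mu> * t)" by blast
  qed
  moreover have "mono_on {0..} V" unfolding V_def using mono by (auto simp: mono_on_def intro: add_mono)
  moreover have "\<And>t. 0 \<le> t \<Longrightarrow> 0 \<le> V t" unfolding V_def using nonneg by (simp add: add_nonneg_nonneg)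
  ultimately obtain P where P: "P holomorphic_on UNIV" "P 0 = 1"
    "\<And>(N::nat) b. \<exists>B. \<forall>z. \<bar>Im z\<bar> \<le> b \<longrightarrow> exp (V (real N * \<bar>Re z\<bar>)) * cmod (P z) \<le> B"
    using rapidly_decaying_entire_function_exists by blast
  have "kernel w P" unfolding kernel_def
  proof (intro conjI P(1,2) allI)
    fix N :: nat and c
    \<comment> \<open>Suc N instead of N, because for N = 0 the linear part of V would be
      lost.\<close>
    obtain B where B: "\<And>z. \<bar>Im z\<bar> \<le> c \<Longrightarrow> exp (V (real (Suc N) * \<bar>Re z\<bar>)) * cmod (P z) \<le> B" using P(3) by blast
    have "exp (w (real N * \<bar>Re z\<bar>) + \<bar>Re z\<bar>) * cmod (P z) \<le> B" if "\<bar>Im z\<bar> \<le> c" for z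
    proof -
      have "w (real N * \<bar>Re z\<bar>) \<le> w (real (Suc N) * \<bar>Re z\<bar>)"
        by (intro mono_onD[OF mono] mult_right_mono) auto
      moreover have "1 * \<bar>Re z\<bar> \<le> real (Suc N) * \<bar>Re z\<bar>" by (intro mult_right_mono) auto
      ultimately have "exp (w (real N * \<bar>Re z\<bar>) + \<bar>Re z\<bar>) * cmod (P z) \<le> exp (V (real (Suc N) * \<bar>Re z\<bar>)) * cmod (P z)"
        unfolding V_def by (intro mult_right_mono) auto
      thus ?thesis using B[OF that] by linarith
    qed
    thus "\<exists>K. \<forall>z. \<bar>Im z\<bar> \<le> c \<longrightarrow> exp (w (real N * \<bar>Re z\<bar>) + \<bar>Re z\<bar>) * cmod (P z) \<le> K" by blast
  qed
  thus thesis by (rule that)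
qed

text \<open>The modulus of exp(-i \<tau> \<omega>) is exp(\<tau> Im \<omega>), which is bounded on
  every strip.\<close>

lemma kernel_tilt:
  assumes P: "kernel w P"
  shows "kernel w (\<lambda>\<omega>. P \<omega> * exp (- \<i> * of_real \<tau> * \<omega>))"
  unfolding kernel_def
proof (intro conjI allI)
  show "(\<lambda>\<omega>. P \<omega> * exp (- \<i> * of_real \<tau> * \<omega>)) holomorphic_on UNIV"
    using P unfolding kernel_def by (intro holomorphic_intros) auto
  show "P 0 * exp (- \<i> * of_real \<tau> * 0) = 1" using P by (simp add: kernel_def)
  fix N :: nat and c :: real
  obtain K where K: "\<And>\<omega>. \<bar>Im \<omega>\<bar> \<le> c \<Longrightarrow> exp (w (real N * \<bar>Re \<omega>\<bar>) + \<bar>Re \<omega>\<bar>) * cmod (P \<omega>) \<le> K"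
    using P unfolding kernel_def by blast
  have "exp (w (real N * \<bar>Re \<omega>\<bar>) + \<bar>Re \<omega>\<bar>) * cmod (P \<omega> * exp (- \<i> * of_real \<tau> * \<omega>)) \<le> max K 0 * exp (\<bar>\<tau>\<bar> * \<bar>c\<bar>)"
    if "\<bar>Im \<omega>\<bar> \<le> c" for \<omega>
  proof -
    have "\<tau> * Im \<omega> \<le> \<bar>\<tau>\<bar> * \<bar>c\<bar>"
      using abs_ge_self[of "\<tau> * Im \<omega>"] mult_mono[of "\<bar>\<tau>\<bar>" "\<bar>\<tau>\<bar>" "\<bar>Im \<omega>\<bar>" "\<bar>c\<bar>"] that by (simp add: abs_mult)
    hence "(exp (w (real N * \<bar>Re \<omega>\<bar>) + \<bar>Re \<omega>\<bar>) * cmod (P \<omega>)) * exp (\<tau> * Im \<omega>) \<le> max K 0 * exp (\<bar>\<tau>\<bar> * \<bar>c\<bar>)"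
      using K[OF that] by (intro mult_mono) auto
    thus ?thesis by (simp add: norm_mult mult_ac)
  qed
  thus "\<exists>K. \<forall>\<omega>. \<bar>Im \<omega>\<bar> \<le> c \<longrightarrow> exp (w (real N * \<bar>Re \<omega>\<bar>) + \<bar>Re \<omega>\<bar>) * cmod (P \<omega> * exp (- \<i> * of_real \<tau> * \<omega>)) \<le> K"
    by blast
qed

text \<open>Multiplying the kernel by \<open>exp (- i s M \<omega>)\<close> keeps its value at the origin, and makes it tiny on all
  differences \<open>\<omega> = z - \<zeta>\<close> with \<open>\<zeta>\<close> in the support of \<open>G\<close> and \<open>z\<close> in the smaller strip.\<close>

lemma kernel_with_small_conv_exists:
  assumes nonneg: "\<And>t. 0 \<le> t \<Longrightarrow> 0 \<le> w t" and mono: "mono_on {0..} w" and P: "kernel w P"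
    and S: "\<And>\<zeta>. \<zeta> \<in> S \<Longrightarrow> \<bar>Im \<zeta>\<bar> \<le> b" and s: "\<bar>s\<bar> = 1" and Sa: "\<And>\<zeta>. \<zeta> \<in> S \<Longrightarrow> a \<le> s * Im \<zeta>" and ca: "c < a"
    and G: "smooth UNIV (rapid w S) G" and W: "finite W" "\<And>vs. vs \<in> W \<Longrightarrow> set vs \<subseteq> dirs" and e: "e > 0"
  obtains E where "kernel w E"
    "\<And>vs z. vs \<in> W \<Longrightarrow> \<bar>Im z\<bar> \<le> c \<Longrightarrow> weight w N z * cmod (conv E (pd vs G) z) \<le> e"
proof -
  obtain K where K: "K \<ge> 0" "\<And>z \<omega>. \<bar>Im z\<bar> \<le> c \<Longrightarrow> z - \<omega> \<in> S \<Longrightarrow>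
    \<bar>Im \<omega>\<bar> \<le> c + b \<and> exp (w (real (2 * N) * \<bar>Re \<omega>\<bar>) + \<bar>Re \<omega>\<bar>) * cmod (P \<omega>) \<le> K"
    using kernel_bound_strip[OF P S, where Y=c and N="2 * N"] by blast
  have "\<forall>vs\<in>W. \<exists>A. \<forall>\<zeta>. weight w (2 * N) \<zeta> * cmod (pd vs G \<zeta>) \<le> A"
    using smooth_prop[OF smooth_pd[OF G W(2)]] unfolding rapid_def by blast
  then obtain A where A: "\<And>vs \<zeta>. vs \<in> W \<Longrightarrow> weight w (2 * N) \<zeta> * cmod (pd vs G \<zeta>) \<le> A vs"
    by metis
  have A0: "A vs \<ge> 0" if "vs \<in> W" for vs
    using A[OF that, of 0] by (smt (verit) exp_ge_zero norm_ge_zero mult_nonneg_nonneg)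
  \<comment> \<open>Summing over the finite set W makes one D, and so one tilt, serve all its
    words.\<close>
  define D where "D = 4 * (\<Sum>vs\<in>W. A vs) * K * exp (c + b)"
  \<comment> \<open>Chosen so that the factor exp(-M (a - c)) brings D below e; M \<ge> 0 lets the
    inequality s Im \<omega> \<le> -(a - c) be multiplied by M.\<close>
  define M where "M = max 0 (ln ((D + 1) / e) / (a - c))"
  have D0: "D \<ge> 0" unfolding D_def using A0 K(1) by (intro mult_nonneg_nonneg sum_nonneg) auto
  have M: "M \<ge> 0" "D * exp (- M * (a - c)) \<le> e"
  proof -
    have "ln ((D + 1) / e) / (a - c) \<le> M" by (simp add: M_def)
    hence "ln ((D + 1) / e) \<le> M * (a - c)" using ca by (simp add: pos_divide_le_eq)
    hence "(D + 1) / e \<le> exp (M * (a - c))" using D0 e by (metis add_nonneg_pos divide_pos_pos ln_le_cancel_iff exp_gt_zero ln_exp zero_less_one)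
    hence "D + 1 \<le> e * exp (M * (a - c))" using e by (simp add: field_simps)
    hence "D \<le> e * exp (M * (a - c))" by simp
    hence "D * exp (- M * (a - c)) \<le> e * exp (M * (a - c)) * exp (- M * (a - c))"
      by (rule mult_right_mono) simp
    thus "D * exp (- M * (a - c)) \<le> e" by (simp add: mult.assoc exp_add[symmetric])
  qed (simp add: M_def)
  define E where "E = (\<lambda>\<omega>. P \<omega> * exp (- \<i> * of_real (s * M) * \<omega>))"
  have E: "kernel w E" unfolding E_def by (rule kernel_tilt[OF P])
  hence Eh: "E holomorphic_on UNIV" by (simp add: kernel_def)
  show thesis
  proof (rule that[OF E])
    fix vs z assume vs: "vs \<in> W" and z: "\<bar>Im z\<bar> \<le> c"
    note Gvs = smooth_pd[OF G W(2)[OF vs]]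
    have KE: "\<bar>Im \<omega>\<bar> \<le> c + b \<and> exp (w (real (2 * N) * \<bar>Re \<omega>\<bar>) + \<bar>Re \<omega>\<bar>) * cmod (E \<omega>) \<le> K * exp (- M * (a - c))"
      if "z - \<omega> \<in> S" for \<omega>
    proof -
      have "\<bar>s * Im z\<bar> \<le> c" using z s by (simp add: abs_mult)
      moreover have "a \<le> s * Im z - s * Im \<omega>" using Sa[OF that] by (simp add: algebra_simps)
      ultimately have "s * Im \<omega> \<le> - (a - c)" by (auto simp: abs_le_iff)
      hence "s * M * Im \<omega> \<le> - M * (a - c)"
        using M(1) mult_left_mono[of "s * Im \<omega>" "- (a - c)" M] by (simp add: algebra_simps)
      hence "(exp (w (real (2 * N) * \<bar>Re \<omega>\<bar>) + \<bar>Re \<omega>\<bar>) * cmod (P \<omega>)) * exp (s * M * Im \<omega>) \<le> K * exp (- M * (a - c))"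
        using K(2)[OF z that] K(1) by (intro mult_mono) (auto simp: mult_ac)
      thus ?thesis using K(2)[OF z that] by (simp add: E_def norm_mult mult_ac)
    qed
    have "weight w N z * cmod (conv E (pd vs G) z) \<le> 4 * A vs * (K * exp (- M * (a - c))) * exp (c + b)"
    proof (rule conv_bound[where S=S])
      show "pd vs G \<zeta> = 0" if "\<zeta> \<notin> S" for \<zeta> using smooth_prop[OF Gvs] that unfolding rapid_def by blast
    qed (fact nonneg mono A[OF vs] Eh smooth_continuous[OF Gvs] | rule KE, assumption | use K(1) in simp)+
    also have "\<dots> \<le> 4 * (\<Sum>vs\<in>W. A vs) * (K * exp (- M * (a - c))) * exp (c + b)"
      using K(1) member_le_sum[OF vs, of A] A0 W(1) by (intro mult_right_mono) auto
    also have "\<dots> = D * exp (- M * (a - c))" by (simp add: D_def mult_ac)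
    also have "\<dots> \<le> e" by (rule M(2))
    finally show "weight w N z * cmod (conv E (pd vs G) z) \<le> e" .
  qed
qed

text \<open>Solves for the part of g on the side of the real axis selected by s. The n-th piece
  carries the cutoff \<sigma> n - \<sigma> (n + 1), supported where a n \<le> s Im z \<le> a (n +
  2), and for n \<ge> 1 the tilt of its kernel makes its convolution small on |Im z| \<le> a (n -
  1).\<close>

lemma dbar_solution_one_side:
  fixes s :: real and a :: "nat \<Rightarrow> real"
  assumes nonneg: "\<And>t. 0 \<le> t \<Longrightarrow> 0 \<le> w t" and mono: "mono_on {0..} w" and P: "kernel w P"
    and g: "g \<in> K_space w h" and s: "\<bar>s\<bar> = 1"
    and a: "0 < a 0" "\<And>n. a n < a (Suc n)" "\<And>n. ereal (a n) < h" "\<And>c. ereal c < h \<Longrightarrow> \<exists>n. c \<le> a n"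
  obtains f where "f \<in> K_space w h"
    "\<And>z. z \<in> strip h \<Longrightarrow> dbar f z = of_real (step ((s * Im z - a 0) / (a 1 - a 0))) * g z"
proof -
  define \<sigma> where "\<sigma> = (\<lambda>n y. step ((s * y - a n) / (a (Suc n) - a n)))"
  have \<sigma>0: "\<sigma> n y = 0" if "s * y \<le> a n" for n y
    unfolding \<sigma>_def using that a(2)[of n] by (intro step_0) (simp add: divide_nonpos_pos)
  have \<sigma>1: "\<sigma> n y = 1" if "s * y \<ge> a (Suc n)" for n y
    unfolding \<sigma>_def using that a(2)[of n] by (intro step_1) simp
  have \<sigma>s: "smooth_real (\<sigma> n)" for n
  proof -
    have "\<sigma> n = (\<lambda>y. step ((s / (a (Suc n) - a n)) * y + (- a n / (a (Suc n) - a n))))"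
      by (simp add: \<sigma>_def diff_divide_distrib)
    thus ?thesis by (simp only: smooth_real_affine[OF smooth_real_step])
  qed
  have amono: "a m \<le> a n" if "m \<le> n" for m n using lift_Suc_mono_le[of a m n] a(2) that less_imp_le by blast
  have a0: "0 < a n" for n using amono[of 0 n] a(1) by linarith
  define T where "T = (\<lambda>n. {y. a n \<le> s * y \<and> s * y \<le> a (n + 2)})"
  define S where "S = (\<lambda>n. {z. Im z \<in> T n})"
  define G where "G = (\<lambda>n z. of_real (\<sigma> n (Im z) - \<sigma> (Suc n) (Im z)) * g z)"
  have Tb: "\<bar>y\<bar> \<le> a (n + 2)" if "y \<in> T n" for n y
  proof -
    have "\<bar>y\<bar> = \<bar>s * y\<bar>" using s by (simp add: abs_mult)
    thus ?thesis using that a0[of n] by (simp add: T_def)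
  qed
  have G: "smooth UNIV (rapid w (S n)) (G n)" for n
    unfolding S_def G_def
  proof (rule smooth_cutoff[OF g smooth_real_diff[OF \<sigma>s \<sigma>s] _ Tb])
    show "closed (T n)" unfolding T_def
      by (intro closed_Collect_conj closed_Collect_le continuous_intros)
    show "\<sigma> n y - \<sigma> (Suc n) y = 0" if "y \<notin> T n" for y
    proof (cases "s * y < a n")
      case True
      hence "s * y \<le> a (Suc n)" using a(2)[of n] by simp
      thus ?thesis using \<sigma>0[of y n] \<sigma>0[of y "Suc n"] True by simp
    next
      case False
      hence "s * y \<ge> a (Suc (Suc n))" using that by (simp add: T_def)
      moreover from this have "s * y \<ge> a (Suc n)" using a(2)[of "Suc n"] by simp
      ultimately show ?thesis using \<sigma>1[of n y] \<sigma>1[of "Suc n" y] by simp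
    qed
  qed (use a0 a(3) in auto)
  \<comment> \<open>|Im z| \<le> -1 is void, so nothing is asked of the first piece; from then on, a
    (n - 1) leaves a gap below a n.\<close>
  define c where "c = (\<lambda>n. if n = 0 then - 1 else a (n - 1))"
  have c: "c n < a n" for n
    using a0[of n] a(2)[of "n - 1"] by (cases n) (auto simp: c_def)
  \<comment> \<open>A diagonal choice: stage n controls all words of length at most n, with weight
    index n, on |Im z| \<le> c n. Every fixed word, weight and closed substrip is thus covered from
    some stage on.\<close>
  define W where "W = (\<lambda>n. {vs. set vs \<subseteq> dirs \<and> length vs \<le> n})"
  have "finite (W n)" for n unfolding W_def by (rule finite_lists_length_le) (simp add: dirs_def)
  hence "\<exists>E. kernel w E \<and> (\<forall>vs\<in>W n. \<forall>z. \<bar>Im z\<bar> \<le> c n \<longrightarrow>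
      weight w n z * cmod (conv E (pd vs (G n)) z) \<le> (1/2) ^ n)" for n
  proof -
    obtain E where "kernel w E" "\<And>vs z. vs \<in> W n \<Longrightarrow> \<bar>Im z\<bar> \<le> c n \<Longrightarrow>
      weight w n z * cmod (conv E (pd vs (G n)) z) \<le> (1/2) ^ n"
    proof (rule kernel_with_small_conv_exists[where N=n, OF nonneg mono P _ s _ c[of n] G[of n] \<open>finite (W n)\<close>])
      show "\<bar>Im \<zeta>\<bar> \<le> a (n + 2)" if "\<zeta> \<in> S n" for \<zeta> using that Tb by (simp add: S_def)
      show "a n \<le> s * Im \<zeta>" if "\<zeta> \<in> S n" for \<zeta> using that by (simp add: S_def T_def)
    qed (auto simp: W_def)
    thus ?thesis by blast
  qed
  then obtain E where E: "\<And>n. kernel w (E n)" "\<And>n vs z. vs \<in> W n \<Longrightarrow> \<bar>Im z\<bar> \<le> c n \<Longrightarrow>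
      weight w n z * cmod (conv (E n) (pd vs (G n)) z) \<le> (1/2) ^ n"
    by metis
  have Sb: "\<bar>Im \<zeta>\<bar> \<le> a (n + 2)" if "\<zeta> \<in> S n" for \<zeta> n using that Tb by (simp add: S_def)
  define F where "F = (\<lambda>n. conv (E n) (G n))"
  have F: "F n \<in> K_space w h" for n
    unfolding F_def K_space_eq_smooth by (rule smooth_conv[OF nonneg mono Sb E(1) G])
  have B: "\<exists>B. summable B \<and>
      (\<forall>n z. \<bar>Im z\<bar> \<le> c' \<longrightarrow> weight w N z * cmod (pd vs (F n) z) \<le> B n)"
    if vs: "set vs \<subseteq> dirs" and c': "0 < c'" "ereal c' < h" for vs c' and N :: nat
  proof -
    obtain j where j: "c' \<le> a j" using a(4)[OF c'(2)] by blast
    define n0 where "n0 = Suc (max j (max N (length vs)))"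
    have "\<forall>n. \<exists>B. \<forall>z. \<bar>Im z\<bar> \<le> c' \<longrightarrow> weight w N z * cmod (pd vs (F n) z) \<le> B"
      using smooth_prop[OF smooth_pd[OF F[unfolded K_space_eq_smooth] vs]] c' unfolding wbd_def by blast
    then obtain B where B: "\<And>n z. \<bar>Im z\<bar> \<le> c' \<Longrightarrow> weight w N z * cmod (pd vs (F n) z) \<le> B n" by metis
    \<comment> \<open>The early pieces have some finite bound because they lie in the space; the
      later ones are bounded by 2^-n.\<close>
    define B' where "B' = (\<lambda>n. if n < n0 then B n else (1/2) ^ n)"
    have "summable B'"
      by (rule summable_cong[THEN iffD1, OF _ summable_geometric[of "1/2 :: real"]])
        (auto simp: B'_def eventually_sequentially intro!: exI[of _ n0])
    moreover have "weight w N z * cmod (pd vs (F n) z) \<le> B' n" if z: "\<bar>Im z\<bar> \<le> c'" for n z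
    proof (cases "n < n0")
      case True thus ?thesis using B[OF z] by (simp add: B'_def)
    next
      case False
      have "vs \<in> W n" using vs False by (simp add: W_def n0_def)
      moreover have "n \<noteq> 0" "j \<le> n - 1" using False by (auto simp: n0_def)
      hence "\<bar>Im z\<bar> \<le> c n"
        using z j amono[of j "n - 1"] by (simp add: c_def)
      ultimately have "weight w n z * cmod (pd vs (F n) z) \<le> (1/2) ^ n"
        using E(2) pd_conv[OF nonneg mono Sb E(1) G vs] by (simp add: F_def)
      moreover have "w (real N * \<bar>Re z\<bar>) \<le> w (real n * \<bar>Re z\<bar>)"
        using False by (intro mono_onD[OF mono] mult_right_mono) (auto simp: n0_def)
      hence "weight w N z * cmod (pd vs (F n) z) \<le> weight w n z * cmod (pd vs (F n) z)"
        by (intro mult_right_mono) auto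
      ultimately show ?thesis using False by (simp add: B'_def)
    qed
    ultimately show ?thesis by blast
  qed
  show thesis
  proof (rule that[OF K_space_suminf(1)[OF F nonneg B]])
    fix z assume z: "z \<in> strip h"
    have "dbar (F n) z = G n z" for n unfolding F_def by (rule dbar_conv[OF nonneg mono Sb E(1) G])
    hence 1: "(\<lambda>n. G n z) sums dbar (\<lambda>z. \<Sum>n. F n z) z"
      using K_space_suminf(2)[OF F nonneg B z] by simp
    \<comment> \<open>At each point the cutoffs vanish from some n on, since the a n exhaust the
      strip; so the sum of the pieces telescopes to the first cutoff.\<close>
    have "(\<lambda>n. \<sigma> n (Im z)) \<longlonglongrightarrow> 0"
    proof -
      have "ereal \<bar>Im z\<bar> < h" using z by (simp add: strip_def)
      then obtain n where n: "\<bar>Im z\<bar> \<le> a n" using a(4) by blast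
      have "s * Im z \<le> \<bar>Im z\<bar>" using s abs_ge_self[of "s * Im z"] by (simp add: abs_mult)
      hence "\<sigma> m (Im z) = 0" if "m \<ge> n" for m
        using n amono[OF that] by (intro \<sigma>0) linarith
      thus ?thesis by (intro tendsto_eventually) (auto simp: eventually_sequentially)
    qed
    hence "(\<lambda>n. \<sigma> n (Im z) - \<sigma> (Suc n) (Im z)) sums (\<sigma> 0 (Im z) - 0)" by (rule telescope_sums')
    hence "(\<lambda>n. complex_of_real (\<sigma> n (Im z) - \<sigma> (Suc n) (Im z))) sums of_real (\<sigma> 0 (Im z))"
      by (subst sums_of_real_iff) simp
    hence "(\<lambda>n. G n z) sums (of_real (\<sigma> 0 (Im z)) * g z)" unfolding G_def by (rule sums_mult2)
    with 1 have "dbar (\<lambda>z. \<Sum>n. F n z) z = of_real (\<sigma> 0 (Im z)) * g z" by (metis sums_unique2)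
    thus "dbar (\<lambda>z. \<Sum>n. F n z) z = of_real (step ((s * Im z - a 0) / (a 1 - a 0))) * g z"
      by (simp add: \<sigma>_def)
  qed
qed

text \<open>Two cutoffs split g into parts towards the upper edge, towards the lower edge and in the
  middle. The middle part is supported in |Im z| \<le> a 1 with a 1 < h, so a single convolution
  with the untilted P solves for it.\<close>

theorem subexp_imp_surj_dbar:
  assumes nonneg: "\<And>t. 0 \<le> t \<Longrightarrow> 0 \<le> w t" and mono: "mono_on {0..} w" and w: "subexp w" and h: "0 < h"
  shows "surj_op (strip h) (K_space w h) dbar"
  unfolding surj_op_def
proof
  fix g assume g: "g \<in> K_space w h"
  obtain P where P: "kernel w P" by (rule kernel_exists[OF nonneg mono w])
  obtain a :: "nat \<Rightarrow> real" where a: "0 < a 0" "\<And>n. a n < a (Suc n)" "\<And>n. ereal (a n) < h"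
    "\<And>c. ereal c < h \<Longrightarrow> \<exists>n. c \<le> a n" using exhausting_sequence[OF h] by blast
  define \<sigma> where "\<sigma> = (\<lambda>y. step ((y - a 0) / (a 1 - a 0)))"
  have a01: "a 0 < a 1" using a(2)[of 0] by simp
  obtain f1 where f1: "f1 \<in> K_space w h" "\<And>z. z \<in> strip h \<Longrightarrow> dbar f1 z = of_real (\<sigma> (Im z)) * g z"
    using dbar_solution_one_side[OF nonneg mono P g, of 1 a] a unfolding \<sigma>_def by auto
  obtain f2 where f2: "f2 \<in> K_space w h" "\<And>z. z \<in> strip h \<Longrightarrow> dbar f2 z = of_real (\<sigma> (- Im z)) * g z"
    using dbar_solution_one_side[OF nonneg mono P g, of "- 1" a] a unfolding \<sigma>_def by auto
  define T where "T = {- a 1..a 1}"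
  define G where "G = (\<lambda>z. of_real (1 - \<sigma> (Im z) - \<sigma> (- Im z)) * g z)"
  have \<sigma>s: "smooth_real (\<lambda>y. \<sigma> (s * y))" for s
  proof -
    have "(\<lambda>y. \<sigma> (s * y)) = (\<lambda>y. step ((s / (a 1 - a 0)) * y + (- a 0 / (a 1 - a 0))))"
      by (simp add: \<sigma>_def diff_divide_distrib)
    thus ?thesis by (simp only: smooth_real_affine[OF smooth_real_step])
  qed
  have \<sigma>01: "\<sigma> y = 0" if "y \<le> a 0" for y
    unfolding \<sigma>_def using that a01 by (intro step_0) (simp add: divide_nonpos_pos)
  have \<sigma>1: "\<sigma> y = 1" if "y \<ge> a 1" for y
    unfolding \<sigma>_def using that a01 by (intro step_1) simp
  have G: "smooth UNIV (rapid w {z. Im z \<in> T}) G" unfolding G_def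
  proof (rule smooth_cutoff[OF g])
    show "smooth_real (\<lambda>y. 1 - \<sigma> y - \<sigma> (- y))"
      using smooth_real_diff[OF smooth_real_diff[OF smooth_real_const \<sigma>s[of 1]] \<sigma>s[of "- 1"], of 1] by simp
    show "closed T" "\<And>y. y \<in> T \<Longrightarrow> \<bar>y\<bar> \<le> a 1" "0 < a 1" "ereal (a 1) < h"
      using a(1,3) a01 by (auto simp: T_def)
    show "1 - \<sigma> y - \<sigma> (- y) = 0" if "y \<notin> T" for y
    proof (cases "y > 0")
      case True
      hence "y \<ge> a 1" "- y \<le> a 0" using that a(1) a01 by (auto simp: T_def)
      thus ?thesis using \<sigma>1[of y] \<sigma>01[of "- y"] by simp
    next
      case False
      hence "- y \<ge> a 1" "y \<le> a 0" using that a(1) a01 by (auto simp: T_def)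
      thus ?thesis using \<sigma>1[of "- y"] \<sigma>01[of y] by simp
    qed
  qed
  have T: "\<bar>Im \<zeta>\<bar> \<le> a 1" if "\<zeta> \<in> {z. Im z \<in> T}" for \<zeta> using that by (auto simp: T_def)
  have f0: "conv P G \<in> K_space w h" unfolding K_space_eq_smooth by (rule smooth_conv[OF nonneg mono T P G])
  have "dbar (\<lambda>z. conv P G z + (f1 z + f2 z)) z = g z" if z: "z \<in> strip h" for z
  proof -
    have pd: "has_pd v (\<lambda>z. conv P G z + (f1 z + f2 z)) z (partial v (conv P G) z + (partial v f1 z + partial v f2 z))"
      if "v \<in> dirs" for v
      by (intro has_pd_add K_space_has_pd[OF f0] K_space_has_pd[OF f1(1)] K_space_has_pd[OF f2(1)] that z)
    have "dbar (\<lambda>z. conv P G z + (f1 z + f2 z)) z = dbar (conv P G) z + (dbar f1 z + dbar f2 z)"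
      unfolding dbar_eqI[OF pd[OF one_dirs] pd[OF ii_dirs]] by (simp add: dbar_def algebra_simps)
    also have "\<dots> = G z + (of_real (\<sigma> (Im z)) * g z + of_real (\<sigma> (- Im z)) * g z)"
      using dbar_conv[OF nonneg mono T P G, of z] f1(2)[OF z] f2(2)[OF z] by simp
    also have "\<dots> = g z" by (simp add: G_def algebra_simps)
    finally show ?thesis .
  qed
  moreover have "(\<lambda>z. conv P G z + (f1 z + f2 z)) \<in> K_space w h" by (intro K_space_add f0 f1(1) f2(1))
  ultimately show "\<exists>f\<in>K_space w h. \<forall>z\<in>strip h. dbar f z = g z" by blast
qed

theorem theorem1p1:
  fixes w :: "real \<Rightarrow> real" and h :: ereal
  assumes w_nonneg: "\<And>t. 0 \<le> t \<Longrightarrow> 0 \<le> w t"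
    and w_mono: "mono_on {0..} w"
    and w_unbounded: "\<not> bdd_above (w ` {0..})"
    and w_int: "\<exists>C>1. (\<integral>\<^sup>+t\<in>{0..}. ennreal (exp (w t - w (C * t))) \<partial>lborel) < \<infinity>"
    and h_pos: "0 < h"
  shows "(surj_op (strip h) (K_space w h) dbar \<longleftrightarrow>
            surj_op (strip h) (K_space w h) laplace) \<and>
         (surj_op (strip h) (K_space w h) laplace \<longleftrightarrow>
            (\<exists>f\<in>K_space w h. f holomorphic_on strip h \<and> (\<exists>z\<in>strip h. f z \<noteq> 0))) \<and>
         ((\<exists>f\<in>K_space w h. f holomorphic_on strip h \<and> (\<exists>z\<in>strip h. f z \<noteq> 0)) \<longleftrightarrow>
            (\<forall>\<mu>>0. (\<integral>\<^sup>+t\<in>{0..}. ennreal (w t * exp (- \<mu> * t)) \<partial>lborel) < \<infinity>))"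
  using surj_dbar_iff_laplace[of h w]
    surj_dbar_imp_holomorphic[OF w_unbounded w_mono h_pos]
    holomorphic_K_space_imp_subexp[OF w_nonneg w_mono, of _ h]
    subexp_imp_surj_dbar[OF w_nonneg w_mono _ h_pos]
    subexp_iff_nn_integral_finite[OF w_nonneg w_mono]
  by blast

end
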